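(* Let $d_1=2$, let $0<c<\infty$, and suppose $p,d_2\to\infty$ with $\lim_{d_2\to\infty}\frac{p}{d_1d_2}=c$. Let $W\in M_2(\mathbb C)\otimes M_{d_2}(\mathbb C)$ be the complex Wishart matrix, $W^{L}$ its left partial transpose, and $E_{ij}$ ($1\le i,j\le 2$) the standard matrix units of $M_2(\mathbb C)$ regarded as $E_{ij}\otimes I_{d_2}$. Then $\{W,W^{L},E_{ij}\}_{i,j=1}^2$ has a limit joint distribution $\{w,w^{L},e_{ij}\}_{i,j=1}^2$ in a non-commutative $*$-probability space $(\mathcal A,\varphi)$. Relative to the matrix units $\{e_{ij}\}_{i,j=1}^2$ write $$w=\frac12\begin{pmatrix} w_{11} & w_{12} \\ w_{21} & w_{22} \end{pmatrix},\qquad w^{L}=\frac12\begin{pmatrix} w_{11} & w_{21} \\ w_{12} & w_{22} \end{pmatrix}.$$ Then $$X_1=\begin{pmatrix} w_{11} & 0 \\ 0 & w_{22} \end{pmatrix}\quad\text{and}\quad X_2=\begin{pmatrix} 0 & w_{21} \\ w_{12} & 0 \end{pmatrix}$$ are free in $(\mathcal A,\varphi)$. Moreover $X_1$ has the Marchenko–Pastur distribution with parameter $2c$, and $X_2$ is an even operator all of whose even free cumulants are equal to $2c$.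
   Context: Complex Wishart matrix: let $G_1,\dots,G_{d_1}$ be $d_2\times p$ random matrices, $G_i=(g^{(i)}_{jk})_{jk}$, where all the $g^{(i)}_{jk}$ are independent complex Gaussian random variables with mean $0$ and $\mathrm E(|g^{(i)}_{jk}|^2)=1$. Put $W(i,j)=\frac1{d_2}G_iG_j^*$ and $W=\frac1{d_1}(W(i,j))_{i,j=1}^{d_1}$, a $d_1\times d_1$ block matrix with $d_2\times d_2$ blocks (here $d_1=2$). The left partial transpose is $W^{L}=\frac1{d_1}(W(j,i))_{ij}$. Limit joint distribution means: joint $*$-moments with respect to $\mathrm E\circ(\mathrm{tr}\otimes\mathrm{tr})$ ($\mathrm{tr}$ the normalized trace) converge to the corresponding joint $*$-moments with respect to $\varphi$. Block notation: the $e_{ij}$ are matrix units in $\mathcal A$, and a matrix $\begin{pmatrix} a_{11} & a_{12} \\ a_{21} & a_{22} \end{pmatrix}$ with entries in $e_{11}\mathcal A e_{11}$ denotes the element $\sum_{i,j}e_{i1}a_{ij}e_{1j}\in\mathcal A$; thus $w_{ij}=2e_{1i}we_{j1}\in e_{11}\mathcal Ae_{11}$, $X_1=2(e_{11}we_{11}+e_{22}we_{22})$, $X_2=2(e_{12}we_{12}+e_{21}we_{21})$, and $2w^{L}=X_1+X_2$. Marchenko–Pastur distribution with parameter $c'>0$: the probability measure all of whose free cumulants equal $c'$; it has density $\frac{\sqrt{(b-t)(t-a)}}{2\pi t}$ on $[a,b]$, with $a=(1-\sqrt{c'})^2$, $b=(1+\sqrt{c'})^2$, and an atom of weight $1-c'$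 at $0$ if $c'<1$. An operator is even if it is self-adjoint and all its odd moments are $0$. Free cumulants of $X_1,X_2$ are taken with respect to $\varphi$. *)

theory Defs
  imports
    "HOL-Probability.Probability"
    "Jordan_Normal_Form.Matrix"
    "Jordan_Normal_Form.Schur_Decomposition"
    "Jordan_Normal_Form.VS_Connect"
begin

section \<open>Non-commutative *-probability spaces\<close>

record 'b star_algebra = "(complex, 'b) module" +
  adj :: "'b \<Rightarrow> 'b"

text \<open>Complex unital *-algebras. The scalars are the field of complex numbers,
  packaged as a ring structure by \<^const>\<open>class_ring\<close>.\<close>

locale star_algebra = module "class_ring :: complex ring" A + ring A
  for A :: "'b star_algebra" (structure) +
  assumes smult_mult_left: "x \<in> carrier A \<Longrightarrow> y \<in> carrier A \<Longrightarrow>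
      (z \<odot> x) \<otimes> y = z \<odot> (x \<otimes> y)"
    and smult_mult_right: "x \<in> carrier A \<Longrightarrow> y \<in> carrier A \<Longrightarrow>
      x \<otimes> (z \<odot> y) = z \<odot> (x \<otimes> y)"
    and adj_closed: "x \<in> carrier A \<Longrightarrow> adj A x \<in> carrier A"
    and adj_adj: "x \<in> carrier A \<Longrightarrow> adj A (adj A x) = x"
    and adj_add: "x \<in> carrier A \<Longrightarrow> y \<in> carrier A \<Longrightarrow>
      adj A (x \<oplus> y) = adj A x \<oplus> adj A y"
    and adj_smult: "x \<in> carrier A \<Longrightarrow> adj A (z \<odot> x) = cnj z \<odot> adj A x"
    and adj_mult: "x \<in> carrier A \<Longrightarrow> y \<in> carrier A \<Longrightarrow>
      adj A (x \<otimes> y) = adj A y \<otimes> adj A x"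

locale star_prob_space = star_algebra A
  for A :: "'b star_algebra" (structure) +
  fixes \<phi> :: "'b \<Rightarrow> complex"
  assumes state_add: "x \<in> carrier A \<Longrightarrow> y \<in> carrier A \<Longrightarrow> \<phi> (x \<oplus> y) = \<phi> x + \<phi> y"
    and state_smult: "x \<in> carrier A \<Longrightarrow> \<phi> (z \<odot> x) = z * \<phi> x"
    and state_one: "\<phi> \<one> = 1"
    and state_pos: "x \<in> carrier A \<Longrightarrow> \<phi> (adj A x \<otimes> x) \<in> \<real>\<^sub>\<ge>\<^sub>0"

text \<open>The product of a word in the letters \<open>a i\<close> and their adjoints; a letter paired
  with \<^const>\<open>True\<close> is starred.\<close>

definition star_word :: "'b star_algebra \<Rightarrow> ('i \<Rightarrow> 'b) \<Rightarrow> ('i \<times> bool) list \<Rightarrow> 'b" where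
  "star_word A a ls =
     foldr (\<lambda>(i, s) y. (if s then adj A (a i) else a i) \<otimes>\<^bsub>A\<^esub> y) ls \<one>\<^bsub>A\<^esub>"

inductive_set unital_subalgebra :: "'b star_algebra \<Rightarrow> 'b set \<Rightarrow> 'b set"
  for A :: "'b star_algebra" and S :: "'b set" where
  gen: "x \<in> S \<Longrightarrow> x \<in> unital_subalgebra A S"
| one: "\<one>\<^bsub>A\<^esub> \<in> unital_subalgebra A S"
| add: "x \<in> unital_subalgebra A S \<Longrightarrow> y \<in> unital_subalgebra A S \<Longrightarrow>
    x \<oplus>\<^bsub>A\<^esub> y \<in> unital_subalgebra A S"
| mult: "x \<in> unital_subalgebra A S \<Longrightarrow> y \<in> unital_subalgebra A S \<Longrightarrow>
    x \<otimes>\<^bsub>A\<^esub> y \<in> unital_subalgebra A S"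
| smult: "x \<in> unital_subalgebra A S \<Longrightarrow> z \<odot>\<^bsub>A\<^esub> x \<in> unital_subalgebra A S"

text \<open>Free independence of the unital subalgebras generated by the elements \<open>x i\<close>:
  alternating products of centred elements are centred.\<close>

definition free_elements ::
    "'b star_algebra \<Rightarrow> ('b \<Rightarrow> complex) \<Rightarrow> 'i set \<Rightarrow> ('i \<Rightarrow> 'b) \<Rightarrow> bool" where
  "free_elements A \<phi> I x \<longleftrightarrow>
     (\<forall>ys :: ('i \<times> 'b) list.
        ys \<noteq> [] \<and> distinct_adj (map fst ys) \<and>
        (\<forall>(i, y) \<in> set ys. i \<in> I \<and> y \<in> unital_subalgebra A {x i} \<and> \<phi> y = 0)
        \<longrightarrow> \<phi> (foldr (\<otimes>\<^bsub>A\<^esub>) (map snd ys) \<one>\<^bsub>A\<^esub>) = 0)"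

definition even_element :: "'b star_algebra \<Rightarrow> ('b \<Rightarrow> complex) \<Rightarrow> 'b \<Rightarrow> bool" where
  "even_element A \<phi> x \<longleftrightarrow>
     x \<in> carrier A \<and> adj A x = x \<and> (\<forall>n::nat. odd n \<longrightarrow> \<phi> (x [^]\<^bsub>A\<^esub> n) = 0)"

definition has_distribution ::
    "'b star_algebra \<Rightarrow> ('b \<Rightarrow> complex) \<Rightarrow> 'b \<Rightarrow> real measure \<Rightarrow> bool" where
  "has_distribution A \<phi> x \<mu> \<longleftrightarrow>
     x \<in> carrier A \<and> adj A x = x \<and>
     (\<forall>n::nat. integrable \<mu> (\<lambda>t. t ^ n) \<and>
        \<phi> (x [^]\<^bsub>A\<^esub> n) = complex_of_real (\<integral>t. t ^ n \<partial>\<mu>))"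


section \<open>Free cumulants\<close>

definition noncrossing_partitions :: "nat \<Rightarrow> nat set set set" where
  "noncrossing_partitions n =
     {\<pi>. partition_on {1..n} \<pi> \<and>
         (\<forall>U\<in>\<pi>. \<forall>V\<in>\<pi>. U \<noteq> V \<longrightarrow>
            \<not> (\<exists>a\<in>U. \<exists>b\<in>V. \<exists>c\<in>U. \<exists>d\<in>V. a < b \<and> b < c \<and> c < d))}"

lemma finite_noncrossing_partitions: "finite (noncrossing_partitions n)"
  by (rule finite_subset[of _ "Pow (Pow {1..n})"])
     (auto simp: noncrossing_partitions_def partition_on_def)

lemma card_block_less:
  assumes "\<pi> \<in> noncrossing_partitions n - {{{1..n}}}" and "V \<in> \<pi>"
  shows "card V < n"
proof -
  have p: "\<Union>\<pi> = {1..n}" "disjoint \<pi>" "{} \<notin> \<pi>" and ne: "\<pi> \<noteq> {{1..n}}"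
    using assms(1) by (auto simp: noncrossing_partitions_def partition_on_def)
  have sub: "V \<subseteq> {1..n}" using p assms(2) by blast
  have "V \<noteq> {1..n}"
  proof
    assume V: "V = {1..n}"
    have "U = V" if U: "U \<in> \<pi>" for U
    proof (rule ccontr)
      assume "U \<noteq> V"
      then have "U \<inter> V = {}" using p(2) U assms(2) by (auto simp: disjoint_def)
      moreover have "U \<subseteq> V" using p(1) U V by blast
      ultimately show False using p(3) U by (metis inf.absorb1)
    qed
    then show False using ne V assms(2) by blast
  qed
  then have "card V < card {1..n}" using sub by (intro psubset_card_mono) auto
  then show ?thesis by simp
qed

text \<open>The free cumulants of a moment sequence \<open>m\<close>, by solving the moment-cumulant
  formula for the summand of the one-block partition.\<close>

function free_cumulant :: "(nat \<Rightarrow> complex) \<Rightarrow> nat \<Rightarrow> complex" where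
  "free_cumulant m n =
     m n - (\<Sum>\<pi> \<in> noncrossing_partitions n - {{{1..n}}}. \<Prod>V\<in>\<pi>. free_cumulant m (card V))"
  by auto
termination
proof (relation "Wellfounded.measure snd")
  fix m :: "nat \<Rightarrow> complex" and n \<pi> V
  assume "\<pi> \<in> noncrossing_partitions n - {{{1..n}}}" "V \<in> \<pi>"
  then show "((m, card V), (m, n)) \<in> Wellfounded.measure snd"
    using card_block_less by simp
qed simp

declare free_cumulant.simps [simp del]

lemma moment_cumulant_formula:
  assumes "0 < n"
  shows "m n = (\<Sum>\<pi> \<in> noncrossing_partitions n. \<Prod>V\<in>\<pi>. free_cumulant m (card V))"
proof -
  have "{{1..n}} \<in> noncrossing_partitions n"
    using assms by (auto simp: noncrossing_partitions_def partition_on_def disjoint_def)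
  then have "(\<Sum>\<pi> \<in> noncrossing_partitions n. \<Prod>V\<in>\<pi>. free_cumulant m (card V)) =
      free_cumulant m n +
      (\<Sum>\<pi> \<in> noncrossing_partitions n - {{{1..n}}}. \<Prod>V\<in>\<pi>. free_cumulant m (card V))"
    by (subst sum.remove[OF finite_noncrossing_partitions]) auto
  then show ?thesis by (subst (asm) (2) free_cumulant.simps) simp
qed

definition element_free_cumulant ::
    "'b star_algebra \<Rightarrow> ('b \<Rightarrow> complex) \<Rightarrow> 'b \<Rightarrow> nat \<Rightarrow> complex" where
  "element_free_cumulant A \<phi> x = free_cumulant (\<lambda>n. \<phi> (x [^]\<^bsub>A\<^esub> n))"


section \<open>The Marchenko--Pastur distribution\<close>

definition marchenko_pastur_density :: "real \<Rightarrow> real \<Rightarrow> real" where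
  "marchenko_pastur_density c t =
     (let a = (1 - sqrt c)\<^sup>2; b = (1 + sqrt c)\<^sup>2
      in indicator {a..b} t * (sqrt ((b - t) * (t - a)) / (2 * pi * t)))"

definition marchenko_pastur :: "real \<Rightarrow> real measure" where
  "marchenko_pastur c =
     measure_of UNIV (sets borel)
       (\<lambda>S. emeasure (density lborel (\<lambda>t. ennreal (marchenko_pastur_density c t))) S
          + ennreal (max 0 (1 - c)) * indicator S 0)"

lemma sets_marchenko_pastur [simp]: "sets (marchenko_pastur c) = sets borel"
  unfolding marchenko_pastur_def
  by (metis sets.sigma_sets_eq sets_measure_of space_borel subset_UNIV Pow_UNIV)

lemma emeasure_marchenko_pastur:
  assumes "S \<in> sets borel"
  shows "emeasure (marchenko_pastur c) S =
    emeasure (density lborel (\<lambda>t. ennreal (marchenko_pastur_density c t))) S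
      + ennreal (max 0 (1 - c)) * indicator S 0"
proof (rule emeasure_measure_of[OF marchenko_pastur_def])
  let ?D = "density lborel (\<lambda>t. ennreal (marchenko_pastur_density c t))"
  let ?R = "return borel (0::real)"
  show "countably_additive (sets (marchenko_pastur c))
     (\<lambda>S. emeasure ?D S + ennreal (max 0 (1 - c)) * indicator S 0)"
  proof (rule countably_additiveI)
    fix F :: "nat \<Rightarrow> real set"
    assume F: "range F \<subseteq> sets (marchenko_pastur c)" "disjoint_family F"
    have D: "(\<Sum>i. emeasure ?D (F i)) = emeasure ?D (\<Union>i. F i)"
      using F by (intro suminf_emeasure) auto
    have R: "(\<Sum>i. emeasure ?R (F i)) = emeasure ?R (\<Union>i. F i)"
      using F by (intro suminf_emeasure) auto
    have "(\<Sum>i. indicator (F i) (0::real) :: ennreal) = indicator (\<Union>i. F i) 0"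
      using R F by (subst (asm) (1 2) emeasure_return) (auto simp: image_subset_iff)
    then show "(\<Sum>i. emeasure ?D (F i) + ennreal (max 0 (1 - c)) * indicator (F i) 0) =
        emeasure ?D (\<Union>i. F i) + ennreal (max 0 (1 - c)) * indicator (\<Union>i. F i) 0"
      using D by (simp add: suminf_add[symmetric])
  qed
qed (use assms in \<open>auto simp: positive_def\<close>)


section \<open>Complex Wishart matrices with two by two blocks\<close>

text \<open>``Complex Gaussian'' means circular: the real and imaginary parts are independent
  with the same variance.\<close>

definition complex_gaussian :: "'a measure \<Rightarrow> ('a \<Rightarrow> complex) \<Rightarrow> bool" where
  "complex_gaussian M Z \<longleftrightarrow>
     (\<exists>m \<sigma>. 0 < \<sigma> \<and>
        distributed M lborel (\<lambda>\<omega>. Re (Z \<omega>)) (normal_density (Re m) \<sigma>) \<and>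
        distributed M lborel (\<lambda>\<omega>. Im (Z \<omega>)) (normal_density (Im m) \<sigma>) \<and>
        prob_space.indep_var M borel (\<lambda>\<omega>. Re (Z \<omega>)) borel (\<lambda>\<omega>. Im (Z \<omega>)))"

text \<open>Blocks are numbered by 1 and 2, the rows and columns inside a block from 0;
  \<open>g i r k\<close> is the \<open>(r, k)\<close> entry of the \<open>i\<close>-th Gaussian matrix.\<close>

type_synonym 'a gaussian_array = "nat \<Rightarrow> nat \<Rightarrow> nat \<Rightarrow> 'a \<Rightarrow> complex"

definition gaussian_matrix :: "nat \<Rightarrow> nat \<Rightarrow> 'a gaussian_array \<Rightarrow> nat \<Rightarrow> 'a \<Rightarrow> complex mat" where
  "gaussian_matrix d p g i \<omega> = Matrix.mat d p (\<lambda>(r, k). g i r k \<omega>)"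

definition wishart_block ::
    "nat \<Rightarrow> nat \<Rightarrow> 'a gaussian_array \<Rightarrow> nat \<Rightarrow> nat \<Rightarrow> 'a \<Rightarrow> complex mat" where
  "wishart_block d p g i j \<omega> =
     (1 / of_nat d) \<cdot>\<^sub>m (gaussian_matrix d p g i \<omega> * mat_adjoint (gaussian_matrix d p g j \<omega>))"

definition block_mat2 :: "(nat \<Rightarrow> nat \<Rightarrow> complex mat) \<Rightarrow> complex mat" where
  "block_mat2 B = four_block_mat (B 1 1) (B 1 2) (B 2 1) (B 2 2)"

definition wishart :: "nat \<Rightarrow> nat \<Rightarrow> 'a gaussian_array \<Rightarrow> 'a \<Rightarrow> complex mat" where
  "wishart d p g \<omega> = (1 / 2) \<cdot>\<^sub>m block_mat2 (\<lambda>i j. wishart_block d p g i j \<omega>)"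

definition wishart_left_transpose ::
    "nat \<Rightarrow> nat \<Rightarrow> 'a gaussian_array \<Rightarrow> 'a \<Rightarrow> complex mat" where
  "wishart_left_transpose d p g \<omega> = (1 / 2) \<cdot>\<^sub>m block_mat2 (\<lambda>i j. wishart_block d p g j i \<omega>)"

definition block_unit :: "nat \<Rightarrow> nat \<Rightarrow> nat \<Rightarrow> complex mat" where
  "block_unit d i j = block_mat2 (\<lambda>k l. if k = i \<and> l = j then 1\<^sub>m d else 0\<^sub>m d d)"

definition mat_star_algebra :: "nat \<Rightarrow> complex mat star_algebra" where
  "mat_star_algebra n = module.extend (module_mat TYPE(complex) n n) \<lparr>adj = mat_adjoint\<rparr>"

definition normalized_trace :: "nat \<Rightarrow> complex mat \<Rightarrow> complex" where
  "normalized_trace n B = (\<Sum>i<n. B $$ (i, i)) / of_nat n"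


section \<open>Limit joint distributions\<close>

text \<open>The random matrices \<open>X n \<omega> i\<close>, of size \<open>N n\<close> and indexed by \<open>i \<in> I\<close>, converge in
  joint *-distribution to the family \<open>a\<close>.\<close>

definition limit_joint_distribution ::
    "(nat \<Rightarrow> 'a measure) \<Rightarrow> (nat \<Rightarrow> nat) \<Rightarrow> 'i set \<Rightarrow> (nat \<Rightarrow> 'a \<Rightarrow> 'i \<Rightarrow> complex mat) \<Rightarrow>
     'b star_algebra \<Rightarrow> ('b \<Rightarrow> complex) \<Rightarrow> ('i \<Rightarrow> 'b) \<Rightarrow> bool" where
  "limit_joint_distribution M N I X A \<phi> a \<longleftrightarrow>
     star_prob_space A \<phi> \<and> (\<forall>i\<in>I. a i \<in> carrier A) \<and>
     (\<forall>ls \<in> lists (I \<times> UNIV).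
        (\<lambda>n. \<integral>\<omega>. normalized_trace (N n)
                    (star_word (mat_star_algebra (N n)) (X n \<omega>) ls) \<partial>M n)
          \<longlonglongrightarrow> \<phi> (star_word A a ls))"

datatype letter = W | WL | E nat nat

definition letters :: "letter set" where
  "letters = {W, WL} \<union> {E i j | i j. i \<in> {1, 2} \<and> j \<in> {1, 2}}"

fun wishart_family :: "nat \<Rightarrow> nat \<Rightarrow> 'a gaussian_array \<Rightarrow> 'a \<Rightarrow> letter \<Rightarrow> complex mat" where
  "wishart_family d p g \<omega> W = wishart d p g \<omega>"
| "wishart_family d p g \<omega> WL = wishart_left_transpose d p g \<omega>"
| "wishart_family d p g \<omega> (E i j) = block_unit d i j"

definition matrix_units2 :: "'b star_algebra \<Rightarrow> (nat \<Rightarrow> nat \<Rightarrow> 'b) \<Rightarrow> bool" where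
  "matrix_units2 A e \<longleftrightarrow>
     (\<forall>i\<in>{1, 2}. \<forall>j\<in>{1, 2}. e i j \<in> carrier A \<and> adj A (e i j) = e j i) \<and>
     (\<forall>i\<in>{1, 2}. \<forall>j\<in>{1, 2}. \<forall>k\<in>{1, 2}. \<forall>l\<in>{1, 2}.
        e i j \<otimes>\<^bsub>A\<^esub> e k l = (if j = k then e i l else \<zero>\<^bsub>A\<^esub>)) \<and>
     e 1 1 \<oplus>\<^bsub>A\<^esub> e 2 2 = \<one>\<^bsub>A\<^esub>"

definition block_entry ::
    "'b star_algebra \<Rightarrow> (nat \<Rightarrow> nat \<Rightarrow> 'b) \<Rightarrow> 'b \<Rightarrow> nat \<Rightarrow> nat \<Rightarrow> 'b" where
  "block_entry A e x i j = e 1 i \<otimes>\<^bsub>A\<^esub> x \<otimes>\<^bsub>A\<^esub> e j 1"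

definition block_element ::
    "'b star_algebra \<Rightarrow> (nat \<Rightarrow> nat \<Rightarrow> 'b) \<Rightarrow> (nat \<Rightarrow> nat \<Rightarrow> 'b) \<Rightarrow> 'b" where
  "block_element A e b =
     (\<Oplus>\<^bsub>A\<^esub>i\<in>{1, 2}. \<Oplus>\<^bsub>A\<^esub>j\<in>{1, 2}. e i 1 \<otimes>\<^bsub>A\<^esub> b i j \<otimes>\<^bsub>A\<^esub> e 1 j)"

text \<open>A limit of the Wishart family in which the limits of the block matrix units are
  matrix units and the limit of the (self-adjoint) Wishart matrix is self-adjoint. When
  the state is not faithful, the moments alone determine these relations only up to
  elements \<open>x\<close> with \<open>\<phi> (x\<^sup>* x) = 0\<close>. As HOL has no quantification over types, the
  existence of such a limit has to be stated for some fixed type of elements; the type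
  of sequences of random matrices is large enough to hold one.\<close>

definition wishart_limit ::
    "(nat \<Rightarrow> 'a measure) \<Rightarrow> (nat \<Rightarrow> nat) \<Rightarrow> (nat \<Rightarrow> nat) \<Rightarrow> (nat \<Rightarrow> 'a gaussian_array) \<Rightarrow>
     'b star_algebra \<Rightarrow> ('b \<Rightarrow> complex) \<Rightarrow> (letter \<Rightarrow> 'b) \<Rightarrow> bool" where
  "wishart_limit M d p g A \<phi> a \<longleftrightarrow>
     limit_joint_distribution M (\<lambda>n. 2 * d n) letters
       (\<lambda>n. wishart_family (d n) (p n) (g n)) A \<phi> a \<and>
     matrix_units2 A (\<lambda>i j. a (E i j)) \<and> adj A (a W) = a W"

end

theory Submission
  imports Defs
begin

text \<open>Gaussian integration by parts gives a closed recursion for the mixed moments of traces of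
  products of the blocks \<open>W(i, j)\<close>: contracting the first factor either splits its trace into two,
  or merges it with another trace at the cost of a factor \<open>1 / d\<^sup>2\<close>. Hence traces become
  independent in the limit, and the limits of single traces satisfy a recursion over non-crossing
  contractions.

  A word in \<open>X\<^sub>1\<close> and \<open>X\<^sub>2\<close> has in each block row at most one nonzero entry, which is a product of
  blocks \<open>W(i\<^sub>1, i\<^sub>0) W(i\<^sub>2, i\<^sub>1) \<dots>\<close>, where \<open>X\<^sub>1\<close> keeps the index and \<open>X\<^sub>2\<close> flips it. On such products the
  recursion only contracts factors of the same kind, and \<open>X\<^sub>2\<close>-blocks of odd size contribute nothing,
  so it is the moment recursion of two free elements with free cumulants \<open>2c\<close>, respectively \<open>2c\<close> in even
  and \<open>0\<close> in odd degrees. The Marchenko--Pastur moments satisfy the same recursion as those of \<open>X\<^sub>1\<close>,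
  because the density is a shifted semicircle density divided by \<open>t\<close>.

  A limit is realised on the algebra spanned by the sequences of words in the blocks, with the limit of
  the expected trace as state; moments of \<open>X\<^sub>1\<close>, \<open>X\<^sub>2\<close> in any other limit are those of this one.\<close>

section \<open>Gaussian integration by parts\<close>

subsection \<open>Formal derivatives of polynomials in random variables\<close>

text \<open>Two recursions have to meet. The Gaussian side removes one factor of a trace at a time
  and never sees a partition; freeness asks about alternating products of centred elements.
  \<open>free_moment\<close> and \<open>open_block\<close>, which expose the block of the first
  letter one letter at a time, serve both sides: the limits of traces fit them directly, and on
  centred alternating words they give 0. Mixed cumulants are never mentioned; non-crossing
  partitions enter only for powers of one letter, to identify the prescribed numbers with
  \<open>free_cumulant\<close>. The transposed position of the off-diagonal blocks is what makes the
  fit work: a contraction in W(i1,i0) W(i2,i1) ... again leaves a path behind one leading factor,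
  and the parity of the flips removes the unwanted cases. The constant 2c is lim p / d2, produced
  whenever a factor is contracted with itself. An arbitrary limit is known only through its moments,
  so no homomorphism into it from the concrete algebra is at hand; elements built by the same
  polynomial are compared instead.\<close>

definition mon :: "('l \<Rightarrow> 'a \<Rightarrow> complex) \<Rightarrow> 'l list \<Rightarrow> 'a \<Rightarrow> complex" where
  "mon v ls \<omega> = (\<Prod>l\<leftarrow>ls. v l \<omega>)"

fun dmon :: "('l \<Rightarrow> 'a \<Rightarrow> complex) \<Rightarrow> ('l \<Rightarrow> complex) \<Rightarrow> 'l list \<Rightarrow> 'a \<Rightarrow> complex" where
  "dmon v \<delta> [] \<omega> = 0"
| "dmon v \<delta> (l # ls) \<omega> = \<delta> l * mon v ls \<omega> + v l \<omega> * dmon v \<delta> ls \<omega>"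

lemma mon_simps [simp]: "mon v [] \<omega> = 1" "mon v (l # ls) \<omega> = v l \<omega> * mon v ls \<omega>"
  "mon v (ls @ ls') \<omega> = mon v ls \<omega> * mon v ls' \<omega>"
  by (simp_all add: mon_def)

lemma dmon_append:
  "dmon v \<delta> (ls @ ls') \<omega> = dmon v \<delta> ls \<omega> * mon v ls' \<omega> + mon v ls \<omega> * dmon v \<delta> ls' \<omega>"
  by (induction ls) (auto simp: algebra_simps)

text \<open>A relation and not an operator: the same random variable can arise from different
  polynomials in the letters, and the formal derivative belongs to the polynomial. Letters have
  constant derivatives \<open>\<delta>\<close>.\<close>

inductive poly_deriv ::
    "'l set \<Rightarrow> ('l \<Rightarrow> 'a \<Rightarrow> complex) \<Rightarrow> ('l \<Rightarrow> complex) \<Rightarrow>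
     ('a \<Rightarrow> complex) \<Rightarrow> ('a \<Rightarrow> complex) \<Rightarrow> bool"
  for S v \<delta> where
  monI: "set ls \<subseteq> S \<Longrightarrow> poly_deriv S v \<delta> (\<lambda>\<omega>. z * mon v ls \<omega>) (\<lambda>\<omega>. z * dmon v \<delta> ls \<omega>)"
| addI: "poly_deriv S v \<delta> f f' \<Longrightarrow> poly_deriv S v \<delta> h h' \<Longrightarrow>
    poly_deriv S v \<delta> (\<lambda>\<omega>. f \<omega> + h \<omega>) (\<lambda>\<omega>. f' \<omega> + h' \<omega>)"

lemma poly_deriv_const: "poly_deriv S v \<delta> (\<lambda>_. z) (\<lambda>_. 0)"
  using poly_deriv.monI[of "[]" S v \<delta> z] by simp

lemma poly_deriv_letter: "l \<in> S \<Longrightarrow> poly_deriv S v \<delta> (v l) (\<lambda>_. \<delta> l)"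
  using poly_deriv.monI[of "[l]" S v \<delta> 1] by simp

lemma poly_deriv_mult:
  assumes "poly_deriv S v \<delta> f f'" "poly_deriv S v \<delta> h h'"
  shows "poly_deriv S v \<delta> (\<lambda>\<omega>. f \<omega> * h \<omega>) (\<lambda>\<omega>. f' \<omega> * h \<omega> + f \<omega> * h' \<omega>)"
  using assms(1)
proof induction
  case f: (monI ls z)
  show ?case
    using assms(2)
  proof induction
    case (monI ls' z')
    then show ?case
      using poly_deriv.monI[of "ls @ ls'" S v \<delta> "z * z'"] f
      by (simp add: dmon_append algebra_simps)
  next
    case (addI h1 h1' h2 h2')
    from poly_deriv.addI[OF addI.IH] show ?case
      by (simp add: algebra_simps)
  qed
next
  case (addI f1 f1' f2 f2')
  from poly_deriv.addI[OF addI.IH] show ?case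
    by (simp add: algebra_simps)
qed

lemma poly_deriv_scale:
  assumes "poly_deriv S v \<delta> f f'"
  shows "poly_deriv S v \<delta> (\<lambda>\<omega>. z * f \<omega>) (\<lambda>\<omega>. z * f' \<omega>)"
  using poly_deriv_mult[OF poly_deriv_const assms] by simp

lemma poly_deriv_sum:
  assumes "\<And>i. i \<in> I \<Longrightarrow> poly_deriv S v \<delta> (f i) (f' i)"
  shows "poly_deriv S v \<delta> (\<lambda>\<omega>. \<Sum>i\<in>I. f i \<omega>) (\<lambda>\<omega>. \<Sum>i\<in>I. f' i \<omega>)"
  using assms
proof (induction I rule: infinite_finite_induct)
  case (insert x F)
  then show ?case using poly_deriv.addI[of S v \<delta> "f x" "f' x"] by simp
qed (simp_all add: poly_deriv_const)

lemma poly_deriv_integrable: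
  assumes "\<And>ls. set ls \<subseteq> S \<Longrightarrow> integrable M (mon v ls)" and "poly_deriv S v \<delta> f f'"
  shows "integrable M f"
  using assms(2)
proof induction
  case (monI ls z)
  then show ?case using assms(1)[of ls] by (auto intro: integrable_mult_right)
qed auto

lemma integrable_dmon:
  assumes "\<And>ls. set ls \<subseteq> S \<Longrightarrow> integrable M (mon v ls)" and "set ls \<subseteq> S" "set ls' \<subseteq> S"
  shows "integrable M (\<lambda>\<omega>. mon v ls' \<omega> * dmon v \<delta> ls \<omega>)"
  using assms(2,3)
proof (induction ls arbitrary: ls')
  case (Cons l ls)
  have "integrable M (\<lambda>\<omega>. \<delta> l * mon v (ls' @ ls) \<omega> + mon v (ls' @ [l]) \<omega> * dmon v \<delta> ls \<omega>)"
    using Cons.prems by (intro Bochner_Integration.integrable_add integrable_mult_right assms(1) Cons.IH) auto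
  then show ?case by (simp add: algebra_simps)
qed simp

text \<open>Integration by parts is linear in the polynomial, so it passes from monomials to all of
  \<open>poly_deriv\<close>. Integrability is carried along because additivity of the integral needs
  it.\<close>

lemma poly_deriv_stein:
  assumes "\<And>ls. set ls \<subseteq> S \<Longrightarrow> integrable M (mon v ls)"
    and "\<And>ls. set ls \<subseteq> S \<Longrightarrow> integrable M (\<lambda>\<omega>. u \<omega> * mon v ls \<omega>)"
    and "\<And>ls. set ls \<subseteq> S \<Longrightarrow> (\<integral>\<omega>. u \<omega> * mon v ls \<omega> \<partial>M) = (\<integral>\<omega>. dmon v \<delta> ls \<omega> \<partial>M)"
    and "poly_deriv S v \<delta> f f'"
  shows "integrable M (\<lambda>\<omega>. u \<omega> * f \<omega>) \<and> integrable M f' \<and>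
    (\<integral>\<omega>. u \<omega> * f \<omega> \<partial>M) = (\<integral>\<omega>. f' \<omega> \<partial>M)"
  using assms(4)
proof induction
  case (monI ls z)
  have "integrable M (\<lambda>\<omega>. z * (u \<omega> * mon v ls \<omega>))"
    using assms(2)[OF monI] by (rule integrable_mult_right)
  moreover have "integrable M (dmon v \<delta> ls)"
    using integrable_dmon[OF assms(1), of S ls "[]"] monI by simp
  ultimately show ?case
    using assms(3)[OF monI] by (simp add: mult.left_commute)
qed (simp add: algebra_simps)

subsection \<open>A single complex Gaussian variable\<close>

lemma normal_power_integrable:
  assumes "0 < \<sigma>"
  shows "integrable lborel (\<lambda>x. normal_density 0 \<sigma> x * x ^ k)"
  using integrable_normal_moment[OF assms, of 0 k] by simp

text \<open>Stein's identity for a power, read off the closed form of the normal moments: for even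
  \<open>k\<close> only odd moments occur, for odd \<open>k\<close> it is the ratio of consecutive
  even moments. At \<open>k = 0\<close> the truncated \<open>k - 1\<close> is harmless since the
  factor \<open>k\<close> is zero.\<close>

lemma normal_power_recursion:
  assumes "0 < \<sigma>"
  shows "(\<integral>x. normal_density 0 \<sigma> x * x ^ Suc k \<partial>lborel) =
    \<sigma>\<^sup>2 * real k * (\<integral>x. normal_density 0 \<sigma> x * x ^ (k - 1) \<partial>lborel)"
proof (cases "even k")
  case True
  then obtain j where k: "k = 2 * j" by (rule evenE)
  show ?thesis
  proof (cases j)
    case 0
    then show ?thesis using k integral_normal_moment_odd[OF assms, of 0 0] by simp
  next
    case (Suc i)
    then show ?thesis
      using k integral_normal_moment_odd[OF assms, of 0 j] integral_normal_moment_odd[OF assms, of 0 i]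
      by simp
  qed
next
  case False
  then obtain j where k: "k = 2 * j + 1" by (rule oddE)
  have "fact (2 * Suc j) / ((2 / \<sigma>\<^sup>2) ^ Suc j * fact (Suc j)) =
      \<sigma>\<^sup>2 * real k * (fact (2 * j) / ((2 / \<sigma>\<^sup>2) ^ j * fact j))"
  proof -
    define A B where "A = (fact (2 * j) :: real)" and "B = (2 / \<sigma>\<^sup>2) ^ j * fact j"
    have "B \<noteq> 0" using assms by (simp add: B_def)
    have e1: "fact (2 * Suc j) = 2 * (real j + 1) * (2 * real j + 1) * A"
      by (simp add: A_def algebra_simps)
    have e2: "(2 / \<sigma>\<^sup>2) ^ Suc j * fact (Suc j) = 2 / \<sigma>\<^sup>2 * (real j + 1) * B"
      by (simp add: B_def)
    have e3: "2 * (real j + 1) * (2 * real j + 1) * A / (2 / \<sigma>\<^sup>2 * (real j + 1) * B) =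
        \<sigma>\<^sup>2 * (2 * real j + 1) * (A / B)"
      using assms \<open>B \<noteq> 0\<close> by (simp add: divide_simps)
    show ?thesis unfolding e1 e2 e3 k by (simp add: A_def B_def)
  qed
  then show ?thesis
    using k integral_normal_moment_even[OF assms, of 0 "Suc j"] integral_normal_moment_even[OF assms, of 0 j]
    by simp
qed

lemma (in prob_space) normal_moments:
  assumes "0 < \<sigma>" "distributed M lborel X (normal_density 0 \<sigma>)"
  shows "integrable M (\<lambda>\<omega>. X \<omega> ^ k)"
    and "expectation (\<lambda>\<omega>. X \<omega> ^ Suc k) = \<sigma>\<^sup>2 * real k * expectation (\<lambda>\<omega>. X \<omega> ^ (k - 1))"
proof -
  have "integrable lborel (\<lambda>x. normal_density 0 \<sigma> x * x ^ k) = integrable M (\<lambda>\<omega>. X \<omega> ^ k)"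
    by (intro distributed_integrable[OF assms(2)]) auto
  then show "integrable M (\<lambda>\<omega>. X \<omega> ^ k)" using normal_power_integrable[OF assms(1)] by simp
  have e: "expectation (\<lambda>\<omega>. X \<omega> ^ j) = (\<integral>x. normal_density 0 \<sigma> x * x ^ j \<partial>lborel)" for j
    by (intro distributed_integral[OF assms(2), symmetric]) auto
  show "expectation (\<lambda>\<omega>. X \<omega> ^ Suc k) = \<sigma>\<^sup>2 * real k * expectation (\<lambda>\<omega>. X \<omega> ^ (k - 1))"
    unfolding e by (rule normal_power_recursion[OF assms(1)])
qed

lemma mon_replicate_split:
  "mon (\<lambda>b \<omega>. if b then y \<omega> else x \<omega>) ls \<omega> =
    x \<omega> ^ count_list ls False * y \<omega> ^ count_list ls True"
  by (induction ls) auto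

lemma dmon_replicate_split:
  "dmon (\<lambda>b \<omega>. if b then y \<omega> else x \<omega>) (\<lambda>b. if b then 0 else s) ls \<omega> =
    s * of_nat (count_list ls False) * x \<omega> ^ (count_list ls False - 1) * y \<omega> ^ count_list ls True"
proof (induction ls)
  case (Cons b ls)
  then show ?case
    by (cases "count_list ls False") (auto simp: mon_replicate_split algebra_simps)
qed simp

text \<open>\<open>False\<close> stands for \<open>X\<close> and \<open>True\<close> for
  \<open>Y\<close>; only \<open>X\<close> is differentiated. Independence splits each monomial into
  a power of \<open>X\<close> and a power of \<open>Y\<close>, and the one-dimensional recursion
  acts on the first.\<close>

lemma (in prob_space) real_pair_stein:
  fixes X Y :: "'a \<Rightarrow> real"
  assumes "0 < \<sigma>" and X: "distributed M lborel X (normal_density 0 \<sigma>)"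
    and Y: "distributed M lborel Y (normal_density 0 \<sigma>)"
    and indep: "indep_var borel X borel Y"
  defines "v \<equiv> \<lambda>b \<omega>. if b then complex_of_real (Y \<omega>) else complex_of_real (X \<omega>)"
  shows "integrable M (mon v ls)"
    and "(\<integral>\<omega>. complex_of_real (X \<omega>) * mon v ls \<omega> \<partial>M) =
      (\<integral>\<omega>. dmon v (\<lambda>b. if b then 0 else complex_of_real (\<sigma>\<^sup>2)) ls \<omega> \<partial>M)"
proof -
  have pr: "integrable M (\<lambda>\<omega>. X \<omega> ^ k * Y \<omega> ^ l)"
    "expectation (\<lambda>\<omega>. X \<omega> ^ k * Y \<omega> ^ l) = expectation (\<lambda>\<omega>. X \<omega> ^ k) * expectation (\<lambda>\<omega>. Y \<omega> ^ l)" for k l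
  proof -
    have i: "indep_var borel (\<lambda>\<omega>. X \<omega> ^ k) borel (\<lambda>\<omega>. Y \<omega> ^ l)"
      by (rule indep_var_compose[OF indep, of "\<lambda>x. x ^ k" borel "\<lambda>y. y ^ l" borel, unfolded comp_def]) auto
    show "integrable M (\<lambda>\<omega>. X \<omega> ^ k * Y \<omega> ^ l)"
      using indep_var_integrable[OF i] normal_moments(1)[OF assms(1) X] normal_moments(1)[OF assms(1) Y] by blast
    show "expectation (\<lambda>\<omega>. X \<omega> ^ k * Y \<omega> ^ l) = expectation (\<lambda>\<omega>. X \<omega> ^ k) * expectation (\<lambda>\<omega>. Y \<omega> ^ l)"
      using indep_var_lebesgue_integral[OF i] normal_moments(1)[OF assms(1) X] normal_moments(1)[OF assms(1) Y] by blast
  qed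
  have m: "mon v ls \<omega> = complex_of_real (X \<omega> ^ count_list ls False * Y \<omega> ^ count_list ls True)" for ls \<omega>
    unfolding v_def by (simp add: mon_replicate_split)
  show "integrable M (mon v ls)"
    using pr(1) by (simp add: m[abs_def] del: of_real_mult)
  let ?a = "count_list ls False" and ?b = "count_list ls True"
  have d: "dmon v (\<lambda>b. if b then 0 else complex_of_real (\<sigma>\<^sup>2)) ls \<omega> =
      complex_of_real (\<sigma>\<^sup>2 * real ?a * (X \<omega> ^ (?a - 1) * Y \<omega> ^ ?b))" for \<omega>
    unfolding v_def by (simp add: dmon_replicate_split)
  have l: "complex_of_real (X \<omega>) * mon v ls \<omega> = complex_of_real (X \<omega> ^ Suc ?a * Y \<omega> ^ ?b)" for \<omega>
    unfolding m by simp
  have "expectation (\<lambda>\<omega>. X \<omega> ^ Suc ?a * Y \<omega> ^ ?b) = \<sigma>\<^sup>2 * real ?a * expectation (\<lambda>\<omega>. X \<omega> ^ (?a - 1) * Y \<omega> ^ ?b)"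
    unfolding pr(2) normal_moments(2)[OF assms(1) X] by simp
  also have "\<dots> = expectation (\<lambda>\<omega>. \<sigma>\<^sup>2 * real ?a * (X \<omega> ^ (?a - 1) * Y \<omega> ^ ?b))"
    by simp
  finally show "(\<integral>\<omega>. complex_of_real (X \<omega>) * mon v ls \<omega> \<partial>M) =
      (\<integral>\<omega>. dmon v (\<lambda>b. if b then 0 else complex_of_real (\<sigma>\<^sup>2)) ls \<omega> \<partial>M)"
    unfolding d l integral_complex_of_real by simp
qed

abbreviation (input) star_letter :: "('a \<Rightarrow> complex) \<Rightarrow> bool \<Rightarrow> 'a \<Rightarrow> complex" where
  "star_letter Z \<equiv> (\<lambda>b \<omega>. if b then cnj (Z \<omega>) else Z \<omega>)"

lemma poly_deriv_mon:
  assumes "\<And>l. l \<in> set ls \<Longrightarrow> poly_deriv S v \<delta> (w l) (\<lambda>_. \<epsilon> l)"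
  shows "poly_deriv S v \<delta> (mon w ls) (dmon w \<epsilon> ls)"
  using assms
proof (induction ls)
  case Nil
  then show ?case using poly_deriv_const[of S v \<delta> 1] by (simp add: mon_def[abs_def] dmon.simps[abs_def])
next
  case (Cons l ls)
  have "poly_deriv S v \<delta> (\<lambda>\<omega>. w l \<omega> * mon w ls \<omega>) (\<lambda>\<omega>. \<epsilon> l * mon w ls \<omega> + w l \<omega> * dmon w \<epsilon> ls \<omega>)"
    using Cons by (intro poly_deriv_mult) auto
  moreover have "mon w (l # ls) = (\<lambda>\<omega>. w l \<omega> * mon w ls \<omega>)"
    "dmon w \<epsilon> (l # ls) = (\<lambda>\<omega>. \<epsilon> l * mon w ls \<omega> + w l \<omega> * dmon w \<epsilon> ls \<omega>)"
    by auto
  ultimately show ?case by simp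
qed

lemma (in prob_space) indep_set_sym: "indep_set A B \<Longrightarrow> indep_set B A"
  unfolding indep_sets2_eq
proof (intro conjI ballI; elim conjE)
  fix b a assume "b \<in> B" "a \<in> A" "\<forall>a\<in>A. \<forall>b\<in>B. prob (a \<inter> b) = prob a * prob b"
  then have "prob (a \<inter> b) = prob a * prob b" by blast
  then show "prob (b \<inter> a) = prob b * prob a" by (subst Int_commute, subst mult.commute)
qed

lemma (in prob_space) indep_var_sym: "indep_var S X T Y \<Longrightarrow> indep_var T Y S X"
  unfolding indep_var_eq by (blast intro: indep_set_sym)

text \<open>With Z = X + iY and both variances equal to s = 1/2, the operator s (d/dX + i d/dY)
  annihilates Z and sends the conjugate of Z to 2s = 1. So multiplication by Z is dual to the
  Wirtinger derivative in the conjugate variable.\<close>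

lemma (in prob_space) complex_gaussian_stein:
  fixes Z :: "'a \<Rightarrow> complex"
  assumes "complex_gaussian M Z" "(\<integral>\<omega>. Z \<omega> \<partial>M) = 0" "(\<integral>\<omega>. (cmod (Z \<omega>))\<^sup>2 \<partial>M) = 1"
  shows "integrable M (mon (star_letter Z) ls)"
    and "(\<integral>\<omega>. Z \<omega> * mon (star_letter Z) ls \<omega> \<partial>M) =
      (\<integral>\<omega>. dmon (star_letter Z) (\<lambda>b. if b then 1 else 0) ls \<omega> \<partial>M)"
proof -
  obtain m \<sigma> where \<sigma>: "0 < \<sigma>" and re: "distributed M lborel (\<lambda>\<omega>. Re (Z \<omega>)) (normal_density (Re m) \<sigma>)"
    and im: "distributed M lborel (\<lambda>\<omega>. Im (Z \<omega>)) (normal_density (Im m) \<sigma>)"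
    and indep: "indep_var borel (\<lambda>\<omega>. Re (Z \<omega>)) borel (\<lambda>\<omega>. Im (Z \<omega>))"
    using assms(1) unfolding complex_gaussian_def by blast
  have Z: "Z = (\<lambda>\<omega>. complex_of_real (Re (Z \<omega>)) + \<i> * complex_of_real (Im (Z \<omega>)))"
    using complex_eq by auto
  have ire: "integrable M (\<lambda>\<omega>. Re (Z \<omega>))"
    using distributed_integrable[OF re, of "\<lambda>x. x"] integrable_normal_moment_nz_1[OF \<sigma>] by auto
  have iim: "integrable M (\<lambda>\<omega>. Im (Z \<omega>))"
    using distributed_integrable[OF im, of "\<lambda>x. x"] integrable_normal_moment_nz_1[OF \<sigma>] by auto
  have iZ: "integrable M Z"
    by (subst Z) (use ire iim in auto)
  have "expectation (\<lambda>\<omega>. Re (Z \<omega>)) = Re m"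
    using normal_distributed_expectation[OF \<sigma> re] .
  moreover have "expectation (\<lambda>\<omega>. Re (Z \<omega>)) = 0"
    using integral_Re[OF iZ] assms(2) by simp
  ultimately have re0: "Re m = 0" by simp
  have "expectation (\<lambda>\<omega>. Im (Z \<omega>)) = Im m"
    using normal_distributed_expectation[OF \<sigma> im] .
  moreover have "expectation (\<lambda>\<omega>. Im (Z \<omega>)) = 0"
    using integral_Im[OF iZ] assms(2) by simp
  ultimately have im0: "Im m = 0" by simp
  note re = re[unfolded re0] and im = im[unfolded im0]
  note mom = normal_moments[OF \<sigma> re] and mom' = normal_moments[OF \<sigma> im]
  \<comment> \<open>Real and imaginary part share the variance, so the normalisation of the modulus
    forces 1/2 for each.\<close>
  have "1 = expectation (\<lambda>\<omega>. Re (Z \<omega>) ^ 2 + Im (Z \<omega>) ^ 2)"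
    using assms(3) by (simp add: cmod_power2)
  also have "\<dots> = 2 * \<sigma>\<^sup>2"
    using mom(1)[of 2] mom'(1)[of 2] mom(2)[of 1] mom'(2)[of 1]
    by (simp add: numeral_2_eq_2 prob_space)
  finally have s2: "2 * \<sigma>\<^sup>2 = 1" by simp
  define s where "s = complex_of_real (\<sigma>\<^sup>2)"
  have s: "s + s = 1" using s2 unfolding s_def by (metis mult_2 of_real_1 of_real_add)
  define x where "x = (\<lambda>b \<omega>. if b then complex_of_real (Im (Z \<omega>)) else complex_of_real (Re (Z \<omega>)))"
  \<comment> \<open>The roles are exchanged: \<open>y False\<close> is the imaginary part, so
    \<open>real_pair_stein\<close> now differentiates in it.\<close>
  define y where "y = (\<lambda>b \<omega>. if b then complex_of_real (Re (Z \<omega>)) else complex_of_real (Im (Z \<omega>)))"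
  define \<delta> where "\<delta> = (\<lambda>b. if b then 0 else s)"
  have indep': "indep_var borel (\<lambda>\<omega>. Im (Z \<omega>)) borel (\<lambda>\<omega>. Re (Z \<omega>))"
    using indep by (rule indep_var_sym)
  note X = real_pair_stein[OF \<sigma> re im indep, folded x_def s_def, folded \<delta>_def]
  note Y = real_pair_stein[OF \<sigma> im re indep', folded y_def s_def, folded \<delta>_def]
  have ux: "integrable M (\<lambda>\<omega>. complex_of_real (Re (Z \<omega>)) * mon x ls \<omega>)" for ls
    using X(1)[of "False # ls"] by (simp add: x_def mon_def[abs_def])
  have uy: "integrable M (\<lambda>\<omega>. complex_of_real (Im (Z \<omega>)) * mon y ls \<omega>)" for ls
    using Y(1)[of "False # ls"] by (simp add: y_def mon_def[abs_def])
  note SX = poly_deriv_stein[of UNIV M x "\<lambda>\<omega>. complex_of_real (Re (Z \<omega>))" \<delta>, OF X(1) ux X(2)]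
  note SY = poly_deriv_stein[of UNIV M y "\<lambda>\<omega>. complex_of_real (Im (Z \<omega>))" \<delta>, OF Y(1) uy Y(2)]
  have zx: "star_letter Z b = (\<lambda>\<omega>. x False \<omega> + (if b then - \<i> else \<i>) * x True \<omega>)" for b
    by (auto simp: x_def complex_eq_iff fun_eq_iff)
  have zy: "star_letter Z b = (\<lambda>\<omega>. y True \<omega> + (if b then - \<i> else \<i>) * y False \<omega>)" for b
    by (auto simp: y_def complex_eq_iff fun_eq_iff)
  have px: "poly_deriv UNIV x \<delta> (star_letter Z b) (\<lambda>_. s)" for b
  proof -
    have "poly_deriv UNIV x \<delta> (\<lambda>\<omega>. x False \<omega> + (if b then - \<i> else \<i>) * x True \<omega>)
        (\<lambda>_. \<delta> False + (if b then - \<i> else \<i>) * \<delta> True)"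
      by (intro poly_deriv.addI poly_deriv_scale poly_deriv_letter) auto
    then show ?thesis unfolding zx by (simp add: \<delta>_def)
  qed
  have py: "poly_deriv UNIV y \<delta> (star_letter Z b) (\<lambda>_. (if b then - \<i> else \<i>) * s)" for b
  proof -
    have "poly_deriv UNIV y \<delta> (\<lambda>\<omega>. y True \<omega> + (if b then - \<i> else \<i>) * y False \<omega>)
        (\<lambda>_. \<delta> True + (if b then - \<i> else \<i>) * \<delta> False)"
      by (intro poly_deriv.addI poly_deriv_scale poly_deriv_letter) auto
    then show ?thesis unfolding zy by (simp add: \<delta>_def)
  qed
  note mx = poly_deriv_mon[of ls UNIV x \<delta> "star_letter Z" "\<lambda>_. s", OF px]
  note my = poly_deriv_mon[of ls UNIV y \<delta> "star_letter Z" "\<lambda>b. (if b then - \<i> else \<i>) * s", OF py]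
  show "integrable M (mon (star_letter Z) ls)"
    by (rule poly_deriv_integrable[OF X(1) mx])
  \<comment> \<open>An unstarred letter receives s + i (i s) = 0, a starred one s + i (-i s) = 2s =
    1.\<close>
  have d: "dmon (star_letter Z) (\<lambda>_. s) ls \<omega> + \<i> * dmon (star_letter Z) (\<lambda>b. (if b then - \<i> else \<i>) * s) ls \<omega> =
      dmon (star_letter Z) (\<lambda>b. if b then 1 else 0) ls \<omega>" for \<omega> ls
  proof (induction ls)
    case (Cons b ls)
    have "dmon (star_letter Z) (\<lambda>_. s) (b # ls) \<omega> + \<i> * dmon (star_letter Z) (\<lambda>b. (if b then - \<i> else \<i>) * s) (b # ls) \<omega> =
       (s + (if b then s else - s)) * mon (star_letter Z) ls \<omega> + star_letter Z b \<omega> *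
         (dmon (star_letter Z) (\<lambda>_. s) ls \<omega> + \<i> * dmon (star_letter Z) (\<lambda>b. (if b then - \<i> else \<i>) * s) ls \<omega>)"
      by (simp add: algebra_simps del: mult_minus_left)
    then show ?case unfolding Cons using s by simp
  qed simp
  have "(\<integral>\<omega>. Z \<omega> * mon (star_letter Z) ls \<omega> \<partial>M) =
     (\<integral>\<omega>. complex_of_real (Re (Z \<omega>)) * mon (star_letter Z) ls \<omega> + \<i> * (complex_of_real (Im (Z \<omega>)) * mon (star_letter Z) ls \<omega>) \<partial>M)"
    by (subst Z) (simp add: algebra_simps)
  also have "\<dots> = (\<integral>\<omega>. dmon (star_letter Z) (\<lambda>_. s) ls \<omega> \<partial>M) +
      \<i> * (\<integral>\<omega>. dmon (star_letter Z) (\<lambda>b. (if b then - \<i> else \<i>) * s) ls \<omega> \<partial>M)"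
    using SX[OF mx] SY[OF my] by simp
  also have "\<dots> = (\<integral>\<omega>. dmon (star_letter Z) (\<lambda>_. s) ls \<omega> + \<i> * dmon (star_letter Z) (\<lambda>b. (if b then - \<i> else \<i>) * s) ls \<omega> \<partial>M)"
    using SX[OF mx] SY[OF my] by simp
  finally show "(\<integral>\<omega>. Z \<omega> * mon (star_letter Z) ls \<omega> \<partial>M) =
      (\<integral>\<omega>. dmon (star_letter Z) (\<lambda>b. if b then 1 else 0) ls \<omega> \<partial>M)"
    unfolding d .
qed

subsection \<open>Families of independent complex Gaussian variables\<close>

locale complex_gaussian_family = prob_space M for M :: "'a measure" +
  fixes I :: "'x set" and h :: "'x \<Rightarrow> 'a \<Rightarrow> complex"
  assumes finite_index: "finite I"
    and indep: "indep_vars (\<lambda>_. borel) h I"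
    and gaussian: "x \<in> I \<Longrightarrow> complex_gaussian M (h x)"
    and centred: "x \<in> I \<Longrightarrow> (\<integral>\<omega>. h x \<omega> \<partial>M) = 0"
    and normalised: "x \<in> I \<Longrightarrow> (\<integral>\<omega>. (cmod (h x \<omega>))\<^sup>2 \<partial>M) = 1"
begin

definition gletter :: "'x \<times> bool \<Rightarrow> 'a \<Rightarrow> complex" where
  "gletter = (\<lambda>(x, b) \<omega>. if b then cnj (h x \<omega>) else h x \<omega>)"

text \<open>The Wirtinger derivative in the conjugate of \<open>h x\<close>; as in
  \<open>complex_gaussian_stein\<close>, the variable \<open>h x\<close> itself counts as a
  constant.\<close>

definition gderiv :: "'x \<Rightarrow> 'x \<times> bool \<Rightarrow> complex" where
  "gderiv x = (\<lambda>(y, b). if y = x \<and> b then 1 else 0)"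

definition letters_at :: "'x \<Rightarrow> ('x \<times> bool) list \<Rightarrow> bool list" where
  "letters_at x ls = map snd (filter (\<lambda>l. fst l = x) ls)"

abbreviation "star_value \<equiv> \<lambda>b z. if b then cnj z else z"

lemma mon_star_letter: "mon (star_letter (h x)) bs \<omega> = mon star_value bs (h x \<omega>)"
  by (induction bs) auto

lemma dmon_star_letter: "dmon (star_letter (h x)) \<delta> bs \<omega> = dmon star_value \<delta> bs (h x \<omega>)"
  by (induction bs) (auto simp: mon_star_letter)

lemma cnj_measurable [measurable]: "cnj \<in> borel_measurable borel"
  by (intro borel_measurable_continuous_onI continuous_intros)

lemma mon_star_value_measurable [measurable]: "mon star_value bs \<in> borel_measurable borel"
proof (induction bs)
  case (Cons b bs)
  have "mon star_value (b # bs) = (\<lambda>z. star_value b z * mon star_value bs z)"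
    by (rule ext) simp
  moreover have "\<dots> \<in> borel_measurable borel"
    using Cons by (cases b) simp_all
  ultimately show ?case by simp
qed (simp add: mon_def[abs_def])

lemma dmon_star_value_measurable [measurable]: "dmon star_value \<delta> bs \<in> borel_measurable borel"
proof (induction bs)
  case (Cons b bs)
  have "dmon star_value \<delta> (b # bs) = (\<lambda>z. \<delta> b * mon star_value bs z + star_value b z * dmon star_value \<delta> bs z)"
    by (rule ext) simp
  moreover have "\<dots> \<in> borel_measurable borel"
    using Cons mon_star_value_measurable[of bs] by (cases b) simp_all
  ultimately show ?case by simp
qed (simp add: dmon.simps[abs_def])

lemma expectation_prod:
  assumes "\<And>x. x \<in> I \<Longrightarrow> F x \<in> borel_measurable borel"
    and "\<And>x. x \<in> I \<Longrightarrow> integrable M (\<lambda>\<omega>. F x (h x \<omega>) :: complex)"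
  shows "integrable M (\<lambda>\<omega>. \<Prod>x\<in>I. F x (h x \<omega>))"
    and "(\<integral>\<omega>. (\<Prod>x\<in>I. F x (h x \<omega>)) \<partial>M) = (\<Prod>x\<in>I. \<integral>\<omega>. F x (h x \<omega>) \<partial>M)"
proof -
  have i: "indep_vars (\<lambda>_. borel) (\<lambda>x \<omega>. F x (h x \<omega>)) I"
    by (rule indep_vars_compose2[OF indep assms(1)])
  show "integrable M (\<lambda>\<omega>. \<Prod>x\<in>I. F x (h x \<omega>))"
    by (rule indep_vars_integrable[OF finite_index i assms(2)])
  show "(\<integral>\<omega>. (\<Prod>x\<in>I. F x (h x \<omega>)) \<partial>M) = (\<Prod>x\<in>I. \<integral>\<omega>. F x (h x \<omega>) \<partial>M)"
    by (rule indep_vars_lebesgue_integral[OF finite_index i assms(2)])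
qed

text \<open>Sorting the commuting letters by variable gives the product form to which independence
  applies.\<close>

lemma mon_gletter:
  assumes "set ls \<subseteq> I \<times> UNIV"
  shows "mon gletter ls \<omega> = (\<Prod>x\<in>I. mon star_value (letters_at x ls) (h x \<omega>))"
  using assms
proof (induction ls)
  case (Cons l ls)
  obtain y b where l: "l = (y, b)" by force
  have y: "y \<in> I" using Cons.prems l by auto
  have "(\<Prod>x\<in>I. mon star_value (letters_at x (l # ls)) (h x \<omega>)) =
      (\<Prod>x\<in>I. (if x = y then star_value b (h y \<omega>) else 1) * mon star_value (letters_at x ls) (h x \<omega>))"
    by (rule prod.cong) (auto simp: l letters_at_def)
  also have "\<dots> = star_value b (h y \<omega>) * (\<Prod>x\<in>I. mon star_value (letters_at x ls) (h x \<omega>))"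
    unfolding prod.distrib by (subst prod.delta[OF finite_index]) (use y in simp)
  finally show ?case using Cons by (simp add: l gletter_def)
qed (simp add: letters_at_def)

lemma dmon_gletter:
  assumes "set ls \<subseteq> I \<times> UNIV" "x \<in> I"
  shows "dmon gletter (gderiv x) ls \<omega> =
    dmon star_value (\<lambda>b. if b then 1 else 0) (letters_at x ls) (h x \<omega>) *
    (\<Prod>y\<in>I - {x}. mon star_value (letters_at y ls) (h y \<omega>))"
  using assms(1)
proof (induction ls)
  case (Cons l ls)
  obtain y b where l: "l = (y, b)" by force
  have y: "y \<in> I" and ls: "set ls \<subseteq> I \<times> UNIV" using Cons.prems l by auto
  note IH = Cons.IH[OF ls]
  show ?case
  proof (cases "y = x")
    case True
    have "(\<Prod>y\<in>I - {x}. mon star_value (letters_at y (l # ls)) (h y \<omega>)) =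
        (\<Prod>y\<in>I - {x}. mon star_value (letters_at y ls) (h y \<omega>))"
      by (rule prod.cong) (auto simp: l True letters_at_def)
    moreover have "mon gletter ls \<omega> = mon star_value (letters_at x ls) (h x \<omega>) *
        (\<Prod>y\<in>I - {x}. mon star_value (letters_at y ls) (h y \<omega>))"
      unfolding mon_gletter[OF ls] by (rule prod.remove[OF finite_index assms(2)])
    ultimately show ?thesis
      using IH by (simp add: l True gderiv_def gletter_def letters_at_def algebra_simps)
  next
    case False
    have fin: "finite (I - {x})" using finite_index by simp
    have "(\<Prod>z\<in>I - {x}. mon star_value (letters_at z (l # ls)) (h z \<omega>)) =
        (\<Prod>z\<in>I - {x}. (if z = y then star_value b (h y \<omega>) else 1) * mon star_value (letters_at z ls) (h z \<omega>))"
      by (rule prod.cong) (auto simp: l letters_at_def)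
    also have "\<dots> = star_value b (h y \<omega>) * (\<Prod>z\<in>I - {x}. mon star_value (letters_at z ls) (h z \<omega>))"
      unfolding prod.distrib by (subst prod.delta[OF fin]) (use y False in simp)
    moreover have "letters_at x (l # ls) = letters_at x ls"
      using False by (simp add: l letters_at_def)
    ultimately show ?thesis
      using IH False by (simp add: l gderiv_def gletter_def)
  qed
qed (simp add: letters_at_def)

lemma integrable_mon:
  assumes "set ls \<subseteq> I \<times> UNIV"
  shows "integrable M (mon gletter ls)"
proof -
  have "integrable M (\<lambda>\<omega>. \<Prod>x\<in>I. mon star_value (letters_at x ls) (h x \<omega>))"
    by (rule expectation_prod(1))
       (auto simp: mon_star_letter[symmetric] intro!: complex_gaussian_stein(1) gaussian centred normalised)
  moreover have "mon gletter ls = (\<lambda>\<omega>. \<Prod>x\<in>I. mon star_value (letters_at x ls) (h x \<omega>))"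
    using mon_gletter[OF assms] by auto
  ultimately show ?thesis by simp
qed

text \<open>Both expectations factor over the independent variables. The factors agree away from
  \<open>x\<close>, and at \<open>x\<close> they agree by the identity for one complex
  Gaussian.\<close>

lemma family_stein_mon:
  assumes "set ls \<subseteq> I \<times> UNIV" "x \<in> I"
  shows "(\<integral>\<omega>. h x \<omega> * mon gletter ls \<omega> \<partial>M) = (\<integral>\<omega>. dmon gletter (gderiv x) ls \<omega> \<partial>M)"
proof -
  let ?d = "dmon star_value (\<lambda>b. if b then 1 else 0) (letters_at x ls)"
  let ?m = "\<lambda>y. mon star_value (letters_at y ls)"
  note stein = complex_gaussian_stein[OF gaussian centred normalised]
  have im: "integrable M (\<lambda>\<omega>. mon star_value bs (h y \<omega>))" if "y \<in> I" for y bs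
    using stein(1)[OF that that that, of bs] by (simp add: mon_star_letter[abs_def])
  have id: "integrable M (\<lambda>\<omega>. ?d (h x \<omega>))"
    using integrable_dmon[of UNIV M "star_letter (h x)" "letters_at x ls" "[]", OF stein(1)] assms(2)
    by (simp add: dmon_star_letter[abs_def])
  define F where "F y z = (if y = x then z * ?m x z else ?m y z)" for y z
  define G where "G y z = (if y = x then ?d z else ?m y z)" for y z
  have prod_if: "(\<Prod>y\<in>I. if y = x then f else k y) = f * (\<Prod>y\<in>I - {x}. k y)" for f :: complex and k
    by (subst prod.remove[OF finite_index assms(2)]) (auto intro: prod.cong)
  have F: "h x \<omega> * mon gletter ls \<omega> = (\<Prod>y\<in>I. F y (h y \<omega>))" for \<omega>
  proof -
    have "(\<Prod>y\<in>I. F y (h y \<omega>)) = (\<Prod>y\<in>I. if y = x then h x \<omega> * ?m x (h x \<omega>) else ?m y (h y \<omega>))"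
      by (rule prod.cong) (auto simp: F_def)
    also have "\<dots> = h x \<omega> * mon gletter ls \<omega>"
      unfolding mon_gletter[OF assms(1)] prod_if
      by (subst prod.remove[OF finite_index assms(2)]) simp
    finally show ?thesis by simp
  qed
  have G: "dmon gletter (gderiv x) ls \<omega> = (\<Prod>y\<in>I. G y (h y \<omega>))" for \<omega>
  proof -
    have "(\<Prod>y\<in>I. G y (h y \<omega>)) = (\<Prod>y\<in>I. if y = x then ?d (h x \<omega>) else ?m y (h y \<omega>))"
      by (rule prod.cong) (auto simp: G_def)
    then show ?thesis unfolding dmon_gletter[OF assms] prod_if by simp
  qed
  have "F y \<in> borel_measurable borel" for y
    unfolding F_def[abs_def] by (cases "y = x") auto
  moreover have "integrable M (\<lambda>\<omega>. F y (h y \<omega>))" if "y \<in> I" for y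
    using im[OF that, of "False # letters_at x ls"] im[OF that, of "letters_at y ls"]
    by (cases "y = x") (simp_all add: F_def)
  ultimately have EF: "(\<integral>\<omega>. h x \<omega> * mon gletter ls \<omega> \<partial>M) = (\<Prod>y\<in>I. \<integral>\<omega>. F y (h y \<omega>) \<partial>M)"
    unfolding F by (rule expectation_prod(2))
  have "G y \<in> borel_measurable borel" for y
    unfolding G_def[abs_def] by (cases "y = x") auto
  moreover have "integrable M (\<lambda>\<omega>. G y (h y \<omega>))" if "y \<in> I" for y
    using id im[OF that, of "letters_at y ls"] by (cases "y = x") (simp_all add: G_def)
  ultimately have EG: "(\<integral>\<omega>. dmon gletter (gderiv x) ls \<omega> \<partial>M) = (\<Prod>y\<in>I. \<integral>\<omega>. G y (h y \<omega>) \<partial>M)"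
    unfolding G by (rule expectation_prod(2))
  show ?thesis
    unfolding EF EG
  proof (rule prod.cong)
    fix y assume "y \<in> I"
    show "(\<integral>\<omega>. F y (h y \<omega>) \<partial>M) = (\<integral>\<omega>. G y (h y \<omega>) \<partial>M)"
      using stein(2)[OF assms(2,2,2), of "letters_at x ls"]
      by (cases "y = x") (simp_all add: F_def G_def mon_star_letter dmon_star_letter)
  qed simp
qed

definition gpoly :: "'x \<Rightarrow> ('a \<Rightarrow> complex) \<Rightarrow> ('a \<Rightarrow> complex) \<Rightarrow> bool" where
  "gpoly x = poly_deriv (I \<times> UNIV) gletter (gderiv x)"

lemma gpoly_stein:
  assumes "gpoly x f f'" "x \<in> I"
  shows "integrable M (\<lambda>\<omega>. h x \<omega> * f \<omega>)" "integrable M f'"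
    and "(\<integral>\<omega>. h x \<omega> * f \<omega> \<partial>M) = (\<integral>\<omega>. f' \<omega> \<partial>M)"
proof -
  have "integrable M (\<lambda>\<omega>. h x \<omega> * mon gletter ls \<omega>)" if "set ls \<subseteq> I \<times> UNIV" for ls
    using integrable_mon[of "(x, False) # ls"] that assms(2) by (simp add: gletter_def mon_def[abs_def])
  from poly_deriv_stein[of "I \<times> UNIV" M gletter "h x", OF integrable_mon this family_stein_mon]
  show "integrable M (\<lambda>\<omega>. h x \<omega> * f \<omega>)" "integrable M f'"
    "(\<integral>\<omega>. h x \<omega> * f \<omega> \<partial>M) = (\<integral>\<omega>. f' \<omega> \<partial>M)"
    using assms unfolding gpoly_def by blast+
qed

lemma gpoly_integrable: "gpoly x f f' \<Longrightarrow> integrable M f"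
  unfolding gpoly_def by (rule poly_deriv_integrable[OF integrable_mon])

lemma gpoly_gauss: "y \<in> I \<Longrightarrow> gpoly x (h y) (\<lambda>_. 0)"
  and gpoly_gauss_cnj: "y \<in> I \<Longrightarrow> gpoly x (\<lambda>\<omega>. cnj (h y \<omega>)) (\<lambda>_. if y = x then 1 else 0)"
  using poly_deriv_letter[of "(y, False)" "I \<times> UNIV" gletter "gderiv x"]
    poly_deriv_letter[of "(y, True)" "I \<times> UNIV" gletter "gderiv x"]
  by (simp_all add: gpoly_def gletter_def gderiv_def)

lemmas gpoly_const = poly_deriv_const[of "I \<times> UNIV" gletter "gderiv x" for x, folded gpoly_def]
lemmas gpoly_add = poly_deriv.addI[of "I \<times> UNIV" gletter "gderiv x" for x, folded gpoly_def]
lemmas gpoly_mult = poly_deriv_mult[of "I \<times> UNIV" gletter "gderiv x" for x, folded gpoly_def]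
lemmas gpoly_scale = poly_deriv_scale[of "I \<times> UNIV" gletter "gderiv x" for x, folded gpoly_def]
lemmas gpoly_sum = poly_deriv_sum[of _ "I \<times> UNIV" gletter "gderiv x" for x, folded gpoly_def]

end

section \<open>Moments of a free family with prescribed cumulants\<close>

text \<open>\<open>open_block \<kappa> a n w\<close> is the sum over the non-crossing completions of a block that already
  consists of \<open>n\<close> letters \<open>a\<close> in front of \<open>w\<close>; further letters of the block are chosen from the
  right.\<close>

function (sequential) free_moment :: "('l \<Rightarrow> nat \<Rightarrow> complex) \<Rightarrow> 'l list \<Rightarrow> complex"
  and open_block :: "('l \<Rightarrow> nat \<Rightarrow> complex) \<Rightarrow> 'l \<Rightarrow> nat \<Rightarrow> 'l list \<Rightarrow> complex" where
  "free_moment \<kappa> [] = 1"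
| "free_moment \<kappa> (a # w) = open_block \<kappa> a 1 w"
| "open_block \<kappa> a n w = \<kappa> a n * free_moment \<kappa> w +
    (\<Sum>k<length w. if w ! k = a
       then open_block \<kappa> a (Suc n) (take k w) * free_moment \<kappa> (drop (Suc k) w) else 0)"
  by pat_completeness auto
termination
  \<comment> \<open>An open block in front of \<open>w\<close> is weighed strictly between
    \<open>w\<close> and \<open>a # w\<close>, since the calls alternate between the two
    functions.\<close>
  by (relation "Wellfounded.measure (\<lambda>x. case x of Inl (\<kappa>, w) \<Rightarrow> 2 * length w
        | Inr (\<kappa>, a, n, w) \<Rightarrow> 2 * length w + 1)") auto

declare open_block.simps [simp del]

text \<open>The summand stays abstract so that the sum over cut positions can be moved through the
  linear functional \<open>centred\<close> before \<open>open_block\<close> and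
  \<open>free_moment\<close> are inserted.\<close>

definition split_sum :: "'l \<Rightarrow> ('l list \<Rightarrow> 'l list \<Rightarrow> complex) \<Rightarrow> 'l list \<Rightarrow> complex" where
  "split_sum a B w = (\<Sum>k<length w. if w ! k = a then B (take k w) (drop (Suc k) w) else 0)"

lemma open_block_split:
  "open_block \<kappa> a n w = \<kappa> a n * free_moment \<kappa> w +
    split_sum a (\<lambda>u v. open_block \<kappa> a (Suc n) u * free_moment \<kappa> v) w"
  by (subst open_block.simps) (simp add: split_sum_def)

lemma split_sum_Nil [simp]: "split_sum a B [] = 0"
  by (simp add: split_sum_def)

lemma split_sum_Cons:
  "split_sum a B (b # w) = (if b = a then B [] w else 0) + split_sum a (\<lambda>u. B (b # u)) w"
  by (auto simp: split_sum_def sum.lessThan_Suc_shift simp del: sum.lessThan_Suc intro!: sum.cong)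

lemma split_sum_replicate:
  "split_sum a B (replicate l b @ w) =
    (if b = a then \<Sum>k<l. B (replicate k a) (replicate (l - Suc k) a @ w) else 0) +
    split_sum a (\<lambda>u. B (replicate l b @ u)) w"
proof (induction l arbitrary: B)
  case (Suc l)
  show ?case
    unfolding replicate_Suc append_Cons split_sum_Cons Suc.IH
    by (auto simp: sum.lessThan_Suc_shift simp del: sum.lessThan_Suc)
qed simp

subsection \<open>Freeness\<close>

text \<open>\<open>centred m [(a1, l1), (a2, l2), \<dots>] f\<close> is the value of the linear extension of \<open>f\<close> at
  \<open>(a1^l1 - m a1 l1) (a2^l2 - m a2 l2) \<dots>\<close>.\<close>

fun centred :: "('l \<Rightarrow> nat \<Rightarrow> complex) \<Rightarrow> ('l \<times> nat) list \<Rightarrow> ('l list \<Rightarrow> complex) \<Rightarrow> complex" where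
  "centred m [] f = f []"
| "centred m ((a, l) # r) f =
    centred m r (\<lambda>w. f (replicate l a @ w)) - m a l * centred m r f"

lemma centred_add: "centred m r (\<lambda>w. f w + h w) = centred m r f + centred m r h"
  by (induction r arbitrary: f h) (auto simp: algebra_simps)

lemma centred_mult: "centred m r (\<lambda>w. z * f w) = z * centred m r f"
  by (induction r arbitrary: f) (auto simp: algebra_simps)

lemma centred_zero [simp]: "centred m r (\<lambda>w. 0) = 0"
  using centred_mult[of m r 0 "\<lambda>_. 0"] by simp

lemma centred_sum: "centred m r (\<lambda>w. \<Sum>i\<in>I. f i w) = (\<Sum>i\<in>I. centred m r (f i))"
  by (induction I rule: infinite_finite_induct) (auto simp: centred_add)

lemma centred_append_single:
  "centred m (r @ [(a, l)]) f = centred m r (\<lambda>w. f (w @ replicate l a)) - m a l * centred m r f"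
proof (induction r arbitrary: f)
  case (Cons x r)
  obtain b j where x: "x = (b, j)" by force
  show ?case
    unfolding x append_Cons centred.simps Cons by (simp add: algebra_simps)
qed simp

text \<open>The cut falls into one factor \<open>t\<close>. That factor loses its centring, because
  its constant term contains no letter to cut at; the factors before and after it remain centred,
  one group in each argument of \<open>B\<close>.\<close>

lemma centred_split_sum:
  "centred m r (split_sum a B) =
    (\<Sum>t<length r. if fst (r ! t) = a
       then \<Sum>k<snd (r ! t). centred m (take t r) (\<lambda>u. centred m (drop (Suc t) r)
              (\<lambda>v. B (u @ replicate k a) (replicate (snd (r ! t) - Suc k) a @ v)))
       else 0)"
proof (induction r arbitrary: B)
  case (Cons x r)
  obtain b l where x: "x = (b, l)" by force
  let ?s = "\<lambda>B t. if fst (r ! t) = a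
       then \<Sum>k<snd (r ! t). centred m (take t r) (\<lambda>u. centred m (drop (Suc t) r)
              (\<lambda>v. B (u @ replicate k a) (replicate (snd (r ! t) - Suc k) a @ v)))
       else 0"
  have "centred m (x # r) (split_sum a B) =
      (if b = a then \<Sum>k<l. centred m r (\<lambda>v. B (replicate k a) (replicate (l - Suc k) a @ v)) else 0) +
      ((\<Sum>t<length r. ?s (\<lambda>u. B (replicate l b @ u)) t) - m b l * (\<Sum>t<length r. ?s B t))"
    by (simp add: x split_sum_replicate centred_add centred_sum Cons.IH)
  also have "(\<Sum>t<length r. ?s (\<lambda>u. B (replicate l b @ u)) t) - m b l * (\<Sum>t<length r. ?s B t) =
      (\<Sum>t<length r. if fst (r ! t) = a
         then \<Sum>k<snd (r ! t). centred m (x # take t r) (\<lambda>u. centred m (drop (Suc t) r)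
              (\<lambda>v. B (u @ replicate k a) (replicate (snd (r ! t) - Suc k) a @ v)))
         else 0)"
    unfolding sum_distrib_left sum_subtractf[symmetric]
    by (rule sum.cong) (auto simp: x sum_distrib_left sum_subtractf)
  finally show ?case
    by (simp add: x sum.lessThan_Suc_shift del: sum.lessThan_Suc cong: if_cong)
qed simp

text \<open>Joint induction on the total exponent, with a companion statement for an open block of
  \<open>a\<close> in front of a word whose first centred factor is not in \<open>a\<close>. The
  block can only be continued in a later factor, so each cut isolates a shorter alternating centred
  word on its right or, if the cut is in the last factor, on its left.\<close>

theorem free_moment_free:
  fixes \<kappa> :: "'l \<Rightarrow> nat \<Rightarrow> complex"
  defines "m \<equiv> \<lambda>a l. free_moment \<kappa> (replicate l a)"
  assumes "r \<noteq> []" "distinct_adj (map fst r)"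
  shows "centred m r (free_moment \<kappa>) = 0"
proof -
  have "(\<forall>r. r \<noteq> [] \<and> distinct_adj (map fst r) \<and> sum_list (map snd r) \<le> s \<longrightarrow>
           centred m r (free_moment \<kappa>) = 0) \<and>
        (\<forall>a n l r. r \<noteq> [] \<and> distinct_adj (a # map fst r) \<and> l + sum_list (map snd r) \<le> s \<longrightarrow>
           centred m r (\<lambda>w. open_block \<kappa> a n (replicate l a @ w)) = 0)" for s
  proof (induction s rule: less_induct)
    case (less s)
    have A: "centred m r (free_moment \<kappa>) = 0"
      if r: "r \<noteq> []" "distinct_adj (map fst r)" "sum_list (map snd r) \<le> s" for r
    proof -
      obtain a l r' where r': "r = (a, l) # r'" using r(1) by (metis neq_Nil_conv surj_pair)
      show ?thesis
      proof (cases "l = 0")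
        \<comment> \<open>The first factor is a^0 - 1 = 0, as the empty word has moment 1.\<close>
        case True
        then show ?thesis by (simp add: r' m_def)
      next
        case False
        then obtain l' where l': "l = Suc l'" by (cases l) auto
        show ?thesis
        proof (cases "r' = []")
          case True
          then show ?thesis by (simp add: r' m_def)
        next
          case False
          have "centred m r' (\<lambda>w. open_block \<kappa> a 1 (replicate l' a @ w)) = 0"
            using less[of "s - 1"] r False by (auto simp: r' l')
          moreover have "centred m r' (free_moment \<kappa>) = 0"
            using less[of "s - 1"] r False by (auto simp: r' l' distinct_adj_Cons)
          ultimately show ?thesis by (simp add: r' l')
        qed
      qed
    qed
    have B: "centred m r (\<lambda>w. open_block \<kappa> a n (replicate l a @ w)) = 0"
      if r: "r \<noteq> []" "distinct_adj (a # map fst r)" "l + sum_list (map snd r) \<le> s" for a n l r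
    proof -
      \<comment> \<open>An uncentred run is its centred version plus a scalar, so two instances of
        the first statement suffice.\<close>
      have N: "centred m r' (\<lambda>w. free_moment \<kappa> (replicate j a @ w)) = 0"
        if "r' \<noteq> []" "distinct_adj (a # map fst r')" "j + sum_list (map snd r') \<le> s" for j r'
        using A[of "(a, j) # r'"] A[of r'] that by (auto simp: distinct_adj_Cons)
      have S: "centred m r (split_sum a (\<lambda>u v. open_block \<kappa> a (Suc n) (replicate l a @ u) * free_moment \<kappa> v)) = 0"
        unfolding centred_split_sum
      proof (intro sum.neutral ballI, clarsimp, intro sum.neutral ballI)
        fix t k assume t: "t < length r" "a = fst (r ! t)" and k: "k \<in> {..<snd (r ! t)}"
        let ?b = "fst (r ! t)" and ?l = "snd (r ! t)"
        have rt: "r = take t r @ (r ! t) # drop (Suc t) r"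
          using t(1) by (rule id_take_nth_drop)
        have sm: "sum_list (map snd r) = sum_list (map snd (take t r)) + ?l + sum_list (map snd (drop (Suc t) r))"
          by (subst rt) (simp del: append_take_drop_id)
        have da: "distinct_adj (a # map fst (take t r) @ fst (r ! t) # map fst (drop (Suc t) r))"
          using r(2) by (subst (asm) rt) simp
        \<comment> \<open>The first factor of \<open>r\<close> is not in \<open>a\<close>, so
          something alternating stands to the left of the cut factor.\<close>
        have tne: "take t r \<noteq> []"
          using da t(2) by (auto simp del: take_eq_Nil)
        show "centred m (take t r) (\<lambda>u. centred m (drop (Suc t) r)
            (\<lambda>v. open_block \<kappa> ?b (Suc n) (replicate l ?b @ u @ replicate k ?b) *
               free_moment \<kappa> (replicate (?l - Suc k) ?b @ v))) = 0"
        proof (cases "drop (Suc t) r = []")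
          case False
          have "distinct_adj (a # map fst (drop (Suc t) r))"
            using da t(2) by (auto simp: distinct_adj_append_iff distinct_adj_Cons)
          then show ?thesis
            using N[OF False, of "?l - Suc k"] r(3) sm t(2) by (simp add: centred_mult)
        next
          \<comment> \<open>The cut is in the last factor, so the right part is a plain run of
            \<open>a\<close> and contributes a scalar. On the left the trailing run \<open>k\<close>
            is again centred plus scalar; the total exponent has dropped by the letter at the cut,
            so the induction hypothesis covers both.\<close>
          case True
          let ?T = "\<lambda>w. open_block \<kappa> ?b (Suc n) (replicate l ?b @ w)"
          have d1: "distinct_adj (a # map fst (take t r))"
            and d2: "distinct_adj (a # map fst (take t r @ [(a, k)]))"
            using da t(2) True by (auto simp: distinct_adj_append_iff distinct_adj_Cons)
          have "centred m (take t r) ?T = 0"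
            using less[of "s - 1"] d1 tne r(3) sm k t(2) by auto
          moreover have "centred m (take t r @ [(?b, k)]) ?T = 0"
          proof -
            have "l + sum_list (map snd (take t r @ [(a, k)])) \<le> s - 1" "s - 1 < s"
              using r(3) sm k by auto
            then show ?thesis
              using less[of "s - 1"] d2 unfolding t(2) by blast
          qed
          ultimately have "centred m (take t r) (\<lambda>u. ?T (u @ replicate k ?b)) = 0"
            by (simp add: centred_append_single)
          then show ?thesis
            using centred_mult[of m "take t r" "free_moment \<kappa> (replicate (?l - Suc k) ?b)"
                "\<lambda>u. ?T (u @ replicate k ?b)"] True
            by (simp add: mult.commute)
        qed
      qed
      \<comment> \<open>Cuts inside the leading run leave the whole centred word to the free moment
        on the right, which \<open>N\<close> annihilates; the remaining cuts are
        \<open>S\<close>.\<close>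
      have "open_block \<kappa> a n (replicate l a @ w) = \<kappa> a n * free_moment \<kappa> (replicate l a @ w) +
          ((\<Sum>k<l. open_block \<kappa> a (Suc n) (replicate k a) * free_moment \<kappa> (replicate (l - Suc k) a @ w)) +
           split_sum a (\<lambda>u v. open_block \<kappa> a (Suc n) (replicate l a @ u) * free_moment \<kappa> v) w)" for w
        unfolding open_block_split[of \<kappa> a n] split_sum_replicate by simp
      then show ?thesis
        using N[OF r(1,2)] r(3) S by (simp add: centred_add centred_mult centred_sum)
    qed
    show ?case using A B by blast
  qed
  then show ?thesis using assms by blast
qed

subsection \<open>Non-crossing partitions\<close>

text \<open>Arbitrary ground sets are needed because cutting a partition of an interval leaves
  partitions of two smaller intervals.\<close>

definition ncp :: "nat set \<Rightarrow> nat set set set" where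
  "ncp S = {\<pi>. partition_on S \<pi> \<and>
     (\<forall>U\<in>\<pi>. \<forall>V\<in>\<pi>. U \<noteq> V \<longrightarrow> \<not> (\<exists>a\<in>U. \<exists>b\<in>V. \<exists>c\<in>U. \<exists>d\<in>V. a < b \<and> b < c \<and> c < d))}"

lemma noncrossing_partitions_eq_ncp: "noncrossing_partitions n = ncp {1..n}"
  by (simp add: noncrossing_partitions_def ncp_def)

definition nc_sum :: "(nat \<Rightarrow> complex) \<Rightarrow> nat set \<Rightarrow> complex" where
  "nc_sum k S = (\<Sum>\<pi>\<in>ncp S. \<Prod>V\<in>\<pi>. k (card V))"

lemma finite_ncp: "finite S \<Longrightarrow> finite (ncp S)"
  by (rule finite_subset[of _ "Pow (Pow S)"]) (auto simp: ncp_def partition_on_def)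

lemma ncp_partition: "\<pi> \<in> ncp S \<Longrightarrow> partition_on S \<pi>"
  by (simp add: ncp_def)

lemma ncp_finite: "\<pi> \<in> ncp S \<Longrightarrow> finite S \<Longrightarrow> finite \<pi>"
  using finite_elements ncp_partition by blast

lemma ncp_crossing:
  "\<pi> \<in> ncp S \<Longrightarrow> U \<in> \<pi> \<Longrightarrow> V \<in> \<pi> \<Longrightarrow> a \<in> U \<Longrightarrow> b \<in> V \<Longrightarrow> c \<in> U \<Longrightarrow> d \<in> V \<Longrightarrow>
    a < b \<Longrightarrow> b < c \<Longrightarrow> c < d \<Longrightarrow> U = V"
  unfolding ncp_def by blast

lemma ncp_unique: "\<pi> \<in> ncp S \<Longrightarrow> U \<in> \<pi> \<Longrightarrow> V \<in> \<pi> \<Longrightarrow> x \<in> U \<Longrightarrow> x \<in> V \<Longrightarrow> U = V"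
  unfolding ncp_def partition_on_def disjoint_def by blast

lemma ncp_subset: "\<pi> \<in> ncp S \<Longrightarrow> U \<in> \<pi> \<Longrightarrow> U \<subseteq> S"
  unfolding ncp_def partition_on_def by blast

lemma ncp_Union: "\<pi> \<in> ncp S \<Longrightarrow> \<Union>\<pi> = S"
  by (simp add: ncp_def partition_on_def)

lemma ncp_nonempty: "\<pi> \<in> ncp S \<Longrightarrow> U \<in> \<pi> \<Longrightarrow> U \<noteq> {}"
  unfolding ncp_def partition_on_def by blast

lemma ncpI:
  assumes "\<Union>\<pi> = S" "{} \<notin> \<pi>"
    and "\<And>U V x. U \<in> \<pi> \<Longrightarrow> V \<in> \<pi> \<Longrightarrow> x \<in> U \<Longrightarrow> x \<in> V \<Longrightarrow> U = V"
    and "\<And>U V a b c d. U \<in> \<pi> \<Longrightarrow> V \<in> \<pi> \<Longrightarrow> a \<in> U \<Longrightarrow> b \<in> V \<Longrightarrow> c \<in> U \<Longrightarrow> d \<in> V \<Longrightarrow>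
      a < b \<Longrightarrow> b < c \<Longrightarrow> c < d \<Longrightarrow> U = V"
  shows "\<pi> \<in> ncp S"
proof -
  have "disjoint \<pi>" using assms(3) unfolding disjoint_def by blast
  then show ?thesis using assms(1,2,4) unfolding ncp_def partition_on_def by blast
qed

lemma ncp_image_strict_mono:
  assumes f: "strict_mono f" and \<pi>: "\<pi> \<in> ncp S"
  shows "(`) f ` \<pi> \<in> ncp (f ` S)"
proof -
  have lt: "f x < f y \<longleftrightarrow> x < y" for x y using f by (rule strict_mono_less)
  have inj: "inj f" using f by (rule strict_mono_imp_inj_on)
  have "partition_on (f ` S) ((`) f ` \<pi>)"
  proof (rule partition_onI)
    show "\<Union> ((`) f ` \<pi>) = f ` S" using \<pi> by (auto simp: ncp_def partition_on_def)
    show "disjnt p q" if "p \<in> (`) f ` \<pi>" "q \<in> (`) f ` \<pi>" "p \<noteq> q" for p q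
    proof -
      obtain U V where uv: "p = f ` U" "q = f ` V" "U \<in> \<pi>" "V \<in> \<pi>" using \<open>p \<in> _\<close> \<open>q \<in> _\<close> by blast
      then have "U \<noteq> V" using \<open>p \<noteq> q\<close> by auto
      then have "U \<inter> V = {}" using \<pi> uv by (simp add: ncp_def partition_on_def disjoint_def)
      then show ?thesis using inj by (auto simp: uv disjnt_def inj_def)
    qed
    show "{} \<notin> (`) f ` \<pi>"
      using \<pi> by (auto simp: ncp_def partition_on_def)
  qed
  then show ?thesis using \<pi> by (fastforce simp: ncp_def lt)
qed

text \<open>Only the order of the points matters, so the part to the right of a cut can be moved
  back to start at 1.\<close>

lemma nc_sum_shift: "nc_sum k ((+) j ` S) = nc_sum k S"
proof -
  let ?f = "\<lambda>x::nat. j + x" and ?g = "\<lambda>x::nat. x - j"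
  have gf: "(`) ?g ` (`) ?f ` \<pi> = \<pi>" for \<pi> by (simp add: image_image)
  have inj: "inj_on ((`) ((`) ?f)) (ncp S)"
    by (rule inj_on_inverseI[of _ "(`) ((`) ?g)"]) (rule gf)
  have smono: "strict_mono ?f" by (simp add: strict_mono_def)
  have "ncp (?f ` S) = (`) ((`) ?f) ` ncp S"
  proof
    show "(`) ((`) ?f) ` ncp S \<subseteq> ncp (?f ` S)"
      using ncp_image_strict_mono[OF smono] by auto
    show "ncp (?f ` S) \<subseteq> (`) ((`) ?f) ` ncp S"
    proof
      fix \<pi> assume \<pi>: "\<pi> \<in> ncp (?f ` S)"
      have sub: "V \<subseteq> ?f ` S" if "V \<in> \<pi>" for V
        using \<pi> that by (auto simp: ncp_def partition_on_def)
      have fgV: "?f ` ?g ` V = V" if "V \<in> \<pi>" for V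
      proof -
        have "?f (?g x) = x" if "x \<in> V" for x using sub[OF \<open>V \<in> \<pi>\<close>] that by auto
        then show ?thesis by (force simp: image_image)
      qed
      then have fg: "(`) ?f ` (`) ?g ` \<pi> = \<pi>" by (force simp: image_image)
      have "partition_on S ((`) ?g ` \<pi>)"
      proof (rule partition_onI)
        have "\<Union> ((`) ?g ` \<pi>) = ?g ` \<Union>\<pi>" by blast
        then show "\<Union> ((`) ?g ` \<pi>) = S" using \<pi> by (simp add: ncp_def partition_on_def image_image)
        show "disjnt p q" if "p \<in> (`) ?g ` \<pi>" "q \<in> (`) ?g ` \<pi>" "p \<noteq> q" for p q
        proof -
          obtain U V where uv: "p = ?g ` U" "q = ?g ` V" "U \<in> \<pi>" "V \<in> \<pi>" using \<open>p \<in> _\<close> \<open>q \<in> _\<close> by blast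
          then have "U \<noteq> V" using \<open>p \<noteq> q\<close> by auto
          then have "U \<inter> V = {}" using \<pi> uv by (simp add: ncp_def partition_on_def disjoint_def)
          then have "?f ` p \<inter> ?f ` q = {}" unfolding uv using fgV uv(3,4) by simp
          then show ?thesis by (auto simp: disjnt_def)
        qed
        show "{} \<notin> (`) ?g ` \<pi>"
          using \<pi> by (auto simp: ncp_def partition_on_def)
      qed
      moreover have "\<not> (\<exists>a\<in>U. \<exists>b\<in>V. \<exists>c\<in>U. \<exists>d\<in>V. a < b \<and> b < c \<and> c < d)"
        if UV: "U \<in> (`) ?g ` \<pi>" "V \<in> (`) ?g ` \<pi>" "U \<noteq> V" for U V
      proof
        assume "\<exists>a\<in>U. \<exists>b\<in>V. \<exists>c\<in>U. \<exists>d\<in>V. a < b \<and> b < c \<and> c < d"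
        then obtain a b c d where abcd: "a \<in> U" "b \<in> V" "c \<in> U" "d \<in> V" "a < b" "b < c" "c < d" by blast
        obtain U' V' where uv: "U = ?g ` U'" "V = ?g ` V'" "U' \<in> \<pi>" "V' \<in> \<pi>"
          using UV(1,2) by blast
        have "?f a \<in> U'" "?f b \<in> V'" "?f c \<in> U'" "?f d \<in> V'"
          using abcd(1-4) fgV[OF uv(3)] fgV[OF uv(4)] unfolding uv by blast+
        then have "U' = V'"
          using ncp_crossing[OF \<pi> uv(3,4), of "?f a" "?f b" "?f c" "?f d"] abcd(5-7) by simp
        then show False using uv UV(3) by simp
      qed
      ultimately have "(`) ?g ` \<pi> \<in> ncp S" unfolding ncp_def by blast
      then show "\<pi> \<in> (`) ((`) ?f) ` ncp S" using fg by (metis image_eqI)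
    qed
  qed
  then have "nc_sum k (?f ` S) = (\<Sum>\<pi>\<in>ncp S. \<Prod>V\<in>(`) ?f ` \<pi>. k (card V))"
    unfolding nc_sum_def by (simp add: sum.reindex[OF inj])
  also have "\<dots> = nc_sum k S"
    unfolding nc_sum_def
  proof (rule sum.cong)
    fix \<pi> assume "\<pi> \<in> ncp S"
    have "inj_on ((`) ?f) \<pi>" by (rule inj_on_inverseI[of _ "(`) ?g"]) (simp add: image_image)
    then show "(\<Prod>V\<in>(`) ?f ` \<pi>. k (card V)) = (\<Prod>V\<in>\<pi>. k (card V))"
      by (simp add: prod.reindex card_image)
  qed simp
  finally show ?thesis .
qed

section \<open>Cutting and gluing partitions at the block of 0\<close>

definition zero_block :: "nat set set \<Rightarrow> nat set" where
  "zero_block \<pi> = \<Union>{V \<in> \<pi>. 0 \<in> V}"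

lemma zero_block_eq: "partition_on S \<pi> \<Longrightarrow> V \<in> \<pi> \<Longrightarrow> 0 \<in> V \<Longrightarrow> zero_block \<pi> = V"
  by (auto simp: zero_block_def partition_on_def disjoint_def)

lemma zero_block_in:
  assumes "partition_on S \<pi>" "0 \<in> S"
  shows "zero_block \<pi> \<in> \<pi>" "0 \<in> zero_block \<pi>"
proof -
  obtain V where "V \<in> \<pi>" "0 \<in> V" using assms by (auto simp: partition_on_def)
  then show "zero_block \<pi> \<in> \<pi>" "0 \<in> zero_block \<pi>" using zero_block_eq[OF assms(1)] by auto
qed

text \<open>The block of \<open>0\<close> is counted with \<open>n\<close> extra elements, the
  letters an open block has collected elsewhere. As \<open>0\<close> itself is one letter,
  \<open>n\<close> here corresponds to \<open>Suc n\<close> in \<open>open_block\<close>.\<close>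

definition open_weight :: "(nat \<Rightarrow> complex) \<Rightarrow> nat \<Rightarrow> nat set set \<Rightarrow> complex" where
  "open_weight k n \<pi> = k (n + card (zero_block \<pi>)) * (\<Prod>V\<in>\<pi> - {zero_block \<pi>}. k (card V))"

definition nc_open_sum :: "(nat \<Rightarrow> complex) \<Rightarrow> nat \<Rightarrow> nat \<Rightarrow> complex" where
  "nc_open_sum k n l = (\<Sum>\<pi>\<in>ncp {..l}. open_weight k n \<pi>)"

text \<open>Cutting a non-crossing partition of \<open>{..l}\<close> at the largest element \<open>j\<close> of the block of
  \<open>0\<close>.\<close>

definition cut_left :: "nat \<Rightarrow> nat set set \<Rightarrow> nat set set" where
  "cut_left j \<pi> = insert (zero_block \<pi> - {j}) {V \<in> \<pi>. V \<subseteq> {..<j}}"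

definition cut_right :: "nat \<Rightarrow> nat set set \<Rightarrow> nat set set" where
  "cut_right j \<pi> = {V \<in> \<pi>. V \<subseteq> {j<..}}"

definition glue :: "nat \<Rightarrow> nat set set \<times> nat set set \<Rightarrow> nat set set" where
  "glue j = (\<lambda>(\<sigma>, \<tau>). insert (insert j (zero_block \<sigma>)) (\<sigma> - {zero_block \<sigma>}) \<union> \<tau>)"

text \<open>A block with points on both sides of \<open>j\<close> would cross the block that
  contains \<open>0\<close> and \<open>j\<close>.\<close>

lemma block_cases:
  assumes \<pi>: "\<pi> \<in> ncp {..l}" and j: "j = Max (zero_block \<pi>)" and V: "V \<in> \<pi>" "V \<noteq> zero_block \<pi>"
  shows "V \<subseteq> {..<j} \<or> V \<subseteq> {j<..}"
proof (rule ccontr)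
  note zb = zero_block_in[OF ncp_partition[OF \<pi>]]
  have fin: "finite (zero_block \<pi>)" using ncp_subset[OF \<pi> zb(1)] finite_subset by auto
  then have jin: "j \<in> zero_block \<pi>" using zb(2) unfolding j by (auto intro: Max_in)
  have "j \<notin> V" "0 \<notin> V" using ncp_unique[OF \<pi> V(1) zb(1)] jin zb(2) V(2) by auto
  moreover assume "\<not> ?thesis"
  ultimately obtain x y where xy: "x \<in> V" "y \<in> V" "x < j" "j < y" "0 < x"
    by (metis greaterThan_iff gr0I lessThan_iff linorder_neqE_nat subsetI)
  then have "zero_block \<pi> = V"
    using ncp_crossing[OF \<pi> zb(1) V(1) zb(2) xy(1) jin xy(2)] by auto
  then show False using V(2) by simp
qed

lemma cut_properties:
  assumes \<pi>: "\<pi> \<in> ncp {..l}" and j: "j = Max (zero_block \<pi>)" and "0 < j"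
  shows "cut_left j \<pi> \<in> ncp {..j - 1}" "cut_right j \<pi> \<in> ncp {j<..l}"
    and "zero_block (cut_left j \<pi>) = zero_block \<pi> - {j}"
    and "glue j (cut_left j \<pi>, cut_right j \<pi>) = \<pi>" "j \<le> l"
proof -
  let ?Z = "zero_block \<pi>"
  note zb = zero_block_in[OF ncp_partition[OF \<pi>]]
  have fin: "finite ?Z" using ncp_subset[OF \<pi> zb(1)] finite_subset by auto
  then have jin: "j \<in> ?Z" using zb(2) unfolding j by (auto intro: Max_in)
  have Zle: "x \<le> j" if "x \<in> ?Z" for x using that fin unfolding j by simp
  note cases = block_cases[OF \<pi> j]
  show "j \<le> l" using jin ncp_subset[OF \<pi> zb(1)] by auto
  have notZ: "V \<noteq> ?Z" if "V \<subseteq> {..<j} \<or> V \<subseteq> {j<..}" for V using that jin by auto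
  show left: "cut_left j \<pi> \<in> ncp {..j - 1}"
  proof (rule ncpI)
    show "\<Union>(cut_left j \<pi>) = {..j - 1}"
    proof (intro equalityI subsetI)
      fix x assume "x \<in> \<Union>(cut_left j \<pi>)"
      then consider "x \<in> ?Z" "x \<noteq> j" | "x < j" by (auto simp: cut_left_def)
      then show "x \<in> {..j - 1}" using Zle[of x] \<open>0 < j\<close> by cases auto
    next
      fix x assume x: "x \<in> {..j - 1}"
      then have "x < j" using \<open>0 < j\<close> by auto
      moreover then have "x \<in> \<Union>\<pi>" using \<pi> \<open>j \<le> l\<close> by (auto simp: ncp_def partition_on_def)
      ultimately show "x \<in> \<Union>(cut_left j \<pi>)"
        using cases by (fastforce simp: cut_left_def)
    qed
    show "{} \<notin> cut_left j \<pi>"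
      using zb(2) \<open>0 < j\<close> ncp_nonempty[OF \<pi>] by (auto simp: cut_left_def)
    show "U = V" if "U \<in> cut_left j \<pi>" "V \<in> cut_left j \<pi>" "x \<in> U" "x \<in> V" for U V x
      using that zb(1) ncp_unique[OF \<pi>] notZ unfolding cut_left_def by blast
    show "U = V" if "U \<in> cut_left j \<pi>" "V \<in> cut_left j \<pi>" "a \<in> U" "b \<in> V" "c \<in> U" "d \<in> V"
      "a < b" "b < c" "c < d" for U V a b c d
      using that zb(1) ncp_crossing[OF \<pi> _ _ _ _ _ _ that(7-9)] notZ unfolding cut_left_def
      by blast
  qed
  show right: "cut_right j \<pi> \<in> ncp {j<..l}"
  proof (rule ncpI)
    show "\<Union>(cut_right j \<pi>) = {j<..l}"
    proof (intro equalityI subsetI)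
      fix x assume "x \<in> \<Union>(cut_right j \<pi>)"
      then show "x \<in> {j<..l}" using ncp_subset[OF \<pi>] by (auto simp: cut_right_def)
    next
      fix x assume x: "x \<in> {j<..l}"
      then have "x \<in> \<Union>\<pi>" using \<pi> by (auto simp: ncp_def partition_on_def)
      then obtain V where V: "V \<in> \<pi>" "x \<in> V" by blast
      then have "V \<subseteq> {j<..}" using cases[of V] Zle x by fastforce
      then show "x \<in> \<Union>(cut_right j \<pi>)" using V by (auto simp: cut_right_def)
    qed
    show "{} \<notin> cut_right j \<pi>" using ncp_nonempty[OF \<pi>] by (auto simp: cut_right_def)
    show "U = V" if "U \<in> cut_right j \<pi>" "V \<in> cut_right j \<pi>" "x \<in> U" "x \<in> V" for U V x
      using that ncp_unique[OF \<pi>] unfolding cut_right_def by blast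
    show "U = V" if "U \<in> cut_right j \<pi>" "V \<in> cut_right j \<pi>" "a \<in> U" "b \<in> V" "c \<in> U" "d \<in> V"
      "a < b" "b < c" "c < d" for U V a b c d
      using that ncp_crossing[OF \<pi>] unfolding cut_right_def by blast
  qed
  show star_value: "zero_block (cut_left j \<pi>) = ?Z - {j}"
    by (rule zero_block_eq[OF ncp_partition[OF left]]) (use zb(2) \<open>0 < j\<close> in \<open>auto simp: cut_left_def\<close>)
  have "cut_left j \<pi> - {?Z - {j}} = {V \<in> \<pi>. V \<subseteq> {..<j}}"
  proof -
    \<comment> \<open>The shortened block still contains \<open>0\<close>, so it cannot coincide
      with an old block; otherwise gluing would remove that one as well.\<close>
    have "?Z - {j} \<notin> \<pi>"
    proof
      assume "?Z - {j} \<in> \<pi>"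
      then have "?Z - {j} = ?Z" using ncp_unique[OF \<pi> _ zb(1), of "?Z - {j}" 0] zb(2) \<open>0 < j\<close> by auto
      then show False using jin by auto
    qed
    then show ?thesis by (auto simp: cut_left_def)
  qed
  moreover have "insert j (?Z - {j}) = ?Z" using jin by auto
  ultimately have "glue j (cut_left j \<pi>, cut_right j \<pi>) =
      insert ?Z {V \<in> \<pi>. V \<subseteq> {..<j}} \<union> {V \<in> \<pi>. V \<subseteq> {j<..}}"
    by (simp add: glue_def star_value cut_right_def)
  also have "\<dots> = \<pi>" using cases zb(1) by auto
  finally show "glue j (cut_left j \<pi>, cut_right j \<pi>) = \<pi>" .
qed

text \<open>\<open>\<sigma>\<close> lies below \<open>j\<close> and \<open>\<tau>\<close> above it,
  so only the enlarged block of \<open>0\<close> is new. A crossing that uses \<open>j\<close> would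
  give a crossing inside \<open>\<sigma>\<close> in which \<open>0\<close> takes over the part of
  \<open>j\<close>.\<close>

lemma glue_properties:
  assumes \<sigma>: "\<sigma> \<in> ncp {..j - 1}" and \<tau>: "\<tau> \<in> ncp {j<..l}" and j: "0 < j" "j \<le> l"
  shows "glue j (\<sigma>, \<tau>) \<in> ncp {..l}"
    and "zero_block (glue j (\<sigma>, \<tau>)) = insert j (zero_block \<sigma>)"
    and "Max (zero_block (glue j (\<sigma>, \<tau>))) = j"
    and "cut_left j (glue j (\<sigma>, \<tau>)) = \<sigma>" "cut_right j (glue j (\<sigma>, \<tau>)) = \<tau>"
    and "open_weight k n (glue j (\<sigma>, \<tau>)) = open_weight k (Suc n) \<sigma> * (\<Prod>V\<in>\<tau>. k (card V))"
proof -
  let ?Z = "zero_block \<sigma>" and ?G = "glue j (\<sigma>, \<tau>)"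
  note zb = zero_block_in[OF ncp_partition[OF \<sigma>]]
  have s\<sigma>: "V \<subseteq> {..<j}" if "V \<in> \<sigma>" for V using ncp_subset[OF \<sigma> that] j by auto
  have s\<tau>: "V \<subseteq> {j<..}" if "V \<in> \<tau>" for V using ncp_subset[OF \<tau> that] by auto
  have Z: "?Z \<in> \<sigma>" "0 \<in> ?Z" "?Z \<subseteq> {..<j}" using zb s\<sigma> by auto
  have lt: "V \<in> \<sigma> \<Longrightarrow> x \<in> V \<Longrightarrow> x < j" for V x using s\<sigma> by auto
  have gt: "V \<in> \<tau> \<Longrightarrow> x \<in> V \<Longrightarrow> j < x" for V x using s\<tau> by auto
  have G: "V \<in> ?G \<longleftrightarrow> V = insert j ?Z \<or> (V \<in> \<sigma> \<and> V \<noteq> ?Z) \<or> V \<in> \<tau>" for V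
    by (auto simp: glue_def)
  \<comment> \<open>\<open>h\<close> takes \<open>j\<close> out of the enlarged block again. On the
    blocks outside \<open>\<tau>\<close> it is injective with values in \<open>\<sigma>\<close>, so
    disjointness and non-crossing can be inherited from there.\<close>
  define h where "h W = (if W = insert j ?Z then ?Z else W)" for W
  have above: "W \<in> \<tau>" if "W \<in> ?G" "x \<in> W" "j < x" for W x
    using that lt Z(1) unfolding G by fastforce
  have below: "x \<le> j" if "W \<in> ?G" "W \<notin> \<tau>" "x \<in> W" for W x
    using that lt Z(1) unfolding G by fastforce
  have at: "W = insert j ?Z" if "W \<in> ?G" "j \<in> W" for W
    using that lt gt unfolding G by fastforce
  have h_old: "h W = W" if "W \<in> \<sigma>" for W
  proof -
    have "j \<notin> W" using lt[OF that, of j] by blast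
    then have "W \<noteq> insert j ?Z" by blast
    then show ?thesis by (simp add: h_def)
  qed
  have h: "h W \<in> \<sigma> \<and> x \<in> h W" if W: "W \<in> ?G" "x \<in> W" "x < j" for W x
  proof -
    consider "W = insert j ?Z" | "W \<in> \<sigma>" | "W \<in> \<tau>" using W(1)[unfolded G] by blast
    then show ?thesis
    proof cases
      case 1
      then show ?thesis using W Z(1) by (simp add: h_def)
    next
      case 2
      then show ?thesis using W h_old by simp
    next
      case 3
      then show ?thesis using gt[OF 3 W(2)] W(3) by simp
    qed
  qed
  have h_inj: "U = V" if "U \<in> ?G" "V \<in> ?G" "U \<notin> \<tau>" "V \<notin> \<tau>" "h U = h V" for U V
  proof -
    have hZ: "h (insert j ?Z) = ?Z" by (simp add: h_def)
    have *: "W = insert j ?Z \<and> h W = ?Z \<or> W \<in> \<sigma> \<and> W \<noteq> ?Z \<and> h W = W"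
      if "W \<in> ?G" "W \<notin> \<tau>" for W
    proof -
      have "W = insert j ?Z \<or> W \<in> \<sigma> \<and> W \<noteq> ?Z" using that(1)[unfolded G] that(2) by simp
      then show ?thesis
      proof
        assume "W = insert j ?Z"
        then show ?thesis using hZ by simp
      next
        assume "W \<in> \<sigma> \<and> W \<noteq> ?Z"
        then show ?thesis using h_old by simp
      qed
    qed
    show ?thesis using *[OF that(1,3)] *[OF that(2,4)] that(5) by metis
  qed
  show ncp: "?G \<in> ncp {..l}"
  proof (rule ncpI)
    have "\<Union>?G = insert j (\<Union>\<sigma>) \<union> \<Union>\<tau>" using Z(1) by (auto simp: glue_def)
    also have "\<dots> = {..l}" using \<sigma> \<tau> j by (auto simp: ncp_def partition_on_def)
    finally show "\<Union>?G = {..l}" .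
    show "{} \<notin> ?G" using ncp_nonempty[OF \<sigma>] ncp_nonempty[OF \<tau>] G by blast
    show "U = V" if "U \<in> ?G" "V \<in> ?G" "x \<in> U" "x \<in> V" for U V x
    proof -
      consider "x < j" | "x = j" | "j < x" by linarith
      then show ?thesis
      proof cases
        case 1
        then have "U \<notin> \<tau>" "V \<notin> \<tau>" using gt[of U x] gt[of V x] that by auto
        moreover have "h U = h V"
          using h[OF that(1,3) 1] h[OF that(2,4) 1] ncp_unique[OF \<sigma>, of "h U" "h V" x] by simp
        ultimately show ?thesis using h_inj that by blast
      next
        case 2
        then show ?thesis using at that by blast
      next
        case 3
        then show ?thesis
          using above[OF that(1,3)] above[OF that(2,4)] ncp_unique[OF \<tau> _ _ that(3,4)] by simp
      qed
    qed
    show "U = V" if uv: "U \<in> ?G" "V \<in> ?G" and el: "a \<in> U" "b \<in> V" "c \<in> U" "d \<in> V"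
      and ord: "a < b" "b < c" "c < d" for U V a b c d
    proof -
      consider "U \<in> \<tau>" | "V \<in> \<tau>" | "U \<notin> \<tau>" "V \<notin> \<tau>" by blast
      then show ?thesis
      proof cases
        case 1
        then have "V \<in> \<tau>" using gt[OF 1 el(1)] ord(1) above[OF uv(2) el(2)] by linarith
        then show ?thesis using ncp_crossing[OF \<tau> 1 _ el ord] by simp
      next
        case 2
        then have "U \<in> \<tau>" using gt[OF 2 el(2)] ord(2) above[OF uv(1) el(3)] by linarith
        then show ?thesis using ncp_crossing[OF \<tau> _ 2 el ord] by simp
      next
        case 3
        have dj: "d \<le> j" by (rule below[OF uv(2) 3(2) el(4)])
        show ?thesis
        proof (cases "d = j")
          case False
          then have "h U \<in> \<sigma>" "h V \<in> \<sigma>" "a \<in> h U" "b \<in> h V" "c \<in> h U" "d \<in> h V"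
            using h[OF uv(1) el(1)] h[OF uv(2) el(2)] h[OF uv(1) el(3)] h[OF uv(2) el(4)] ord dj False
            by auto
          then have "h U = h V" by (rule ncp_crossing[OF \<sigma> _ _ _ _ _ _ ord])
          then show ?thesis using h_inj uv 3 by blast
        next
          \<comment> \<open>Now \<open>V\<close> is the enlarged block. If \<open>U\<close> differed
            from it, then 0 < a < b < c with \<open>0\<close> and \<open>b\<close> in the old block
            of \<open>0\<close> would be a crossing of \<open>\<sigma>\<close>.\<close>
          case True
          then have V: "V = insert j ?Z" using at el(4) uv(2) by blast
          then have bZ: "b \<in> ?Z" using el(2) ord True by auto
          show ?thesis
          proof (rule ccontr)
            assume "U \<noteq> V"
            then have U: "U \<in> \<sigma>" "U \<noteq> ?Z" using uv(1) 3(1) V G by auto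
            have "0 \<notin> U" using ncp_unique[OF \<sigma> U(1) Z(1) _ Z(2)] U(2) by auto
            then have "0 < a" using el(1) by (metis gr0I)
            then show False using ncp_crossing[OF \<sigma> Z(1) U(1) Z(2) el(1) bZ el(3)] ord U(2) by auto
          qed
        qed
      qed
    qed
  qed
  show zg: "zero_block ?G = insert j ?Z"
    by (rule zero_block_eq[OF ncp_partition[OF ncp]]) (use Z(2) G in auto)
  have finZ: "finite ?Z" using Z(3) finite_subset by auto
  show "Max (zero_block ?G) = j"
    unfolding zg by (rule Max_eqI) (use finZ Z(3) in auto)
  have ZZ: "insert j ?Z - {j} = ?Z" using Z(3) by auto
  have new: "V = insert j ?Z \<longrightarrow> \<not> V \<subseteq> {..<j} \<and> \<not> V \<subseteq> {j<..}" for V by auto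
  have old: "V \<in> \<sigma> \<longrightarrow> V \<subseteq> {..<j} \<and> \<not> V \<subseteq> {j<..}" for V
  proof
    assume V: "V \<in> \<sigma>"
    then obtain x where "x \<in> V" using ncp_nonempty[OF \<sigma> V] by auto
    then show "V \<subseteq> {..<j} \<and> \<not> V \<subseteq> {j<..}" using s\<sigma>[OF V] lt[OF V, of x] by auto
  qed
  have right: "V \<in> \<tau> \<longrightarrow> V \<subseteq> {j<..} \<and> \<not> V \<subseteq> {..<j}" for V
  proof
    assume V: "V \<in> \<tau>"
    then obtain x where "x \<in> V" using ncp_nonempty[OF \<tau> V] by auto
    then show "V \<subseteq> {j<..} \<and> \<not> V \<subseteq> {..<j}" using s\<tau>[OF V] gt[OF V, of x] by auto
  qed
  have "{V \<in> ?G. V \<subseteq> {..<j}} = \<sigma> - {?Z}"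
  proof (rule Set.set_eqI)
    show "V \<in> {V \<in> ?G. V \<subseteq> {..<j}} \<longleftrightarrow> V \<in> \<sigma> - {?Z}" for V
      using G[of V] new[of V] old[of V] right[of V]
      unfolding mem_Collect_eq Diff_iff singleton_iff by argo
  qed
  then show "cut_left j ?G = \<sigma>"
    unfolding cut_left_def zg ZZ using Z(1) by auto
  show "cut_right j ?G = \<tau>"
    unfolding cut_right_def
  proof (rule Set.set_eqI)
    show "V \<in> {V \<in> ?G. V \<subseteq> {j<..}} \<longleftrightarrow> V \<in> \<tau>" for V
      using G[of V] new[of V] old[of V] right[of V] unfolding mem_Collect_eq by argo
  qed
  have "?G - {insert j ?Z} = (\<sigma> - {?Z}) \<union> \<tau>"
  proof (rule Set.set_eqI)
    show "V \<in> ?G - {insert j ?Z} \<longleftrightarrow> V \<in> (\<sigma> - {?Z}) \<union> \<tau>" for V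
      using G[of V] new[of V] old[of V] right[of V] unfolding Un_iff Diff_iff singleton_iff by argo
  qed
  moreover have "(\<sigma> - {?Z}) \<inter> \<tau> = {}" using old right by blast
  ultimately have "(\<Prod>V\<in>?G - {insert j ?Z}. k (card V)) =
      (\<Prod>V\<in>\<sigma> - {?Z}. k (card V)) * (\<Prod>V\<in>\<tau>. k (card V))"
    using ncp_finite[OF \<sigma>] ncp_finite[OF \<tau>] by (simp add: prod.union_disjoint)
  moreover have "card (insert j ?Z) = Suc (card ?Z)"
    using card_insert_disjoint[OF finZ, of j] Z(3) by blast
  ultimately show "open_weight k n ?G = open_weight k (Suc n) \<sigma> * (\<Prod>V\<in>\<tau>. k (card V))"
    by (simp add: open_weight_def zg)
qed

lemma nc_sum_interval: "nc_sum k {j<..l} = nc_sum k {1..l - j}"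
proof -
  have "(+) j ` {1..l - j} = {j<..l}"
    by (cases "j \<le> l") (auto simp: image_add_atLeastAtMost)
  then show ?thesis using nc_sum_shift[of k j "{1..l - j}"] by simp
qed

lemma nc_sum_empty: "nc_sum k {} = 1"
proof -
  have "ncp {} = {{}}" by (auto simp: ncp_def partition_on_def)
  then show ?thesis by (simp add: nc_sum_def)
qed

lemma nc_sum_Suc: "nc_sum k {1..Suc l} = nc_open_sum k 0 l"
proof -
  have "(+) 1 ` {..l} = {1..Suc l}"
    by (auto simp: image_iff) (metis Suc_le_D Suc_le_mono atMost_iff)
  then have "nc_sum k {1..Suc l} = nc_sum k {..l}"
    using nc_sum_shift[of k 1 "{..l}"] by simp
  also have "\<dots> = nc_open_sum k 0 l"
    unfolding nc_sum_def nc_open_sum_def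
  proof (rule sum.cong)
    fix \<pi> assume \<pi>: "\<pi> \<in> ncp {..l}"
    show "(\<Prod>V\<in>\<pi>. k (card V)) = open_weight k 0 \<pi>"
      unfolding open_weight_def
      using prod.remove[OF ncp_finite[OF \<pi>] zero_block_in(1)[OF ncp_partition[OF \<pi>]]] by simp
  qed simp
  finally show ?thesis .
qed

text \<open>The partitions are sorted by the largest element of the block of \<open>0\<close>. If it
  is \<open>0\<close>, the block is a singleton and can be deleted; if it is \<open>Suc j\<close>,
  cutting there is a bijection onto pairs. This is the recursion of \<open>open_block\<close> on a
  run of equal letters.\<close>

lemma nc_open_sum_rec:
  "nc_open_sum k n l = k (Suc n) * nc_sum k {1..l} +
    (\<Sum>j<l. nc_open_sum k (Suc n) j * nc_sum k {1..l - Suc j})"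
proof -
  define P where "P j = {\<pi> \<in> ncp {..l}. Max (zero_block \<pi>) = j}" for j
  have fin: "finite (ncp {..l})" by (simp add: finite_ncp)
  have block_seq: "finite (zero_block \<pi>)" "0 \<in> zero_block \<pi>" "zero_block \<pi> \<in> \<pi>" "zero_block \<pi> \<subseteq> {..l}"
    if "\<pi> \<in> ncp {..l}" for \<pi>
    using zero_block_in[OF ncp_partition[OF that]] ncp_subset[OF that]
    by (auto intro: finite_subset[of _ "{..l}"])
  have mx: "Max (zero_block \<pi>) \<in> {..l}" if "\<pi> \<in> ncp {..l}" for \<pi>
    using block_seq[OF that] Max_in[of "zero_block \<pi>"] by blast
  have "nc_open_sum k n l = (\<Sum>j\<le>l. \<Sum>\<pi>\<in>P j. open_weight k n \<pi>)"
    unfolding nc_open_sum_def P_def by (rule sum.group[symmetric]) (use fin mx in auto)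
  also have "\<dots> = (\<Sum>\<pi>\<in>P 0. open_weight k n \<pi>) + (\<Sum>j<l. \<Sum>\<pi>\<in>P (Suc j). open_weight k n \<pi>)"
    by (simp add: lessThan_Suc_atMost[symmetric] sum.lessThan_Suc_shift del: sum.lessThan_Suc)
  also have "(\<Sum>\<pi>\<in>P 0. open_weight k n \<pi>) = k (Suc n) * nc_sum k {1..l}"
  proof -
    have zb0: "zero_block \<pi> = {0}" if "\<pi> \<in> P 0" for \<pi>
    proof -
      have "\<pi> \<in> ncp {..l}" "Max (zero_block \<pi>) = 0" using that by (auto simp: P_def)
      then show ?thesis using block_seq(1,2)[of \<pi>] Max_ge[of "zero_block \<pi>"] by fastforce
    qed
    have ins: "insert {0} \<tau> \<in> P 0" "{0} \<notin> \<tau>" if \<tau>: "\<tau> \<in> ncp {1..l}" for \<tau>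
    proof -
      have s: "V \<subseteq> {1..l}" if "V \<in> \<tau>" for V using ncp_subset[OF \<tau> that] .
      show n: "{0} \<notin> \<tau>" using s by fastforce
      have "insert {0} \<tau> \<in> ncp {..l}"
      proof (rule ncpI)
        have "\<Union>(insert {0} \<tau>) = insert 0 {1..l}"
          using ncp_Union[OF \<tau>] by simp
        also have "insert 0 {1..l} = {..l}" by auto
        finally show "\<Union>(insert {0} \<tau>) = {..l}" .
        show "{} \<notin> insert {0} \<tau>" using ncp_nonempty[OF \<tau>] by auto
        show "U = V" if "U \<in> insert {0} \<tau>" "V \<in> insert {0} \<tau>" "x \<in> U" "x \<in> V" for U V x
          using that s ncp_unique[OF \<tau>, of U V x] by fastforce
        show "U = V" if "U \<in> insert {0} \<tau>" "V \<in> insert {0} \<tau>" "a \<in> U" "b \<in> V" "c \<in> U" "d \<in> V"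
          "a < b" "b < c" "c < d" for U V a b c d
          using that ncp_crossing[OF \<tau> _ _ that(3-9)] by auto
      qed
      moreover from this have "zero_block (insert {0} \<tau>) = {0}"
        by (intro zero_block_eq[OF ncp_partition]) auto
      ultimately show "insert {0} \<tau> \<in> P 0" by (simp add: P_def)
    qed
    have del: "\<pi> - {{0}} \<in> ncp {1..l}" "insert {0} (\<pi> - {{0}}) = \<pi>" if \<pi>0: "\<pi> \<in> P 0" for \<pi>
    proof -
      have \<pi>: "\<pi> \<in> ncp {..l}" using \<pi>0 by (simp add: P_def)
      have z: "{0} \<in> \<pi>" using block_seq(3)[OF \<pi>] zb0[OF \<pi>0] by simp
      then show "insert {0} (\<pi> - {{0}}) = \<pi>" by auto
      show "\<pi> - {{0}} \<in> ncp {1..l}"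
      proof (rule ncpI)
        show "\<Union>(\<pi> - {{0}}) = {1..l}"
        proof (intro equalityI subsetI)
          fix x assume "x \<in> \<Union>(\<pi> - {{0}})"
          then obtain V where V: "V \<in> \<pi>" "V \<noteq> {0}" "x \<in> V" by auto
          then have "x \<noteq> 0" using ncp_unique[OF \<pi> V(1) z, of 0] by auto
          then show "x \<in> {1..l}" using ncp_subset[OF \<pi> V(1)] V(3) by auto
        next
          fix x assume "x \<in> {1..l}"
          then have "x \<in> \<Union>\<pi>" "x \<noteq> 0" using ncp_Union[OF \<pi>] by auto
          then show "x \<in> \<Union>(\<pi> - {{0}})" by blast
        qed
        show "{} \<notin> \<pi> - {{0}}" using ncp_nonempty[OF \<pi>] by auto
        show "U = V" if "U \<in> \<pi> - {{0}}" "V \<in> \<pi> - {{0}}" "x \<in> U" "x \<in> V" for U V x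
          using that ncp_unique[OF \<pi>, of U V x] by auto
        show "U = V" if "U \<in> \<pi> - {{0}}" "V \<in> \<pi> - {{0}}" "a \<in> U" "b \<in> V" "c \<in> U" "d \<in> V"
          "a < b" "b < c" "c < d" for U V a b c d
          using that ncp_crossing[OF \<pi> _ _ that(3-9)] by auto
      qed
    qed
    have "(\<Sum>\<pi>\<in>P 0. open_weight k n \<pi>) = (\<Sum>\<tau>\<in>ncp {1..l}. k (Suc n) * (\<Prod>V\<in>\<tau>. k (card V)))"
    proof (rule sum.reindex_bij_witness[of _ "insert {0}" "\<lambda>\<pi>. \<pi> - {{0}}"])
      fix \<pi> assume \<pi>: "\<pi> \<in> P 0"
      show "insert {0} (\<pi> - {{0}}) = \<pi>" "\<pi> - {{0}} \<in> ncp {1..l}" using del[OF \<pi>] by auto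
      show "k (Suc n) * (\<Prod>V\<in>\<pi> - {{0}}. k (card V)) = open_weight k n \<pi>"
        by (simp add: open_weight_def zb0[OF \<pi>])
    next
      fix \<tau> assume \<tau>: "\<tau> \<in> ncp {1..l}"
      show "insert {0} \<tau> - {{0}} = \<tau>" "insert {0} \<tau> \<in> P 0" using ins[OF \<tau>] by auto
    qed
    then show ?thesis by (simp add: nc_sum_def sum_distrib_left)
  qed
  also have "(\<Sum>j<l. \<Sum>\<pi>\<in>P (Suc j). open_weight k n \<pi>) =
      (\<Sum>j<l. nc_open_sum k (Suc n) j * nc_sum k {1..l - Suc j})"
  proof (rule sum.cong)
    fix j assume "j \<in> {..<l}"
    then have j: "0 < Suc j" "Suc j \<le> l" by auto
    have "(\<Sum>\<pi>\<in>P (Suc j). open_weight k n \<pi>) =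
        (\<Sum>(\<sigma>, \<tau>)\<in>ncp {..j} \<times> ncp {Suc j<..l}. open_weight k (Suc n) \<sigma> * (\<Prod>V\<in>\<tau>. k (card V)))"
    proof (rule sum.reindex_bij_witness[of _ "glue (Suc j)" "\<lambda>\<pi>. (cut_left (Suc j) \<pi>, cut_right (Suc j) \<pi>)"])
      fix \<pi> assume "\<pi> \<in> P (Suc j)"
      then have \<pi>: "\<pi> \<in> ncp {..l}" "Suc j = Max (zero_block \<pi>)" by (auto simp: P_def)
      note c = cut_properties[OF \<pi> j(1)]
      show "glue (Suc j) (cut_left (Suc j) \<pi>, cut_right (Suc j) \<pi>) = \<pi>" by (rule c(4))
      show "(cut_left (Suc j) \<pi>, cut_right (Suc j) \<pi>) \<in> ncp {..j} \<times> ncp {Suc j<..l}"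
        using c(1,2) by simp
      show "(case (cut_left (Suc j) \<pi>, cut_right (Suc j) \<pi>) of
          (\<sigma>, \<tau>) \<Rightarrow> open_weight k (Suc n) \<sigma> * (\<Prod>V\<in>\<tau>. k (card V))) = open_weight k n \<pi>"
        using glue_properties(6)[OF c(1,2) j, of k n] c(4) by simp
    next
      fix st assume "st \<in> ncp {..j} \<times> ncp {Suc j<..l}"
      then obtain \<sigma> \<tau> where st: "st = (\<sigma>, \<tau>)" "\<sigma> \<in> ncp {..Suc j - 1}" "\<tau> \<in> ncp {Suc j<..l}" by auto
      note g = glue_properties[OF st(2,3) j]
      show "(cut_left (Suc j) (glue (Suc j) st), cut_right (Suc j) (glue (Suc j) st)) = st"
        using g(4,5) st(1) by simp
      show "glue (Suc j) st \<in> P (Suc j)" using g(1,3) st(1) by (simp add: P_def)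
    qed
    also have "\<dots> = nc_open_sum k (Suc n) j * nc_sum k {Suc j<..l}"
      by (simp add: nc_open_sum_def nc_sum_def sum_product sum.cartesian_product)
    finally show "(\<Sum>\<pi>\<in>P (Suc j). open_weight k n \<pi>) =
        nc_open_sum k (Suc n) j * nc_sum k {1..l - Suc j}"
      unfolding nc_sum_interval .
  qed simp
  finally show ?thesis .
qed

lemma open_block_replicate:
  "open_block \<kappa> a n (replicate l a) = \<kappa> a n * free_moment \<kappa> (replicate l a) +
    (\<Sum>k<l. open_block \<kappa> a (Suc n) (replicate k a) * free_moment \<kappa> (replicate (l - Suc k) a))"
  unfolding open_block_split[of \<kappa> a n]
  using split_sum_replicate[of a "\<lambda>u v. open_block \<kappa> a (Suc n) u * free_moment \<kappa> v" l a "[]"] by simp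

text \<open>Both sides satisfy the same recursion. The shift from \<open>n\<close> to
  \<open>Suc n\<close> accounts for the point \<open>0\<close>, which stands for the letter that
  opened the block.\<close>

lemma free_moment_replicate:
  "free_moment \<kappa> (replicate l a) = nc_sum (\<kappa> a) {1..l} \<and>
   open_block \<kappa> a (Suc n) (replicate l a) = nc_open_sum (\<kappa> a) n l"
proof (induction l arbitrary: n rule: less_induct)
  case (less l)
  have N: "free_moment \<kappa> (replicate l a) = nc_sum (\<kappa> a) {1..l}"
  proof (cases l)
    case 0
    then show ?thesis by (simp add: nc_sum_empty)
  next
    case (Suc l')
    then show ?thesis using less[of l' 0] nc_sum_Suc[of "\<kappa> a" l'] by simp
  qed
  have "open_block \<kappa> a (Suc n) (replicate l a) = nc_open_sum (\<kappa> a) n l"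
    unfolding open_block_replicate[of \<kappa> a "Suc n"] nc_open_sum_rec[of "\<kappa> a" n] N
    using less by auto
  then show ?case using N by blast
qed

text \<open>The moment-cumulant formula determines the cumulants one after the other: the moments
  satisfy it with \<open>\<kappa>\<close>, and all proper blocks have smaller size.\<close>

theorem free_cumulant_free_moment:
  assumes "1 \<le> n"
  shows "free_cumulant (\<lambda>n. free_moment \<kappa> (replicate n a)) n = \<kappa> a n"
  using assms
proof (induction n rule: less_induct)
  case (less n)
  let ?m = "\<lambda>n. free_moment \<kappa> (replicate n a)"
  have top: "{{1..n}} \<in> noncrossing_partitions n"
    using less.prems by (auto simp: noncrossing_partitions_def partition_on_def disjoint_def)
  have "(\<Sum>\<pi>\<in>noncrossing_partitions n - {{{1..n}}}. \<Prod>V\<in>\<pi>. free_cumulant ?m (card V)) =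
      (\<Sum>\<pi>\<in>noncrossing_partitions n - {{{1..n}}}. \<Prod>V\<in>\<pi>. \<kappa> a (card V))"
  proof (intro sum.cong prod.cong refl less.IH)
    fix \<pi> V assume \<pi>: "\<pi> \<in> noncrossing_partitions n - {{{1..n}}}" and V: "V \<in> \<pi>"
    show "card V < n" by (rule card_block_less[OF \<pi> V])
    have "V \<noteq> {}" "V \<subseteq> {1..n}" using \<pi> V by (auto simp: noncrossing_partitions_def partition_on_def)
    then show "1 \<le> card V" by (simp add: Suc_le_eq card_gt_0_iff finite_subset[of V "{1..n}"])
  qed
  moreover have "?m n = (\<Sum>\<pi>\<in>noncrossing_partitions n. \<Prod>V\<in>\<pi>. \<kappa> a (card V))"
    using free_moment_replicate[of \<kappa> n a 0] by (simp add: nc_sum_def noncrossing_partitions_eq_ncp)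
  ultimately show ?case
    using sum.remove[OF finite_noncrossing_partitions top, of "\<lambda>\<pi>. \<Prod>V\<in>\<pi>. \<kappa> a (card V)"]
    by (subst free_cumulant.simps) simp
qed

subsection \<open>Moments of words in the blocks\<close>

text \<open>The limit of the normalized trace of \<open>W(i1, j1) W(i2, j2) \<dots>\<close>; here \<open>c\<close> is the limit of
  \<open>p / d\<close>.\<close>

function limit_trace :: "complex \<Rightarrow> (nat \<times> nat) list \<Rightarrow> complex" where
  "limit_trace c [] = 1"
| "limit_trace c (x # u) = (if fst x = snd x then c * limit_trace c u else 0) +
    (\<Sum>s<length u. if snd (u ! s) = fst x
       then limit_trace c ((fst (u ! s), snd x) # take s u) * limit_trace c (drop (Suc s) u) else 0)"
  by pat_completeness auto
termination
  \<comment> \<open>Replacing \<open>take s u\<close> by a list with one more entry is safe because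
    \<open>s < length u\<close>.\<close>
  by (relation "Wellfounded.measure (length \<circ> snd)") auto

declare limit_trace.simps(2) [simp del]

definition flip :: "bool \<Rightarrow> nat \<Rightarrow> nat" where
  "flip b i = (if b then 3 - i else i)"

text \<open>In the word \<open>X\<close> given by \<open>w\<close> (\<open>False\<close> for \<open>X1\<close>, \<open>True\<close> for \<open>X2\<close>), the product of blocks
  met on the path starting in row \<open>i\<close>.\<close>

fun block_path :: "nat \<Rightarrow> bool list \<Rightarrow> (nat \<times> nat) list" where
  "block_path i [] = []"
| "block_path i (b # w) = (flip b i, i) # block_path (flip b i) w"

fun path_end :: "nat \<Rightarrow> bool list \<Rightarrow> nat" where
  "path_end i [] = i"
| "path_end i (b # w) = path_end (flip b i) w"

lemma length_block_path [simp]: "length (block_path i w) = length w"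
  by (induction i w rule: block_path.induct) auto

lemma block_path_nth:
  "s < length w \<Longrightarrow> block_path i w ! s = (flip (w ! s) (path_end i (take s w)), path_end i (take s w))"
  by (induction i w arbitrary: s rule: block_path.induct) (auto simp: nth_Cons split: nat.splits)

lemma take_block_path: "take s (block_path i w) = block_path i (take s w)"
  by (induction i w arbitrary: s rule: block_path.induct) (auto simp: take_Cons split: nat.splits)

lemma drop_block_path:
  "s < length w \<Longrightarrow> drop (Suc s) (block_path i w) =
    block_path (flip (w ! s) (path_end i (take s w))) (drop (Suc s) w)"
proof (induction i w arbitrary: s rule: block_path.induct)
  case (2 i b w)
  then show ?case by (cases s) auto
qed simp

lemma path_end_parity:
  "i \<in> {1, 2} \<Longrightarrow> path_end i w = (if even (count_list w True) then i else 3 - i)"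
  by (induction i w rule: path_end.induct) (auto simp: flip_def)

text \<open>\<open>c\<close> stands for lim p / d here, which is twice the constant of the final
  statement.\<close>

definition block_cumulant :: "complex \<Rightarrow> bool \<Rightarrow> nat \<Rightarrow> complex" where
  "block_cumulant c b n = (if b \<and> odd n then 0 else c)"

lemma count_list_split:
  "s < length w \<Longrightarrow> count_list w x = count_list (take s w) x + (if w ! s = x then 1 else 0) +
    count_list (drop (Suc s) w) x"
  by (subst id_take_nth_drop[of s w], assumption) (simp del: append_take_drop_id)

text \<open>Every surviving pattern groups the letters \<open>True\<close> into blocks of even size,
  so an odd number of them leaves nothing. For an open block of \<open>True\<close> the
  \<open>n\<close> letters already collected are included in the count.\<close>

lemma block_moment_odd:
  fixes c defines "\<kappa> \<equiv> block_cumulant c"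
  shows "(odd (count_list w True) \<longrightarrow> free_moment \<kappa> w = 0) \<and>
    (odd (count_list w True) \<longrightarrow> open_block \<kappa> False n w = 0) \<and>
    (odd (n + count_list w True) \<longrightarrow> open_block \<kappa> True n w = 0)"
proof (induction "length w" arbitrary: w n rule: less_induct)
  case (less w)
  have N: "odd (count_list w True) \<longrightarrow> free_moment \<kappa> w = 0"
  proof (cases w)
    case (Cons b w')
    then show ?thesis using less[of w' 1] by (cases b) auto
  qed simp
  have drop0: "odd (count_list (drop (Suc s) w) True) \<Longrightarrow> free_moment \<kappa> (drop (Suc s) w) = 0"
    if "s < length w" for s
    using less[of "drop (Suc s) w" 0] that by simp
  have take0: "odd (count_list (take s w) True) \<Longrightarrow> open_block \<kappa> False (Suc n) (take s w) = 0"
    "odd (Suc n + count_list (take s w) True) \<Longrightarrow> open_block \<kappa> True (Suc n) (take s w) = 0"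
    if "s < length w" for s
    using less[of "take s w" "Suc n"] that by (simp_all del: even_Suc)
  have F: "open_block \<kappa> False n w = 0" if "odd (count_list w True)"
    unfolding open_block.simps[of \<kappa> False n]
  proof (subst sum.neutral, intro ballI)
    fix s assume "s \<in> {..<length w}"
    then have s: "s < length w" by simp
    show "(if w ! s = False then open_block \<kappa> False (Suc n) (take s w) * free_moment \<kappa> (drop (Suc s) w)
        else 0) = 0"
    proof (cases "w ! s")
      case False
      then have "odd (count_list (take s w) True) \<or> odd (count_list (drop (Suc s) w) True)"
        using count_list_split[OF s, of True] that by presburger
      then show ?thesis using take0(1)[OF s] drop0[OF s] by auto
    qed simp
  qed (use N that in simp)
  have T: "open_block \<kappa> True n w = 0" if "odd (n + count_list w True)"
    unfolding open_block.simps[of \<kappa> True n]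
  proof (subst sum.neutral, intro ballI)
    fix s assume "s \<in> {..<length w}"
    then have s: "s < length w" by simp
    show "(if w ! s = True then open_block \<kappa> True (Suc n) (take s w) * free_moment \<kappa> (drop (Suc s) w)
        else 0) = 0"
    proof (cases "w ! s")
      case True
      then have "odd (Suc n + count_list (take s w) True) \<or> odd (count_list (drop (Suc s) w) True)"
        using count_list_split[OF s, of True] that by presburger
      then show ?thesis using take0(2)[OF s] drop0[OF s] by auto
    qed simp
  next
    show "\<kappa> True n * free_moment \<kappa> w + 0 = 0"
      using N that by (cases "odd n") (auto simp: \<kappa>_def block_cumulant_def)
  qed
  show ?case using N F T by blast
qed

text \<open>The leading pair records the state of the open block: its first entry is the index the
  next contraction must find, its second one the index needed for closing. Equal entries
  \<open>i\<close> mean a block of \<open>X1\<close>; a block of \<open>X2\<close> alternates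
  between (i, 3 - i) and (3 - i, 3 - i) with the parity of its size, and only the even state may
  close. The last pair (3 - i, i) arises when letters of different kinds are contracted, and gives
  0.\<close>

lemma limit_trace_block_path_aux:
  fixes c defines "\<kappa> \<equiv> block_cumulant c"
  assumes "i \<in> {1, 2}"
  shows "limit_trace c (block_path i w) = free_moment \<kappa> w \<and>
    (\<forall>n. limit_trace c ((i, i) # block_path i w) = open_block \<kappa> False n w) \<and>
    (\<forall>n. even n \<longrightarrow> limit_trace c ((3 - i, 3 - i) # block_path i w) = open_block \<kappa> True n w) \<and>
    (\<forall>n. odd n \<longrightarrow> limit_trace c ((i, 3 - i) # block_path i w) = open_block \<kappa> True n w) \<and>
    limit_trace c ((3 - i, i) # block_path i w) = 0"
  using assms(2)
proof (induction "length w" arbitrary: w i rule: less_induct)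
  case (less w)
  have i: "3 - i \<in> {1, 2}" "3 - i \<noteq> i" "i \<noteq> 3 - i" "3 - (3 - i) = i" using less.prems by auto
  have N: "limit_trace c (block_path i w) = free_moment \<kappa> w"
  proof (cases w)
    case (Cons b w')
    have IH: "limit_trace c ((i, i) # block_path i w') = open_block \<kappa> False 1 w'"
      "limit_trace c ((3 - i, 3 - (3 - i)) # block_path (3 - i) w') = open_block \<kappa> True 1 w'"
      using less.hyps[of w' i] less.hyps[of w' "3 - i"] i(1) less.prems Cons by auto
    show ?thesis
      using IH i(4) Cons by (cases b) (simp_all add: flip_def)
  qed simp
  \<comment> \<open>\<open>j s\<close> is the row reached before letter \<open>s\<close>, hence the
    second index of the block there; a contraction with (x, y) requires
    \<open>j s = x\<close>.\<close>
  define j where "j s = path_end i (take s w)" for s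
  have j: "j s = (if even (count_list (take s w) True) then i else 3 - i)" for s
    unfolding j_def by (rule path_end_parity[OF less.prems])
  have rec: "limit_trace c ((x, y) # block_path i w) = (if x = y then c * free_moment \<kappa> w else 0) +
      (\<Sum>s<length w. if j s = x
         then limit_trace c ((flip (w ! s) (j s), y) # block_path i (take s w)) * free_moment \<kappa> (drop (Suc s) w)
         else 0)" for x y
  proof -
    have "limit_trace c (drop (Suc s) (block_path i w)) = free_moment \<kappa> (drop (Suc s) w)"
      if "s < length w" for s
    proof -
      have "flip (w ! s) (path_end i (take s w)) \<in> {1, 2}"
        using less.prems i(1) path_end_parity[OF less.prems, of "take s w"] by (auto simp: flip_def)
      then show ?thesis
        unfolding drop_block_path[OF that] using less.hyps[of "drop (Suc s) w"] that by auto
    qed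
    then show ?thesis
      by (subst limit_trace.simps(2))
         (auto simp: N block_path_nth take_block_path j_def intro!: sum.cong)
  qed
  note odd0 = block_moment_odd[of _ c, folded \<kappa>_def]
  have IH: "limit_trace c ((i, i) # block_path i (take s w)) = open_block \<kappa> False n (take s w)"
    "even n \<Longrightarrow> limit_trace c ((3 - i, 3 - i) # block_path i (take s w)) = open_block \<kappa> True n (take s w)"
    "odd n \<Longrightarrow> limit_trace c ((i, 3 - i) # block_path i (take s w)) = open_block \<kappa> True n (take s w)"
    "limit_trace c ((3 - i, i) # block_path i (take s w)) = 0" if "s < length w" for s n
    using less.hyps[of "take s w" i] that less.prems by auto
  have vanish: "odd (count_list u True) \<Longrightarrow> open_block \<kappa> False n u = 0"
    "odd (n + count_list u True) \<Longrightarrow> open_block \<kappa> True n u = 0" for u n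
    using odd0[of u n] by blast+
  \<comment> \<open>A letter \<open>True\<close> met in row \<open>i\<close> leads to the vanishing
    state. A letter \<open>False\<close> met in row \<open>3 - i\<close> is not contracted, and
    \<open>open_block\<close> agrees because the odd part before it contributes 0.\<close>
  have A: "limit_trace c ((i, i) # block_path i w) = open_block \<kappa> False n w" for n
    unfolding rec open_block.simps[of \<kappa> False n]
  proof (intro arg_cong2[where f = "(+)"] sum.cong refl)
    show "(if i = i then c * free_moment \<kappa> w else 0) = \<kappa> False n * free_moment \<kappa> w"
      by (simp add: \<kappa>_def block_cumulant_def)
    fix s assume "s \<in> {..<length w}"
    then have s: "s < length w" by simp
    show "(if j s = i then limit_trace c ((flip (w ! s) (j s), i) # block_path i (take s w)) *
          free_moment \<kappa> (drop (Suc s) w) else 0) =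
        (if w ! s = False then open_block \<kappa> False (Suc n) (take s w) * free_moment \<kappa> (drop (Suc s) w) else 0)"
      using IH(1)[OF s, of "Suc n"] IH(4)[OF s] vanish(1)[of "take s w" "Suc n"]
      by (cases "even (count_list (take s w) True)"; cases "w ! s") (simp_all add: j flip_def i(2,3))
  qed
  \<comment> \<open>Here the contraction requires an odd number of flips before it. A letter
    \<open>False\<close> found there would keep the state, but then the part to its left has the
    wrong parity; the same holds for \<open>C\<close> with an even number.\<close>
  have B: "limit_trace c ((3 - i, 3 - i) # block_path i w) = open_block \<kappa> True n w" if "even n" for n
    unfolding rec open_block.simps[of \<kappa> True n]
  proof (intro arg_cong2[where f = "(+)"] sum.cong refl)
    show "(if 3 - i = 3 - i then c * free_moment \<kappa> w else 0) = \<kappa> True n * free_moment \<kappa> w"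
      using that by (simp add: \<kappa>_def block_cumulant_def)
    fix s assume "s \<in> {..<length w}"
    then have s: "s < length w" by simp
    show "(if j s = 3 - i then limit_trace c ((flip (w ! s) (j s), 3 - i) # block_path i (take s w)) *
          free_moment \<kappa> (drop (Suc s) w) else 0) =
        (if w ! s = True then open_block \<kappa> True (Suc n) (take s w) * free_moment \<kappa> (drop (Suc s) w) else 0)"
      using IH(2)[OF s, of 0] IH(3)[OF s, of "Suc n"] vanish(2)[of 0 "take s w"]
        vanish(2)[of "Suc n" "take s w"] that
      by (cases "even (count_list (take s w) True)"; cases "w ! s") (simp_all add: j flip_def i(2-4))
  qed
  have C: "limit_trace c ((i, 3 - i) # block_path i w) = open_block \<kappa> True n w" if "odd n" for n
    unfolding rec open_block.simps[of \<kappa> True n]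
  proof (intro arg_cong2[where f = "(+)"] sum.cong refl)
    show "(if i = 3 - i then c * free_moment \<kappa> w else 0) = \<kappa> True n * free_moment \<kappa> w"
      using that i by (simp add: \<kappa>_def block_cumulant_def)
    fix s assume "s \<in> {..<length w}"
    then have s: "s < length w" by simp
    show "(if j s = i then limit_trace c ((flip (w ! s) (j s), 3 - i) # block_path i (take s w)) *
          free_moment \<kappa> (drop (Suc s) w) else 0) =
        (if w ! s = True then open_block \<kappa> True (Suc n) (take s w) * free_moment \<kappa> (drop (Suc s) w) else 0)"
      using IH(3)[OF s, of 1] IH(2)[OF s, of "Suc n"] vanish(2)[of 1 "take s w"]
        vanish(2)[of "Suc n" "take s w"] that
      by (cases "even (count_list (take s w) True)"; cases "w ! s") (simp_all add: j flip_def i(2-4))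
  qed
  \<comment> \<open>Closing is excluded as the entries differ. A contracted letter either keeps this
    state or turns it into that of an \<open>X1\<close>-block enclosing an odd number of
    flips.\<close>
  have D: "limit_trace c ((3 - i, i) # block_path i w) = 0"
    unfolding rec
  proof (subst sum.neutral, intro ballI)
    fix s assume "s \<in> {..<length w}"
    then have s: "s < length w" by simp
    show "(if j s = 3 - i then limit_trace c ((flip (w ! s) (j s), i) # block_path i (take s w)) *
          free_moment \<kappa> (drop (Suc s) w) else 0) = 0"
      using IH(1)[OF s, of 1] IH(4)[OF s] vanish(1)[of "take s w" 1]
      by (cases "even (count_list (take s w) True)"; cases "w ! s") (simp_all add: j flip_def i(2-4))
  qed (use i in simp)
  show ?case using N A B C D by blast
qed

theorem limit_trace_block_path:
  "i \<in> {1, 2} \<Longrightarrow> limit_trace c (block_path i w) = free_moment (block_cumulant c) w"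
  using limit_trace_block_path_aux by blast

section \<open>Moments of the Marchenko--Pastur distribution\<close>

subsection \<open>The semicircle law on [-1, 1]\<close>

definition sc_moment :: "nat \<Rightarrow> real" where
  "sc_moment n = 2 / pi * integral {-1..1} (\<lambda>s. s ^ n * sqrt (1 - s\<^sup>2))"

lemma semicircle_integrable:
  "continuous_on {-1..1} f \<Longrightarrow> (\<lambda>s::real. f s * sqrt (1 - s\<^sup>2)) integrable_on {-1..1}"
  by (intro integrable_continuous_interval continuous_intros)

lemma one_minus_square_pos: "s \<in> {-1<..<1} \<Longrightarrow> 0 < 1 - (s::real)\<^sup>2"
  by (simp add: power2_less_1_iff abs_less_iff)

lemma sc_moment_0: "sc_moment 0 = 1"
proof -
  have "((\<lambda>s::real. sqrt (1 - s\<^sup>2)) has_integral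
      ((1 * sqrt (1 - 1\<^sup>2) + arcsin 1) / 2 - ((-1) * sqrt (1 - (-1)\<^sup>2) + arcsin (-1)) / 2)) {-1..1}"
  proof (rule fundamental_theorem_of_calculus_interior)
    show "continuous_on {-1..1} (\<lambda>s::real. (s * sqrt (1 - s\<^sup>2) + arcsin s) / 2)"
      by (auto intro!: continuous_intros)
    fix s :: real assume s: "s \<in> {-1<..<1}"
    have p: "0 < 1 - s\<^sup>2" by (rule one_minus_square_pos[OF s])
    have q: "sqrt (1 - s\<^sup>2) * sqrt (1 - s\<^sup>2) = 1 - s\<^sup>2" "sqrt (1 - s\<^sup>2) \<noteq> 0"
      using p by (auto simp: real_sqrt_mult_self)
    have "((\<lambda>s::real. (s * sqrt (1 - s\<^sup>2) + arcsin s) / 2) has_real_derivative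
      (1 * sqrt (1 - s\<^sup>2) + s * (- (2 * s) * (inverse (sqrt (1 - s\<^sup>2)) / 2)) + inverse (sqrt (1 - s\<^sup>2))) / 2) (at s)"
      using s p by (auto intro!: derivative_eq_intros)
    moreover have "(1 * sqrt (1 - s\<^sup>2) + s * (- (2 * s) * (inverse (sqrt (1 - s\<^sup>2)) / 2)) + inverse (sqrt (1 - s\<^sup>2))) / 2
       = sqrt (1 - s\<^sup>2)"
      using q by (simp add: field_simps power2_eq_square)
    ultimately show "((\<lambda>s::real. (s * sqrt (1 - s\<^sup>2) + arcsin s) / 2) has_vector_derivative sqrt (1 - s\<^sup>2)) (at s)"
      by (simp only: has_real_derivative_iff_has_vector_derivative)
  qed simp
  then have "integral {-1..1} (\<lambda>s::real. sqrt (1 - s\<^sup>2)) = pi / 2"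
    by (simp add: integral_unique)
  then show ?thesis by (simp add: sc_moment_def)
qed

lemma sqrt_cube_deriv:
  assumes "s \<in> {-1<..<1}"
  shows "((\<lambda>s::real. (1 - s\<^sup>2) * sqrt (1 - s\<^sup>2)) has_real_derivative - 3 * s * sqrt (1 - s\<^sup>2)) (at s)"
proof -
  have p: "0 < 1 - s\<^sup>2" by (rule one_minus_square_pos[OF assms])
  have q: "sqrt (1 - s\<^sup>2) * sqrt (1 - s\<^sup>2) = 1 - s\<^sup>2" "sqrt (1 - s\<^sup>2) \<noteq> 0"
    using p by (auto simp: real_sqrt_mult_self)
  have "((\<lambda>s::real. (1 - s\<^sup>2) * sqrt (1 - s\<^sup>2)) has_real_derivative
      - (2 * s) * sqrt (1 - s\<^sup>2) + (1 - s\<^sup>2) * (- (2 * s) * (inverse (sqrt (1 - s\<^sup>2)) / 2))) (at s)"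
    using p by (auto intro!: derivative_eq_intros)
  moreover have "(1 - s\<^sup>2) * (- (2 * s) * (inverse (sqrt (1 - s\<^sup>2)) / 2)) = - s * sqrt (1 - s\<^sup>2)"
  proof -
    have "x * (- (2 * s) * (inverse y / 2)) = - s * y" if "x = y * y" "y \<noteq> 0" for x y :: real
      using that by (simp add: field_simps)
    then show ?thesis using q(1)[symmetric] q(2) .
  qed
  moreover have "- (2 * s) * x + - s * x = - 3 * s * x" for x by (simp add: algebra_simps)
  ultimately show ?thesis by (simp only:)
qed

lemma sc_moment_1: "sc_moment 1 = 0"
proof -
  have "((\<lambda>s::real. s * sqrt (1 - s\<^sup>2)) has_integral
      (- ((1 - 1\<^sup>2) * sqrt (1 - 1\<^sup>2)) / 3 - (- ((1 - (-1)\<^sup>2) * sqrt (1 - (-1)\<^sup>2)) / 3))) {-1..1}"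
  proof (rule fundamental_theorem_of_calculus_interior)
    show "continuous_on {-1..1} (\<lambda>s::real. - ((1 - s\<^sup>2) * sqrt (1 - s\<^sup>2)) / 3)"
      by (auto intro!: continuous_intros)
    fix s :: real assume s: "s \<in> {-1<..<1}"
    from DERIV_cdivide[OF DERIV_minus[OF sqrt_cube_deriv[OF s]], of 3]
    show "((\<lambda>s::real. - ((1 - s\<^sup>2) * sqrt (1 - s\<^sup>2)) / 3) has_vector_derivative s * sqrt (1 - s\<^sup>2)) (at s)"
      by (simp add: has_real_derivative_iff_has_vector_derivative)
  qed simp
  then show ?thesis by (simp add: sc_moment_def integral_unique)
qed

text \<open>Integrate the derivative of s^(n+1) (1 - s^2)^(3/2), which vanishes at both
  endpoints.\<close>

lemma sc_moment_rec: "real (n + 4) * sc_moment (n + 2) = real (n + 1) * sc_moment n"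
proof -
  have "((\<lambda>s::real. real (n + 1) * (s ^ n * sqrt (1 - s\<^sup>2)) - real (n + 4) * (s ^ (n + 2) * sqrt (1 - s\<^sup>2)))
     has_integral (1 ^ (n + 1) * ((1 - 1\<^sup>2) * sqrt (1 - 1\<^sup>2)) - (-1) ^ (n + 1) * ((1 - (-1)\<^sup>2) * sqrt (1 - (-1)\<^sup>2)))) {-1..1}"
  proof (rule fundamental_theorem_of_calculus_interior)
    show "continuous_on {-1..1} (\<lambda>s::real. s ^ (n + 1) * ((1 - s\<^sup>2) * sqrt (1 - s\<^sup>2)))"
      by (auto intro!: continuous_intros)
    fix s :: real assume s: "s \<in> {-1<..<1}"
    have "((\<lambda>s::real. s ^ (n + 1) * ((1 - s\<^sup>2) * sqrt (1 - s\<^sup>2))) has_real_derivative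
        (real (n + 1) * s ^ n) * ((1 - s\<^sup>2) * sqrt (1 - s\<^sup>2)) + (- 3 * s * sqrt (1 - s\<^sup>2)) * s ^ (n + 1)) (at s)"
      using DERIV_mult[OF DERIV_pow[of "n + 1" s] sqrt_cube_deriv[OF s]] by simp
    moreover have "(real (n + 1) * s ^ n) * ((1 - s\<^sup>2) * sqrt (1 - s\<^sup>2)) + (- 3 * s * sqrt (1 - s\<^sup>2)) * s ^ (n + 1) =
        real (n + 1) * (s ^ n * sqrt (1 - s\<^sup>2)) - real (n + 4) * (s ^ (n + 2) * sqrt (1 - s\<^sup>2))"
      by (simp add: algebra_simps power2_eq_square)
    ultimately show "((\<lambda>s::real. s ^ (n + 1) * ((1 - s\<^sup>2) * sqrt (1 - s\<^sup>2))) has_vector_derivative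
        real (n + 1) * (s ^ n * sqrt (1 - s\<^sup>2)) - real (n + 4) * (s ^ (n + 2) * sqrt (1 - s\<^sup>2))) (at s)"
      by (simp only: has_real_derivative_iff_has_vector_derivative)
  qed simp
  then have "integral {-1..1} (\<lambda>s::real. real (n + 1) * (s ^ n * sqrt (1 - s\<^sup>2)) - real (n + 4) * (s ^ (n + 2) * sqrt (1 - s\<^sup>2))) = 0"
    by (simp add: integral_unique)
  moreover have "(\<lambda>s::real. s ^ k * sqrt (1 - s\<^sup>2)) integrable_on {-1..1}" for k
    by (intro semicircle_integrable continuous_intros)
  then have "integral {-1..1} (\<lambda>s::real. real (n + 1) * (s ^ n * sqrt (1 - s\<^sup>2)) - real (n + 4) * (s ^ (n + 2) * sqrt (1 - s\<^sup>2))) =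
      integral {-1..1} (\<lambda>s::real. real (n + 1) * (s ^ n * sqrt (1 - s\<^sup>2))) -
      integral {-1..1} (\<lambda>s::real. real (n + 4) * (s ^ (n + 2) * sqrt (1 - s\<^sup>2)))"
    by (intro integral_diff integrable_on_mult_right)
  ultimately have "real (n + 1) * integral {-1..1} (\<lambda>s::real. s ^ n * sqrt (1 - s\<^sup>2)) =
      real (n + 4) * integral {-1..1} (\<lambda>s::real. s ^ (n + 2) * sqrt (1 - s\<^sup>2))"
    by (simp only: integral_mult_right)
  then show ?thesis unfolding sc_moment_def by simp
qed

lemma sc_moment_odd: "odd n \<Longrightarrow> sc_moment n = 0"
proof (induction n rule: less_induct)
  case (less n)
  show ?case
  proof (cases "n = 1")
    case False
    then obtain m where m: "n = m + 2" using less.prems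
      by (metis One_nat_def add_2_eq_Suc' not0_implies_Suc odd_pos less_numeral_extra(3))
    then show ?thesis using less sc_moment_rec[of m] by simp
  qed (use sc_moment_1 in simp)
qed

text \<open>The right-hand side is the Catalan number C_k divided by 4^k. Writing it with the
  coefficients of sqrt (1 + x) makes the convolution identity below a case of Vandermonde's.\<close>

lemma sc_moment_even: "sc_moment (2 * k) = 2 * (- 1) ^ k * (1 / 2 gchoose Suc k)"
proof (induction k)
  case 0
  then show ?case by (simp add: sc_moment_0)
next
  case (Suc k)
  have "(2 * real k + 4) * sc_moment (2 * Suc k) = (2 * real k + 1) * sc_moment (2 * k)"
    using sc_moment_rec[of "2 * k"] by simp
  then have "(2 * real k + 4) * sc_moment (2 * Suc k) = - 4 * (- 1) ^ k * ((1 / 2 gchoose Suc k) * (1 / 2 - (real k + 1)))"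
    unfolding Suc.IH by (simp add: algebra_simps)
  also have "(1 / 2 gchoose Suc k) * (1 / 2 - (real k + 1)) = (1 / 2 gchoose Suc (Suc k)) * (real k + 2)"
    using gbinomial_absorb_comp[of "1 / 2 :: real" "Suc k"] gbinomial_absorption[of "Suc k" "1 / 2 :: real"]
    by (simp add: algebra_simps)
  also have "- 4 * (- 1) ^ k * ((1 / 2 gchoose Suc (Suc k)) * (real k + 2)) =
      (2 * real k + 4) * (2 * (- 1) ^ Suc k * (1 / 2 gchoose Suc (Suc k)))"
    by (simp add: algebra_simps)
  finally have "(2 * real k + 4) * sc_moment (2 * Suc k) =
      (2 * real k + 4) * (2 * (- 1) ^ Suc k * (1 / 2 gchoose Suc (Suc k)))" .
  then show ?case by (rule mult_left_cancel[THEN iffD1, rotated]) linarith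
qed

lemma sum_even_support:
  fixes f :: "nat \<Rightarrow> real"
  assumes "\<And>i. odd i \<Longrightarrow> f i = 0"
  shows "(\<Sum>i<2 * k + 1. f i) = (\<Sum>j<k + 1. f (2 * j))"
  by (induction k) (auto simp: assms)

text \<open>The Catalan recursion, in the scaling of the interval [-1, 1]. For even \<open>n\<close>
  every summand contains an odd moment.\<close>

lemma sc_moment_quadratic: "sc_moment (Suc n) = (\<Sum>i<n. sc_moment i * sc_moment (n - 1 - i)) / 4"
proof (cases "even n")
  case True
  have "sc_moment i * sc_moment (n - 1 - i) = 0" if "i < n" for i
  proof -
    have "odd i \<or> odd (n - 1 - i)" using True that by presburger
    then show ?thesis by (metis sc_moment_odd mult_zero_left mult_zero_right)
  qed
  then have "(\<Sum>i<n. sc_moment i * sc_moment (n - 1 - i)) = 0" by (intro sum.neutral) auto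
  then show ?thesis using True by (simp add: sc_moment_odd)
next
  case False
  then obtain k where n: "n = 2 * k + 1" by (rule oddE)
  define h where "h j = (1 / 2 :: real) gchoose j" for j
  \<comment> \<open>The square of sqrt (1 + x) is 1 + x, which has no term of degree k + 2.
    Splitting off the two end terms of this coefficient leaves the wanted convolution.\<close>
  have "(\<Sum>j\<le>Suc (Suc k). h j * h (Suc (Suc k) - j)) = (1 gchoose Suc (Suc k))"
    unfolding h_def atMost_atLeast0 gbinomial_Vandermonde by simp
  also have "\<dots> = (0::real)"
    using binomial_gbinomial[of 1 "Suc (Suc k)", where 'a = real] by simp
  also have "(\<Sum>j\<le>Suc (Suc k). h j * h (Suc (Suc k) - j)) =
      2 * h (Suc (Suc k)) + (\<Sum>j\<le>k. h (Suc j) * h (Suc (k - j)))"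
    by (subst sum.atMost_Suc_shift, subst sum.atMost_Suc)
       (auto simp: h_def Suc_diff_le intro!: sum.cong)
  finally have V: "(\<Sum>j\<le>k. h (Suc j) * h (Suc (k - j))) = - 2 * h (Suc (Suc k))" by simp
  have "(\<Sum>i<n. sc_moment i * sc_moment (n - 1 - i)) =
      (\<Sum>j<k + 1. sc_moment (2 * j) * sc_moment (2 * k - 2 * j))"
    unfolding n by (subst sum_even_support) (auto simp: sc_moment_odd)
  also have "\<dots> = (\<Sum>j\<le>k. 4 * (- 1) ^ k * (h (Suc j) * h (Suc (k - j))))"
  proof (rule sum.cong)
    fix j assume "j \<in> {..k}"
    then have j: "j \<le> k" by simp
    have "sc_moment (2 * k - 2 * j) = 2 * (- 1) ^ (k - j) * h (Suc (k - j))"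
      using sc_moment_even[of "k - j"] by (simp add: h_def right_diff_distrib')
    moreover have "(- 1 :: real) ^ j * (- 1) ^ (k - j) = (- 1) ^ k"
      using j by (simp flip: power_add)
    moreover have "(2 * x * u) * (2 * y * v) = 4 * (x * y) * (u * v)" for x y u v :: real by simp
    ultimately show "sc_moment (2 * j) * sc_moment (2 * k - 2 * j) =
        4 * (- 1) ^ k * (h (Suc j) * h (Suc (k - j)))"
      unfolding sc_moment_even h_def by (simp only:)
  qed auto
  also have "\<dots> = 4 * (2 * (- 1) ^ Suc k * h (Suc (Suc k)))"
    unfolding sum_distrib_left[symmetric] V by simp
  also have "\<dots> = 4 * sc_moment (Suc n)"
    using sc_moment_even[of "Suc k"] by (simp add: n h_def)
  finally show ?thesis by simp
qed

subsection \<open>Shifted moments\<close>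

text \<open>Powers of x = \<open>\<rho> * s\<close> and of \<open>\<alpha> + x\<close> are kept
  apart, so that an induction can trade one factor \<open>\<alpha> + x\<close> for
  \<open>\<alpha>\<close> and one further \<open>x\<close>.\<close>

definition shifted_moment :: "real \<Rightarrow> real \<Rightarrow> nat \<Rightarrow> nat \<Rightarrow> real" where
  "shifted_moment \<rho> \<alpha> m n =
     2 / pi * integral {-1..1} (\<lambda>s. (\<rho> * s) ^ m * (\<alpha> + \<rho> * s) ^ n * sqrt (1 - s\<^sup>2))"

lemma shifted_moment_Suc:
  "shifted_moment \<rho> \<alpha> m (Suc n) = \<alpha> * shifted_moment \<rho> \<alpha> m n + shifted_moment \<rho> \<alpha> (Suc m) n"
proof -
  let ?f = "\<lambda>m n s. (\<rho> * s) ^ m * (\<alpha> + \<rho> * s) ^ n * sqrt (1 - s\<^sup>2)"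
  have i: "?f m n integrable_on {-1..1}" for m n
    by (intro semicircle_integrable continuous_intros)
  have eq: "?f m (Suc n) = (\<lambda>s. \<alpha> * ?f m n s + ?f (Suc m) n s)"
    by (rule ext) (simp add: algebra_simps)
  have "integral {-1..1} (?f m (Suc n)) = integral {-1..1} (\<lambda>s. \<alpha> * ?f m n s) + integral {-1..1} (?f (Suc m) n)"
    unfolding eq by (intro integral_add integrable_on_mult_right i)
  then have "integral {-1..1} (?f m (Suc n)) = \<alpha> * integral {-1..1} (?f m n) + integral {-1..1} (?f (Suc m) n)"
    by (simp only: integral_mult_right)
  then show ?thesis unfolding shifted_moment_def by (simp add: distrib_left)
qed

lemma shifted_moment_0: "shifted_moment \<rho> \<alpha> m 0 = \<rho> ^ m * sc_moment m"
proof -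
  have "(\<lambda>s. (\<rho> * s) ^ m * (\<alpha> + \<rho> * s) ^ 0 * sqrt (1 - s\<^sup>2)) = (\<lambda>s. \<rho> ^ m * (s ^ m * sqrt (1 - s\<^sup>2)))"
    by (auto simp: power_mult_distrib)
  then show ?thesis unfolding shifted_moment_def sc_moment_def by simp
qed

text \<open>The Schwinger--Dyson equation of the semicircle law, for the difference quotient of
  \<open>x^m (\<alpha> + x)^n\<close>.\<close>

lemma shifted_moment_schwinger_dyson:
  fixes \<rho> \<alpha> :: real
  defines "e \<equiv> shifted_moment \<rho> \<alpha>"
  shows "e (Suc m) n = \<rho>\<^sup>2 / 4 * ((\<Sum>i<m. e i 0 * e (m - 1 - i) n) + (\<Sum>j<n. e m j * e 0 (n - 1 - j)))"
proof (induction n arbitrary: m)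
  \<comment> \<open>Without a power of \<open>\<alpha> + x\<close> this is the quadratic recursion
    of the semicircle moments, rescaled by \<open>\<rho>\<close>.\<close>
  case 0
  have "(\<Sum>i<m. e i 0 * e (m - 1 - i) 0) = (\<Sum>i<m. \<rho> ^ (m - 1) * (sc_moment i * sc_moment (m - 1 - i)))"
  proof (rule sum.cong)
    fix i assume "i \<in> {..<m}"
    then have "\<rho> ^ i * \<rho> ^ (m - 1 - i) = \<rho> ^ (m - 1)" by (simp flip: power_add)
    moreover have "(\<rho> ^ i * u) * (\<rho> ^ (m - 1 - i) * v) = (\<rho> ^ i * \<rho> ^ (m - 1 - i)) * (u * v)" for u v by simp
    ultimately show "e i 0 * e (m - 1 - i) 0 = \<rho> ^ (m - 1) * (sc_moment i * sc_moment (m - 1 - i))"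
      unfolding e_def shifted_moment_0 by (simp only:)
  qed simp
  also have "\<dots> = \<rho> ^ (m - 1) * (4 * sc_moment (Suc m))"
    unfolding sc_moment_quadratic sum_distrib_left[symmetric] by simp
  finally show ?case
    by (cases m) (auto simp: e_def shifted_moment_0 sc_moment_odd power2_eq_square)
next
  case (Suc n)
  have rec: "e m (Suc n) = \<alpha> * e m n + e (Suc m) n" for m n
    unfolding e_def by (rule shifted_moment_Suc)
  have "e (Suc m) (Suc n) = \<alpha> * e (Suc m) n + e (Suc (Suc m)) n" by (rule rec)
  also have "\<dots> = \<rho>\<^sup>2 / 4 * (
      \<alpha> * (\<Sum>i<m. e i 0 * e (m - 1 - i) n) + (\<Sum>i<Suc m. e i 0 * e (m - i) n) +
      (\<Sum>j<n. (\<alpha> * e m j + e (Suc m) j) * e 0 (n - 1 - j)))"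
    unfolding Suc.IH by (simp add: sum.distrib sum_distrib_left algebra_simps)
  also have "(\<Sum>j<n. (\<alpha> * e m j + e (Suc m) j) * e 0 (n - 1 - j)) = (\<Sum>j<n. e m (Suc j) * e 0 (n - Suc j))"
    by (simp add: rec)
  also have "\<alpha> * (\<Sum>i<m. e i 0 * e (m - 1 - i) n) + (\<Sum>i<Suc m. e i 0 * e (m - i) n) =
      (\<Sum>i<m. e i 0 * e (m - 1 - i) (Suc n)) + e m 0 * e 0 n"
  proof -
    have "(\<Sum>i<m. e i 0 * e (m - 1 - i) (Suc n)) =
        \<alpha> * (\<Sum>i<m. e i 0 * e (m - 1 - i) n) + (\<Sum>i<m. e i 0 * e (m - i) n)"
      unfolding sum_distrib_left sum.distrib[symmetric]
      by (rule sum.cong) (auto simp: rec Suc_diff_Suc algebra_simps)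
    then show ?thesis by simp
  qed
  finally show ?case
    by (simp add: sum.lessThan_Suc_shift add.assoc del: sum.lessThan_Suc)
qed

text \<open>The support of the Marchenko-Pastur density has centre 1 + c and half-length 2 sqrt c;
  for this radius \<open>\<rho>\<close> the factor \<open>\<rho>^2 / 4\<close> is \<open>c\<close>.
  The claim is the case \<open>m = 0\<close> of the Schwinger-Dyson equation.\<close>

lemma shifted_moment_recursion:
  fixes c :: real
  assumes "0 < c"
  defines "P \<equiv> shifted_moment (2 * sqrt c) (1 + c) 0"
  shows "P 0 = 1" "P (Suc n) = (1 + c) * P n + c * (\<Sum>j<n. P j * P (n - 1 - j))"
proof -
  show "P 0 = 1" by (simp add: P_def shifted_moment_0 sc_moment_0)
  have "(2 * sqrt c)\<^sup>2 / 4 = c" using assms by (simp add: power_mult_distrib)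
  then show "P (Suc n) = (1 + c) * P n + c * (\<Sum>j<n. P j * P (n - 1 - j))"
    using shifted_moment_schwinger_dyson[of "2 * sqrt c" "1 + c" 0 n]
    by (simp add: P_def shifted_moment_Suc)
qed

subsection \<open>Integration against the Marchenko--Pastur distribution\<close>

context
  fixes c a b :: real
  assumes c: "0 < c"
  defines "a \<equiv> (1 - sqrt c)\<^sup>2" and "b \<equiv> (1 + sqrt c)\<^sup>2"
begin

lemma mp_endpoints: "0 \<le> a" "a < b" "a + b = 2 * (1 + c)" "a * b = (1 - c)\<^sup>2" "b - a = 4 * sqrt c"
proof -
  have s: "sqrt c * sqrt c = c" "0 < sqrt c" using c by auto
  show "0 \<le> a" by (simp add: a_def)
  show "a + b = 2 * (1 + c)" "b - a = 4 * sqrt c"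
    using s(1) by (simp_all add: a_def b_def power2_eq_square algebra_simps)
  then show "a < b" using s(2) by linarith
  have "a * b = ((1 - sqrt c) * (1 + sqrt c))\<^sup>2" by (simp add: a_def b_def power_mult_distrib)
  also have "(1 - sqrt c) * (1 + sqrt c) = 1 - c" using s(1) by (simp add: algebra_simps)
  finally show "a * b = (1 - c)\<^sup>2" .
qed

lemma mp_quadratic: "(b - t) * (t - a) = 4 * c - (t - (1 + c))\<^sup>2"
proof -
  have "(b - t) * (t - a) = (a + b) * t - t * t - a * b" by (simp add: algebra_simps)
  then show ?thesis unfolding mp_endpoints by (simp add: power2_eq_square algebra_simps)
qed

lemma one_minus_divide_square: "0 < r \<Longrightarrow> 1 - (x / r)\<^sup>2 = (r\<^sup>2 - x\<^sup>2) / r\<^sup>2" for r :: real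
  by (simp add: power_divide diff_divide_distrib)

text \<open>Substitute t = 1 + c + 2 sqrt c s. The root and the differential each contribute 2 sqrt
  c, and with the constants 1 / (2 pi) and pi / 2 this gives the factor \<open>c\<close>. The
  integrand is already t^(n+1) times the density.\<close>

lemma mp_integral_pos:
  "((\<lambda>t. t ^ n * sqrt ((b - t) * (t - a)) / (2 * pi)) has_integral
     c * shifted_moment (2 * sqrt c) (1 + c) 0 n) {a..b}"
proof -
  let ?r = "2 * sqrt c" and ?\<alpha> = "1 + c"
  have r: "0 < ?r" "?r * ?r = 4 * c" using c by auto
  let ?f = "\<lambda>s. (?\<alpha> + ?r * s) ^ n * sqrt (1 - s\<^sup>2)"
  have "?f integrable_on {-1..1}" by (intro semicircle_integrable continuous_intros)
  then have "(?f has_integral integral {-1..1} ?f) (cbox (-1) 1)" by (simp add: integrable_integral)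
  moreover have "integral {-1..1} ?f = pi / 2 * shifted_moment ?r ?\<alpha> 0 n" by (simp add: shifted_moment_def)
  ultimately have f: "(?f has_integral (pi / 2 * shifted_moment ?r ?\<alpha> 0 n)) (cbox (-1) 1)" by simp
  have img: "(\<lambda>x. 1 / (1 / ?r) * x + - (1 / (1 / ?r) * (- ?\<alpha> / ?r))) ` cbox (-1) 1 = {a..b}"
  proof -
    have eq: "(\<lambda>x. 1 / (1 / ?r) * x + - (1 / (1 / ?r) * (- ?\<alpha> / ?r))) = (\<lambda>x. ?r * x + ?\<alpha>)"
      using r by (auto simp: field_simps)
    have "- ?r + ?\<alpha> = a" "?r + ?\<alpha> = b"
      using c by (auto simp: a_def b_def power2_eq_square algebra_simps)
    then have "(\<lambda>x. ?r * x + ?\<alpha>) ` {-1..1} = {a..b}"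
      using r image_affinity_atLeastAtMost[of ?r ?\<alpha> "-1" 1] by simp
    then show ?thesis by (simp only: eq cbox_interval)
  qed
  have g: "?f (1 / ?r * t + - ?\<alpha> / ?r) = t ^ n * sqrt ((b - t) * (t - a)) / ?r" for t
  proof -
    have 1: "?\<alpha> + ?r * (1 / ?r * t + - ?\<alpha> / ?r) = t" using r by (simp add: field_simps)
    have "1 / ?r * t + - ?\<alpha> / ?r = (t - ?\<alpha>) / ?r" using r by (simp add: field_simps)
    then have "1 - (1 / ?r * t + - ?\<alpha> / ?r)\<^sup>2 = 1 - ((t - ?\<alpha>) / ?r)\<^sup>2" by (simp only:)
    also have "\<dots> = (?r\<^sup>2 - (t - ?\<alpha>)\<^sup>2) / ?r\<^sup>2" by (rule one_minus_divide_square[OF r(1)])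
    also have "\<dots> = ((b - t) * (t - a)) / ?r\<^sup>2" using r unfolding mp_quadratic by (simp add: power2_eq_square)
    finally have e: "1 - (1 / ?r * t + - ?\<alpha> / ?r)\<^sup>2 = ((b - t) * (t - a)) / ?r\<^sup>2" .
    have "sqrt (?r\<^sup>2) = ?r" using r(1) by (intro real_sqrt_unique) auto
    then have "sqrt (1 - (1 / ?r * t + - ?\<alpha> / ?r)\<^sup>2) = sqrt ((b - t) * (t - a)) / ?r"
      by (simp only: e real_sqrt_divide)
    then show ?thesis unfolding 1 by simp
  qed
  have m0: "1 / ?r \<noteq> 0" using r(1) by simp
  have "((\<lambda>t. ?f (1 / ?r * t + - ?\<alpha> / ?r)) has_integral
      (1 / (\<bar>1 / ?r\<bar> ^ DIM(real)) * (pi / 2 * shifted_moment ?r ?\<alpha> 0 n))) {a..b}"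
    by (rule has_integral_affinity[OF f m0, of "- ?\<alpha> / ?r", unfolded real_scaleR_def img])
  then have "((\<lambda>t. t ^ n * sqrt ((b - t) * (t - a)) / ?r) has_integral
      (?r * (pi / 2 * shifted_moment ?r ?\<alpha> 0 n))) {a..b}"
    unfolding g using r by simp
  from has_integral_mult_right[OF this, of "?r / (2 * pi)"]
  have *: "((\<lambda>t. ?r / (2 * pi) * (t ^ n * sqrt ((b - t) * (t - a)) / ?r)) has_integral
      (?r / (2 * pi) * (?r * (pi / 2 * shifted_moment ?r ?\<alpha> 0 n)))) {a..b}" .
  have e1: "x / (2 * pi) * (y / x) = y / (2 * pi)" if "0 < x" for x y :: real
    using that by simp
  have e2: "x / (2 * pi) * (x * (pi / 2 * y)) = x * x / 4 * y" for x y :: real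
    by (simp add: field_simps)
  show ?thesis using * unfolding e1[OF r(1)] e2 r(2) by simp
qed

text \<open>With S the square root, S / t has the primitive S + \<open>\<alpha>\<close> arcsin ((t -
  \<open>\<alpha>\<close>) / r) - q arcsin u, where q^2 = ab. Each arcsine grows by pi over the
  interval, so the mass is (1 + c - |1 - c|) / 2; the atom at 0 supplies the rest.\<close>

lemma mp_integral_zero:
  "((\<lambda>t. sqrt ((b - t) * (t - a)) / (2 * pi * t)) has_integral min 1 c) {a..b}"
proof -
  define S where "S t = sqrt ((b - t) * (t - a))" for t
  define \<alpha> q r where "\<alpha> = 1 + c" and "q = \<bar>1 - c\<bar>" and "r = 2 * sqrt c"
  have r: "0 < r" "r\<^sup>2 = 4 * c" using c by (auto simp: r_def power_mult_distrib)
  have q: "0 \<le> q" "q\<^sup>2 = a * b" "\<alpha>\<^sup>2 - r\<^sup>2 = q\<^sup>2" unfolding mp_endpoints r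
    by (auto simp: q_def \<alpha>_def power2_eq_square algebra_simps)
  have ends: "a = \<alpha> - r" "b = \<alpha> + r" using mp_endpoints(3,5) by (auto simp: \<alpha>_def r_def)
  have quad: "(b - t) * (t - a) = r\<^sup>2 - (t - \<alpha>)\<^sup>2" for t
    unfolding mp_quadratic r \<alpha>_def ..
  have pos: "0 < (b - t) * (t - a)" if "t \<in> {a<..<b}" for t using that by auto
  have S2: "S t * S t = (b - t) * (t - a)" "0 < S t" if "t \<in> {a<..<b}" for t
    using pos[OF that] by (auto simp: S_def)
  have u1: "((\<lambda>t. arcsin ((t - \<alpha>) / r)) has_real_derivative 1 / S t) (at t)" if t: "t \<in> {a<..<b}" for t
  proof -
    have lt: "- 1 < (t - \<alpha>) / r" "(t - \<alpha>) / r < 1" using t r by (auto simp: ends field_simps)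
    have "1 - ((t - \<alpha>) / r)\<^sup>2 = (b - t) * (t - a) / r\<^sup>2"
      unfolding quad by (rule one_minus_divide_square[OF r(1)])
    then have sq: "sqrt (1 - ((t - \<alpha>) / r)\<^sup>2) = S t / r" using r(1) by (simp add: S_def real_sqrt_divide)
    have "((\<lambda>t. arcsin ((t - \<alpha>) / r)) has_real_derivative inverse (sqrt (1 - ((t - \<alpha>) / r)\<^sup>2)) * (1 / r)) (at t)"
      using lt by (auto intro!: derivative_eq_intros simp: divide_inverse)
    then show ?thesis unfolding sq using r S2[OF t] by (simp add: field_simps)
  qed
  have u2: "((\<lambda>t. S t) has_real_derivative (\<alpha> - t) / S t) (at t)" if t: "t \<in> {a<..<b}" for t
  proof -
    have "((\<lambda>t. sqrt ((b - t) * (t - a))) has_real_derivative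
        ((b - t) - (t - a)) * (inverse (sqrt ((b - t) * (t - a))) / 2)) (at t)"
      using pos[OF t] by (auto intro!: derivative_eq_intros)
    moreover have "(b - t) - (t - a) = 2 * (\<alpha> - t)" unfolding ends by simp
    moreover have "2 * (\<alpha> - t) * (inverse x / 2) = (\<alpha> - t) / x" for x
      by (simp only: divide_inverse) simp
    ultimately show ?thesis unfolding S_def by (simp only:)
  qed
  have contS: "continuous_on {a..b} S" unfolding S_def by (intro continuous_intros)
  have cont1: "continuous_on {a..b} (\<lambda>t. arcsin ((t - \<alpha>) / r))"
    using r by (intro continuous_intros) (auto simp: ends field_simps)
  have "((\<lambda>t. S t / t) has_integral (\<alpha> * pi - q * pi)) {a..b}"
  proof (cases "q = 0")
    case True
    \<comment> \<open>Here c = 1 and a = 0, so the integrand is unbounded at 0 and the third term of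
      the primitive is absent. The primitive is continuous up to the endpoint, and derivatives are
      only needed in the interior.\<close>
    have "((\<lambda>t. S t / t) has_integral
        ((S b + \<alpha> * arcsin ((b - \<alpha>) / r)) - (S a + \<alpha> * arcsin ((a - \<alpha>) / r)))) {a..b}"
    proof (rule fundamental_theorem_of_calculus_interior)
      show "a \<le> b" using mp_endpoints(2) by simp
      show "continuous_on {a..b} (\<lambda>t. S t + \<alpha> * arcsin ((t - \<alpha>) / r))"
        by (intro continuous_on_add continuous_on_mult_left contS cont1)
      fix t assume t: "t \<in> {a<..<b}"
      have t0: "0 < t" using t mp_endpoints(1) by auto
      have "(\<alpha> - t) / S t + \<alpha> * (1 / S t) = (2 * \<alpha> - t) / S t"
        by (simp add: diff_divide_distrib add_divide_distrib)
      also have "2 * \<alpha> - t = S t * S t / t"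
      proof -
        have "S t * S t = (2 * \<alpha> - t) * t"
          unfolding S2(1)[OF t] quad using q(3) True by (simp add: power2_eq_square algebra_simps)
        then show ?thesis using t0 by simp
      qed
      finally have "(\<alpha> - t) / S t + \<alpha> * (1 / S t) = S t / t" using S2(2)[OF t] by simp
      moreover have "((\<lambda>t. S t + \<alpha> * arcsin ((t - \<alpha>) / r)) has_real_derivative (\<alpha> - t) / S t + \<alpha> * (1 / S t)) (at t)"
        by (intro DERIV_add DERIV_cmult u1 u2 t)
      ultimately show "((\<lambda>t. S t + \<alpha> * arcsin ((t - \<alpha>) / r)) has_vector_derivative S t / t) (at t)"
        by (simp add: has_real_derivative_iff_has_vector_derivative)
    qed
    moreover have "(S b + \<alpha> * arcsin ((b - \<alpha>) / r)) - (S a + \<alpha> * arcsin ((a - \<alpha>) / r)) = \<alpha> * pi - q * pi"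
      using r True by (simp add: ends S_def)
    ultimately show ?thesis by simp
  next
    case False
    then have q0: "0 < q" using q by simp
    have a0: "0 < a" using q mp_endpoints(1) q0 by (metis less_eq_real_def mult_zero_left power_eq_0_iff less_irrefl)
    \<comment> \<open>\<open>u\<close> is affine in 1 / t and runs from -1 at \<open>a\<close> to 1
      at \<open>b\<close>; its arcsine has the derivative q / (t S), which the other two terms of
      the primitive cannot produce.\<close>
    define u where "u t = (\<alpha> * t - q\<^sup>2) / (r * t)" for t
    have usq: "1 - (u t)\<^sup>2 = q\<^sup>2 * ((b - t) * (t - a)) / (r * t)\<^sup>2" if "0 < t" for t
    proof -
      have "(r * t)\<^sup>2 - (\<alpha> * t - q\<^sup>2)\<^sup>2 = - (\<alpha>\<^sup>2 - r\<^sup>2) * t\<^sup>2 + 2 * \<alpha> * q\<^sup>2 * t - q\<^sup>2 * q\<^sup>2"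
        by (simp add: power2_eq_square algebra_simps)
      also have "\<dots> = q\<^sup>2 * (- t\<^sup>2 + 2 * \<alpha> * t - q\<^sup>2)" unfolding q(3) by (simp add: algebra_simps)
      also have "- t\<^sup>2 + 2 * \<alpha> * t - q\<^sup>2 = (b - t) * (t - a)"
        unfolding quad q(3)[symmetric] by (simp add: power2_eq_square algebra_simps)
      finally have e: "(r * t)\<^sup>2 - (\<alpha> * t - q\<^sup>2)\<^sup>2 = q\<^sup>2 * ((b - t) * (t - a))" .
      have "0 < r * t" using that r(1) by simp
      then show ?thesis unfolding u_def by (simp only: one_minus_divide_square e)
    qed
    have u3: "((\<lambda>t. arcsin (u t)) has_real_derivative q / (t * S t)) (at t)" if t: "t \<in> {a<..<b}" for t
    proof -
      have t0: "0 < t" using t a0 by auto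
      have "0 < 1 - (u t)\<^sup>2" unfolding usq[OF t0] using pos[OF t] q0 t0 r by simp
      then have lt: "- 1 < u t" "u t < 1" by (auto simp: power2_less_1_iff abs_less_iff)
      have sq: "sqrt (1 - (u t)\<^sup>2) = q * S t / (r * t)"
        unfolding usq[OF t0] using q0 t0 r by (simp add: S_def real_sqrt_divide real_sqrt_mult)
      have "u = (\<lambda>t. (\<alpha> * t - q\<^sup>2) / (r * t))" by (simp add: u_def fun_eq_iff)
      then have du: "(u has_real_derivative (\<alpha> * (r * t) - (\<alpha> * t - q\<^sup>2) * r) / ((r * t) * (r * t))) (at t)"
        using t0 r by (auto intro!: derivative_eq_intros)
      have "((\<lambda>t. arcsin (u t)) has_real_derivative
          inverse (sqrt (1 - (u t)\<^sup>2)) * ((\<alpha> * (r * t) - (\<alpha> * t - q\<^sup>2) * r) / ((r * t) * (r * t)))) (at t)"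
        by (rule DERIV_chain2[OF DERIV_arcsin[OF lt] du])
      moreover have "inverse (sqrt (1 - (u t)\<^sup>2)) * ((\<alpha> * (r * t) - (\<alpha> * t - q\<^sup>2) * r) / ((r * t) * (r * t))) = q / (t * S t)"
        unfolding sq using q0 t0 r S2(2)[OF t] by (simp add: field_simps power2_eq_square)
      ultimately show ?thesis by simp
    qed
    have cont3: "continuous_on {a..b} (\<lambda>t. arcsin (u t))"
    proof -
      have "- 1 \<le> u t \<and> u t \<le> 1" if "t \<in> {a..b}" for t
      proof -
        have "0 \<le> 1 - (u t)\<^sup>2" using that a0 by (subst usq) auto
        then have "(u t)\<^sup>2 \<le> 1" by simp
        then show ?thesis by (simp add: abs_square_le_1 abs_le_iff)
      qed
      moreover have "continuous_on {a..b} u"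
        unfolding u_def using a0 r by (intro continuous_intros) auto
      ultimately show ?thesis by (intro continuous_on_arcsin) auto
    qed
    have "((\<lambda>t. S t / t) has_integral
        ((S b + \<alpha> * arcsin ((b - \<alpha>) / r) - q * arcsin (u b)) - (S a + \<alpha> * arcsin ((a - \<alpha>) / r) - q * arcsin (u a)))) {a..b}"
    proof (rule fundamental_theorem_of_calculus_interior)
      show "a \<le> b" using mp_endpoints(2) by simp
      show "continuous_on {a..b} (\<lambda>t. S t + \<alpha> * arcsin ((t - \<alpha>) / r) - q * arcsin (u t))"
        by (intro continuous_on_add continuous_on_diff continuous_on_mult_left contS cont1 cont3)
      fix t assume t: "t \<in> {a<..<b}"
      have t0: "0 < t" using t mp_endpoints(1) by auto
      have "(\<alpha> - t) / S t + \<alpha> * (1 / S t) - q * (q / (t * S t)) = ((2 * \<alpha> - t) * t - q\<^sup>2) / (t * S t)"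
        using t0 S2(2)[OF t] by (simp add: field_simps power2_eq_square)
      also have "(2 * \<alpha> - t) * t - q\<^sup>2 = S t * S t"
        unfolding S2(1)[OF t] quad q(3)[symmetric] by (simp add: power2_eq_square algebra_simps)
      finally have "(\<alpha> - t) / S t + \<alpha> * (1 / S t) - q * (q / (t * S t)) = S t / t" using S2(2)[OF t] by simp
      moreover have "((\<lambda>t. S t + \<alpha> * arcsin ((t - \<alpha>) / r) - q * arcsin (u t)) has_real_derivative
          (\<alpha> - t) / S t + \<alpha> * (1 / S t) - q * (q / (t * S t))) (at t)"
        by (intro DERIV_add DERIV_diff DERIV_cmult u1 u2 u3 t)
      ultimately show "((\<lambda>t. S t + \<alpha> * arcsin ((t - \<alpha>) / r) - q * arcsin (u t)) has_vector_derivative S t / t) (at t)"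
        by (simp add: has_real_derivative_iff_has_vector_derivative)
    qed
    moreover have "u b = 1" "u a = -1"
    proof -
      have "\<alpha> * b - q\<^sup>2 = r * b" "\<alpha> * a - q\<^sup>2 = - (r * a)"
        unfolding q(3)[symmetric] ends by (simp_all add: power2_eq_square algebra_simps)
      then show "u b = 1" "u a = -1" using r a0 mp_endpoints(2) by (auto simp: u_def)
    qed
    ultimately show ?thesis using r by (simp add: ends S_def algebra_simps)
  qed
  from has_integral_mult_right[OF this, of "1 / (2 * pi)"]
  have "((\<lambda>t. sqrt ((b - t) * (t - a)) / (2 * pi * t)) has_integral (1 / (2 * pi) * (\<alpha> * pi - q * pi))) {a..b}"
    by (simp add: S_def mult.commute)
  moreover have "1 / (2 * pi) * (\<alpha> * pi - q * pi) = min 1 c"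
    by (auto simp: \<alpha>_def q_def field_simps min_def)
  ultimately show ?thesis by simp
qed

text \<open>In positive degree one factor t cancels the denominator of the density, whence the shift
  by 1. In degree 0 the value 1 is the density's mass together with the atom.\<close>

definition mp_moment :: "nat \<Rightarrow> real" where
  "mp_moment n = (if n = 0 then 1 else c * shifted_moment (2 * sqrt c) (1 + c) 0 (n - 1))"

text \<open>This form, and not the usual quadratic one, is what \<open>open_block_replicate\<close>
  yields when all cumulants equal \<open>c\<close>.\<close>

lemma mp_moment_recursion:
  "mp_moment (Suc n) = c * mp_moment n + (\<Sum>k<n. mp_moment (Suc k) * mp_moment (n - Suc k))"
proof (cases n)
  case 0
  then show ?thesis using shifted_moment_recursion(1)[OF c] by (simp add: mp_moment_def)
next
  case (Suc m)
  let ?P = "shifted_moment (2 * sqrt c) (1 + c) 0"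
  \<comment> \<open>The last summand stands apart because its second factor is the moment of degree
    0, which lacks the prefactor \<open>c\<close>.\<close>
  have "(\<Sum>k<n. mp_moment (Suc k) * mp_moment (n - Suc k)) =
      (\<Sum>k<m. c * ?P k * (c * ?P (m - 1 - k))) + c * ?P m"
    unfolding Suc sum.lessThan_Suc by (auto simp: mp_moment_def intro!: sum.cong)
  then show ?thesis
    using shifted_moment_recursion(2)[OF c, of m]
    by (simp add: Suc mp_moment_def sum_distrib_left algebra_simps)
qed

lemma mp_density_integral:
  "((\<lambda>t. t ^ n * marchenko_pastur_density c t) has_integral
     (mp_moment n - (if n = 0 then max 0 (1 - c) else 0))) UNIV"
proof -
  have eq: "t ^ n * marchenko_pastur_density c t =
      (if t \<in> {a..b} then t ^ n * (sqrt ((b - t) * (t - a)) / (2 * pi * t)) else 0)" for t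
    by (simp add: marchenko_pastur_density_def a_def b_def)
  have "((\<lambda>t. t ^ n * (sqrt ((b - t) * (t - a)) / (2 * pi * t))) has_integral
     (mp_moment n - (if n = 0 then max 0 (1 - c) else 0))) {a..b}"
  proof (cases n)
    case 0
    then show ?thesis using mp_integral_zero by (auto simp: mp_moment_def min_def max_def)
  next
    case (Suc m)
    have "t ^ m * sqrt ((b - t) * (t - a)) / (2 * pi) = t ^ n * (sqrt ((b - t) * (t - a)) / (2 * pi * t))"
      if "t \<in> {a..b}" for t
    \<comment> \<open>The point 0 lies in the interval only if a = 0, and then the square root
      vanishes there.\<close>
    proof (cases "t = 0")
      case True
      then have "a = 0" using that mp_endpoints(1) by simp
      then show ?thesis using True by simp
    qed (simp add: Suc)
    then show ?thesis
      using has_integral_cong[THEN iffD1, OF _ mp_integral_pos[of m]] Suc by (simp add: mp_moment_def)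
  qed
  then show ?thesis unfolding eq has_integral_restrict_UNIV .
qed

text \<open>The measure is given by its values on sets, so the two summands are carried over to
  integrals by induction on measurable functions.\<close>

lemma nn_integral_marchenko_pastur:
  assumes "f \<in> borel_measurable borel"
  shows "(\<integral>\<^sup>+t. f t \<partial>marchenko_pastur c) =
    (\<integral>\<^sup>+t. f t \<partial>density lborel (\<lambda>t. ennreal (marchenko_pastur_density c t))) +
    ennreal (max 0 (1 - c)) * f 0"
proof -
  let ?D = "density lborel (\<lambda>t. ennreal (marchenko_pastur_density c t))"
  have sp: "measurable (marchenko_pastur c) borel = measurable borel (borel :: ennreal measure)"
    "measurable ?D borel = measurable borel (borel :: ennreal measure)"
    by (auto intro!: measurable_cong_sets)
  show ?thesis
    using assms
  proof (induction rule: borel_measurable_induct)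
    case (cong f g)
    then show ?case by (simp add: fun_eq_iff)
  next
    case (set A)
    then show ?case by (simp add: emeasure_marchenko_pastur)
  next
    case (mult u z)
    then show ?case by (simp add: nn_integral_cmult sp distrib_left ac_simps)
  next
    case (add u v)
    then show ?case by (simp add: nn_integral_add sp distrib_left ac_simps)
  next
    case (seq U)
    have "(\<integral>\<^sup>+t. (SUP i. U i t) \<partial>marchenko_pastur c) = (SUP i. \<integral>\<^sup>+t. U i t \<partial>marchenko_pastur c)"
      using seq by (intro nn_integral_monotone_convergence_SUP) (auto simp: sp)
    also have "\<dots> = (SUP i. (\<integral>\<^sup>+t. U i t \<partial>?D) + ennreal (max 0 (1 - c)) * U i 0)"
      using seq by simp
    also have "\<dots> = (SUP i. \<integral>\<^sup>+t. U i t \<partial>?D) + (SUP i. ennreal (max 0 (1 - c)) * U i 0)"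
      using seq by (intro ennreal_SUP_add) (auto simp: incseq_def le_fun_def intro!: nn_integral_mono mult_left_mono)
    also have "(SUP i. \<integral>\<^sup>+t. U i t \<partial>?D) = (\<integral>\<^sup>+t. (SUP i. U i t) \<partial>?D)"
      using seq by (intro nn_integral_monotone_convergence_SUP[symmetric]) (auto simp: sp)
    finally show ?case by (simp add: SUP_mult_left_ennreal image_comp)
  qed
qed

lemma marchenko_pastur_density_nonneg: "0 \<le> marchenko_pastur_density c t"
  using mp_endpoints(1) by (auto simp: marchenko_pastur_density_def a_def[symmetric] b_def[symmetric] indicator_def)

lemma marchenko_pastur_density_neg: "t < 0 \<Longrightarrow> marchenko_pastur_density c t = 0"
  using mp_endpoints(1) by (auto simp: marchenko_pastur_density_def a_def[symmetric] b_def[symmetric] indicator_def)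

lemma marchenko_pastur_density_measurable [measurable]: "marchenko_pastur_density c \<in> borel_measurable borel"
  unfolding marchenko_pastur_density_def[abs_def] Let_def by measurable

lemma marchenko_pastur_moments:
  "has_bochner_integral (marchenko_pastur c) (\<lambda>t. t ^ n) (mp_moment n)"
proof (rule has_bochner_integral_nn_integral)
  have sp: "measurable (marchenko_pastur c) borel = measurable borel (borel :: real measure)"
    by (auto intro!: measurable_cong_sets)
  show "(\<lambda>t. t ^ n) \<in> borel_measurable (marchenko_pastur c)" by (simp add: sp)
  let ?d = "marchenko_pastur_density c"
  have nn: "0 \<le> t ^ n * ?d t" for t
    using marchenko_pastur_density_nonneg[of t] marchenko_pastur_density_neg[of t]
    by (cases "t < 0") auto
  have I: "(\<integral>\<^sup>+t. ennreal (t ^ n * ?d t) \<partial>lborel) = ennreal (mp_moment n - (if n = 0 then max 0 (1 - c) else 0))"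
    by (rule nn_integral_has_integral_lborel[OF _ nn mp_density_integral]) measurable
  have r0: "0 \<le> mp_moment n - (if n = 0 then max 0 (1 - c) else 0)"
    by (rule has_integral_nonneg[OF mp_density_integral]) (use nn in auto)
  then show "0 \<le> mp_moment n" by (auto split: if_splits)
  have D: "(\<integral>\<^sup>+t. ennreal (t ^ n) \<partial>density lborel (\<lambda>t. ennreal (?d t))) = (\<integral>\<^sup>+t. ennreal (t ^ n * ?d t) \<partial>lborel)"
    using marchenko_pastur_density_nonneg
    by (subst nn_integral_density) (auto simp: ennreal_mult' mult.commute intro!: nn_integral_cong)
  show "(\<integral>\<^sup>+t. ennreal (t ^ n) \<partial>marchenko_pastur c) = ennreal (mp_moment n)"
  proof -
    \<comment> \<open>\<open>0 ^ n\<close> is 1 for \<open>n = 0\<close> and 0 otherwise, so the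
      atom is seen only by the total mass.\<close>
    let ?y = "max 0 (1 - c)"
    have "(\<integral>\<^sup>+t. ennreal (t ^ n) \<partial>marchenko_pastur c) =
        ennreal (mp_moment n - (if n = 0 then ?y else 0)) + ennreal ?y * ennreal (0 ^ n)"
    proof -
      have m: "(\<lambda>t::real. ennreal (t ^ n)) \<in> borel_measurable borel" by measurable
      show ?thesis unfolding nn_integral_marchenko_pastur[OF m] D I ..
    qed
    also have "\<dots> = ennreal (mp_moment n)"
    proof (cases "n = 0")
      case True
      then have "ennreal (mp_moment n - (if n = 0 then ?y else 0)) + ennreal ?y * ennreal (0 ^ n) =
          ennreal (mp_moment n - ?y) + ennreal ?y" by simp
      also have "\<dots> = ennreal (mp_moment n - ?y + ?y)"
        using r0 True by (intro ennreal_plus[symmetric]) auto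
      finally show ?thesis by simp
    qed simp
    finally show ?thesis .
  qed
  \<comment> \<open>Odd powers are negative only on the negative half-line, which carries neither
    density nor atom.\<close>
  show "AE t in marchenko_pastur c. 0 \<le> t ^ n"
  proof (rule AE_I)
    show "{t \<in> space (marchenko_pastur c). \<not> 0 \<le> t ^ n} \<subseteq> {..<0}"
      by (auto simp: not_le)
    show "{..<0} \<in> sets (marchenko_pastur c)" by simp
    have "(\<integral>\<^sup>+t. ennreal (?d t) * indicator {..<0} t \<partial>lborel) = (\<integral>\<^sup>+(t::real). 0 \<partial>lborel)"
      by (intro nn_integral_cong) (auto simp: indicator_def marchenko_pastur_density_neg)
    then show "emeasure (marchenko_pastur c) {..<0} = 0"
      by (simp add: emeasure_marchenko_pastur emeasure_density)
  qed
qed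

end

section \<open>Loop equations for the blocks of a Wishart matrix\<close>

text \<open>Entries are given by explicit sums and not through matrix multiplication, so that each
  is visibly a polynomial in the Gaussian letters.\<close>

fun word_entry :: "nat \<Rightarrow> nat \<Rightarrow> 'a gaussian_array \<Rightarrow> (nat \<times> nat) list \<Rightarrow> nat \<Rightarrow> nat \<Rightarrow> 'a \<Rightarrow> complex" where
  "word_entry d p g [] a b \<omega> = (if a = b then 1 else 0)"
| "word_entry d p g (x # u) a b \<omega> = 1 / of_nat d *
    (\<Sum>q<d. \<Sum>k<p. g (fst x) a k \<omega> * cnj (g (snd x) q k \<omega>) * word_entry d p g u q b \<omega>)"

definition word_trace :: "nat \<Rightarrow> nat \<Rightarrow> 'a gaussian_array \<Rightarrow> (nat \<times> nat) list \<Rightarrow> 'a \<Rightarrow> complex" where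
  "word_trace d p g w \<omega> = 1 / of_nat d * (\<Sum>a<d. word_entry d p g w a a \<omega>)"

definition traces :: "nat \<Rightarrow> nat \<Rightarrow> 'a gaussian_array \<Rightarrow> (nat \<times> nat) list list \<Rightarrow> 'a \<Rightarrow> complex" where
  "traces d p g ws \<omega> = (\<Prod>w\<leftarrow>ws. word_trace d p g w \<omega>)"

lemma traces_simps [simp]:
  "traces d p g [] \<omega> = 1" "traces d p g (w # ws) \<omega> = word_trace d p g w \<omega> * traces d p g ws \<omega>"
  "traces d p g (ws @ vs) \<omega> = traces d p g ws \<omega> * traces d p g vs \<omega>"
  by (simp_all add: traces_def)

section \<open>Differentiating and contracting words in the blocks\<close>

lemma sum_rotate3:
  fixes f :: "nat \<Rightarrow> nat \<Rightarrow> nat \<Rightarrow> complex"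
  shows "(\<Sum>q\<in>A. \<Sum>k\<in>B. \<Sum>r\<in>C. f q k r) = (\<Sum>r\<in>C. \<Sum>q\<in>A. \<Sum>k\<in>B. f q k r)"
  unfolding sum.cartesian_product
  by (rule sum.reindex_bij_witness[of _ "\<lambda>(r, q, k). (q, k, r)" "\<lambda>(q, k, r). (r, q, k)"]) auto

lemma sum_permute5:
  fixes f :: "nat \<Rightarrow> nat \<Rightarrow> nat \<Rightarrow> nat \<Rightarrow> nat \<Rightarrow> complex"
  shows "(\<Sum>a\<in>A. \<Sum>q\<in>B. \<Sum>k\<in>C. \<Sum>b\<in>D. \<Sum>r\<in>F. f a q k b r) =
    (\<Sum>r\<in>F. \<Sum>q\<in>B. \<Sum>k\<in>C. \<Sum>a\<in>A. \<Sum>b\<in>D. f a q k b r)"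
  unfolding sum.cartesian_product
  by (rule sum.reindex_bij_witness[of _ "\<lambda>(r, q, k, a, b). (a, q, k, b, r)" "\<lambda>(a, q, k, b, r). (r, q, k, a, b)"]) auto

lemma word_entry_append:
  "a < d \<Longrightarrow> word_entry d p g (u @ v) a b \<omega> = (\<Sum>q<d. word_entry d p g u a q \<omega> * word_entry d p g v q b \<omega>)"
proof (induction u arbitrary: a)
  case Nil
  then show ?case by (simp add: if_distrib[of "\<lambda>x. x * _"] cong: if_cong)
next
  case (Cons x u)
  have "word_entry d p g ((x # u) @ v) a b \<omega> = 1 / of_nat d *
      (\<Sum>q<d. \<Sum>k<p. \<Sum>r<d. g (fst x) a k \<omega> * cnj (g (snd x) q k \<omega>) * word_entry d p g u q r \<omega> * word_entry d p g v r b \<omega>)"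
    by (simp add: Cons.IH sum_distrib_left mult.assoc)
  also have "(\<Sum>q<d. \<Sum>k<p. \<Sum>r<d. g (fst x) a k \<omega> * cnj (g (snd x) q k \<omega>) * word_entry d p g u q r \<omega> * word_entry d p g v r b \<omega>) =
      (\<Sum>r<d. \<Sum>q<d. \<Sum>k<p. g (fst x) a k \<omega> * cnj (g (snd x) q k \<omega>) * word_entry d p g u q r \<omega> * word_entry d p g v r b \<omega>)"
    by (rule sum_rotate3)
  finally show ?case
    by (simp add: sum_distrib_left sum_distrib_right mult.assoc)
qed

text \<open>The conjugate of \<open>g i r k\<close> occurs in factors whose second index is
  \<open>i\<close>. Removing it there breaks the product into a left part that ends in column
  \<open>k\<close> of a Gaussian matrix and a right part that starts in row
  \<open>r\<close>.\<close>

definition word_entry_deriv ::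
    "nat \<Rightarrow> nat \<Rightarrow> 'a gaussian_array \<Rightarrow> nat \<times> nat \<times> nat \<Rightarrow> (nat \<times> nat) list \<Rightarrow> nat \<Rightarrow> nat \<Rightarrow> 'a \<Rightarrow> complex" where
  "word_entry_deriv d p g = (\<lambda>(i, r, k) w a b \<omega>. \<Sum>s<length w. if snd (w ! s) = i
     then 1 / of_nat d * (\<Sum>q<d. word_entry d p g (take s w) a q \<omega> * g (fst (w ! s)) q k \<omega>) *
       word_entry d p g (drop (Suc s) w) r b \<omega>
     else 0)"

definition word_trace_deriv ::
    "nat \<Rightarrow> nat \<Rightarrow> 'a gaussian_array \<Rightarrow> nat \<times> nat \<times> nat \<Rightarrow> (nat \<times> nat) list \<Rightarrow> 'a \<Rightarrow> complex" where
  "word_trace_deriv d p g x w \<omega> = 1 / of_nat d * (\<Sum>a<d. word_entry_deriv d p g x w a a \<omega>)"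

definition traces_deriv ::
    "nat \<Rightarrow> nat \<Rightarrow> 'a gaussian_array \<Rightarrow> nat \<times> nat \<times> nat \<Rightarrow> (nat \<times> nat) list list \<Rightarrow> 'a \<Rightarrow> complex" where
  "traces_deriv d p g x ws \<omega> = (\<Sum>t<length ws. word_trace_deriv d p g x (ws ! t) \<omega> *
     traces d p g (take t ws @ drop (Suc t) ws) \<omega>)"

text \<open>The right-hand side, with its zero summand, is written exactly as the product rule
  produces it from the recursive equation of \<open>word_entry\<close>.\<close>

lemma word_entry_deriv_Cons:
  assumes "a < d" "r < d" "k < p"
  shows "word_entry_deriv d p g (i, r, k) (x # u) a b \<omega> = 1 / of_nat d *
    (\<Sum>q<d. \<Sum>l<p. (0 * cnj (g (snd x) q l \<omega>) +
         g (fst x) a l \<omega> * (if (snd x, q, l) = (i, r, k) then 1 else 0)) * word_entry d p g u q b \<omega> +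
       (g (fst x) a l \<omega> * cnj (g (snd x) q l \<omega>)) * word_entry_deriv d p g (i, r, k) u q b \<omega>)"
    (is "_ = 1 / of_nat d * (\<Sum>q<d. \<Sum>l<p. ?A q l + ?B q l)")
proof -
  have "(\<Sum>q<d. \<Sum>l<p. ?A q l) =
      (\<Sum>q<d. \<Sum>l<p. if l = k then (if q = r then (if snd x = i then g (fst x) a k \<omega> * word_entry d p g u r b \<omega> else 0) else 0) else 0)"
    by (intro sum.cong refl) auto
  also have "\<dots> = (if snd x = i then g (fst x) a k \<omega> * word_entry d p g u r b \<omega> else 0)"
    using assms by (simp add: sum.delta)
  finally have A: "(\<Sum>q<d. \<Sum>l<p. ?A q l) = (if snd x = i then g (fst x) a k \<omega> * word_entry d p g u r b \<omega> else 0)" .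
  define T where "T s q = word_entry d p g (take s u) q" for s q
  define C where "C s = g (fst (u ! s))" for s
  define D where "D s = word_entry d p g (drop (Suc s) u) r b \<omega>" for s
  have B: "(\<Sum>q<d. \<Sum>l<p. ?B q l) = (\<Sum>s<length u. if snd (u ! s) = i
     then (\<Sum>q'<d. word_entry d p g (x # take s u) a q' \<omega> * C s q' k \<omega>) * D s else 0)"
  proof -
    have "(\<Sum>q<d. \<Sum>l<p. ?B q l) = (\<Sum>q<d. \<Sum>l<p. \<Sum>s<length u. if snd (u ! s) = i
       then g (fst x) a l \<omega> * cnj (g (snd x) q l \<omega>) * (1 / of_nat d * (\<Sum>q'<d. T s q q' \<omega> * C s q' k \<omega>) * D s) else 0)"
      unfolding word_entry_deriv_def prod.case sum_distrib_left T_def C_def D_def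
      by (intro sum.cong refl) (auto simp: sum_distrib_left)
    also have "\<dots> = (\<Sum>s<length u. \<Sum>q<d. \<Sum>l<p. if snd (u ! s) = i
       then g (fst x) a l \<omega> * cnj (g (snd x) q l \<omega>) * (1 / of_nat d * (\<Sum>q'<d. T s q q' \<omega> * C s q' k \<omega>) * D s) else 0)"
      by (rule sum_rotate3)
    also have "\<dots> = (\<Sum>s<length u. if snd (u ! s) = i
     then (\<Sum>q'<d. word_entry d p g (x # take s u) a q' \<omega> * C s q' k \<omega>) * D s else 0)"
    proof (intro sum.cong refl)
      fix s
      have "(\<Sum>q'<d. word_entry d p g (x # take s u) a q' \<omega> * C s q' k \<omega>) * D s =
          (\<Sum>q'<d. \<Sum>q<d. \<Sum>l<p. g (fst x) a l \<omega> * cnj (g (snd x) q l \<omega>) * (1 / of_nat d * (T s q q' \<omega> * C s q' k \<omega>) * D s))"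
        by (simp add: T_def sum_distrib_left sum_distrib_right mult_ac)
      also have "\<dots> = (\<Sum>q<d. \<Sum>l<p. \<Sum>q'<d. g (fst x) a l \<omega> * cnj (g (snd x) q l \<omega>) * (1 / of_nat d * (T s q q' \<omega> * C s q' k \<omega>) * D s))"
        by (rule sum_rotate3[symmetric])
      finally show "(\<Sum>q<d. \<Sum>l<p. if snd (u ! s) = i
       then g (fst x) a l \<omega> * cnj (g (snd x) q l \<omega>) * (1 / of_nat d * (\<Sum>q'<d. T s q q' \<omega> * C s q' k \<omega>) * D s) else 0) =
        (if snd (u ! s) = i then (\<Sum>q'<d. word_entry d p g (x # take s u) a q' \<omega> * C s q' k \<omega>) * D s else 0)"
        by (auto simp: sum_distrib_left sum_distrib_right mult_ac)
    qed
    finally show ?thesis .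
  qed
  have C: "(\<Sum>q<d. word_entry d p g [] a q \<omega> * g (fst x) q k \<omega>) = g (fst x) a k \<omega>"
    using assms(1) by (simp add: if_distrib[of "\<lambda>x. x * _"] cong: if_cong)
  have "word_entry_deriv d p g (i, r, k) (x # u) a b \<omega> =
     (if snd x = i then 1 / of_nat d * (\<Sum>q<d. word_entry d p g [] a q \<omega> * g (fst x) q k \<omega>) * word_entry d p g u r b \<omega> else 0) +
     (\<Sum>s<length u. if snd (u ! s) = i
       then 1 / of_nat d * (\<Sum>q'<d. word_entry d p g (x # take s u) a q' \<omega> * C s q' k \<omega>) * D s else 0)"
    by (simp add: word_entry_deriv_def sum.lessThan_Suc_shift C_def D_def del: sum.lessThan_Suc word_entry.simps cong: if_cong)
  also have "\<dots> = 1 / of_nat d * ((\<Sum>q<d. \<Sum>l<p. ?A q l) + (\<Sum>q<d. \<Sum>l<p. ?B q l))"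
  proof -
    have "(\<Sum>s<length u. if snd (u ! s) = i then 1 / of_nat d * Z s * D s else 0) =
        1 / of_nat d * (\<Sum>s<length u. if snd (u ! s) = i then Z s * D s else 0)" for Z
      by (subst sum_distrib_left, intro sum.cong refl) simp
    then show ?thesis unfolding A B C distrib_left by (simp only: mult_zero_right mult.assoc if_distrib)
  qed
  finally show ?thesis by (simp only: sum.distrib)
qed

text \<open>The two kinds of contractions: inside a trace, which splits it, and between two traces,
  which merges them at the cost of a factor \<open>1 / d\<^sup>2\<close>.\<close>

lemma contraction_split:
  "1 / (of_nat d)\<^sup>2 * (\<Sum>a<d. \<Sum>q<d. \<Sum>k<p. cnj (g j q k \<omega>) * word_entry_deriv d p g (i, a, k) u q a \<omega>) =
    (\<Sum>s<length u. if snd (u ! s) = i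
      then word_trace d p g ((fst (u ! s), j) # take s u) \<omega> * word_trace d p g (drop (Suc s) u) \<omega> else 0)"
proof -
  define T where "T s q q' = word_entry d p g (take s u) q q' \<omega>" for s q q'
  define C where "C s q' k = g (fst (u ! s)) q' k \<omega>" for s q' k
  define D where "D s a = word_entry d p g (drop (Suc s) u) a a \<omega>" for s a
  have "(\<Sum>a<d. \<Sum>q<d. \<Sum>k<p. cnj (g j q k \<omega>) * word_entry_deriv d p g (i, a, k) u q a \<omega>) =
      (\<Sum>a<d. \<Sum>q<d. \<Sum>k<p. \<Sum>s<length u. if snd (u ! s) = i
         then cnj (g j q k \<omega>) * (1 / of_nat d * (\<Sum>q'<d. T s q q' * C s q' k) * D s a) else 0)"
    unfolding word_entry_deriv_def prod.case sum_distrib_left T_def C_def D_def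
    by (intro sum.cong refl) (auto simp: sum_distrib_left)
  also have "\<dots> = (\<Sum>s<length u. \<Sum>a<d. \<Sum>q<d. \<Sum>k<p. if snd (u ! s) = i
         then cnj (g j q k \<omega>) * (1 / of_nat d * (\<Sum>q'<d. T s q q' * C s q' k) * D s a) else 0)"
    unfolding sum.cartesian_product
    by (rule sum.reindex_bij_witness[of _ "\<lambda>(s, a, q, k). (a, q, k, s)" "\<lambda>(a, q, k, s). (s, a, q, k)"]) auto
  finally have "1 / (of_nat d)\<^sup>2 * (\<Sum>a<d. \<Sum>q<d. \<Sum>k<p. cnj (g j q k \<omega>) * word_entry_deriv d p g (i, a, k) u q a \<omega>) =
      (\<Sum>s<length u. 1 / (of_nat d)\<^sup>2 * (\<Sum>a<d. \<Sum>q<d. \<Sum>k<p. if snd (u ! s) = i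
         then cnj (g j q k \<omega>) * (1 / of_nat d * (\<Sum>q'<d. T s q q' * C s q' k) * D s a) else 0))"
    by (simp only: sum_distrib_left)
  also have "\<dots> = (\<Sum>s<length u. if snd (u ! s) = i
      then word_trace d p g ((fst (u ! s), j) # take s u) \<omega> * word_trace d p g (drop (Suc s) u) \<omega> else 0)"
  proof (intro sum.cong refl)
    fix s
    define S where "S = (\<Sum>q'<d. \<Sum>q<d. \<Sum>k<p. C s q' k * cnj (g j q k \<omega>) * T s q q')"
    have S: "(\<Sum>q<d. \<Sum>k<p. \<Sum>q'<d. C s q' k * cnj (g j q k \<omega>) * T s q q') = S"
      unfolding S_def by (rule sum_rotate3)
    have 1: "word_trace d p g ((fst (u ! s), j) # take s u) \<omega> = 1 / of_nat d * (1 / of_nat d * S)"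
      by (simp add: word_trace_def S_def C_def T_def sum_divide_distrib)
    have 2: "word_trace d p g (drop (Suc s) u) \<omega> = 1 / of_nat d * (\<Sum>a<d. D s a)"
      by (simp add: word_trace_def D_def)
    have "(\<Sum>a<d. \<Sum>q<d. \<Sum>k<p. cnj (g j q k \<omega>) * (1 / of_nat d * (\<Sum>q'<d. T s q q' * C s q' k) * D s a)) =
        (\<Sum>a<d. 1 / of_nat d * (\<Sum>q<d. \<Sum>k<p. \<Sum>q'<d. C s q' k * cnj (g j q k \<omega>) * T s q q') * D s a)"
      by (simp add: sum_distrib_left sum_distrib_right mult_ac)
    also have "\<dots> = 1 / of_nat d * S * (\<Sum>a<d. D s a)"
      unfolding S by (simp add: sum_distrib_left)
    finally show "1 / (of_nat d)\<^sup>2 * (\<Sum>a<d. \<Sum>q<d. \<Sum>k<p. if snd (u ! s) = i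
         then cnj (g j q k \<omega>) * (1 / of_nat d * (\<Sum>q'<d. T s q q' * C s q' k) * D s a) else 0) =
      (if snd (u ! s) = i
      then word_trace d p g ((fst (u ! s), j) # take s u) \<omega> * word_trace d p g (drop (Suc s) u) \<omega> else 0)"
      unfolding 1 2 by (simp add: power2_eq_square)
  qed
  finally show ?thesis .
qed

text \<open>Opening the trace of \<open>v\<close> at \<open>s\<close> leaves the cyclic word that
  starts behind \<open>s\<close>, and this is inserted after \<open>u\<close>. The powers of
  \<open>d\<close> on both sides balance, so the prefactor 1 / d^2 of the first trace survives,
  whereas splitting uses it up.\<close>

lemma contraction_merge:
  "(\<Sum>a<d. \<Sum>q<d. \<Sum>k<p. cnj (g j q k \<omega>) * word_entry d p g u q a \<omega> * word_trace_deriv d p g (i, a, k) v \<omega>) =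
    (\<Sum>s<length v. if snd (v ! s) = i
      then word_trace d p g ((fst (v ! s), j) # u @ drop (Suc s) v @ take s v) \<omega> else 0)"
proof -
  define T where "T s b r = word_entry d p g (take s v) b r \<omega>" for s b r
  define C where "C s r k = g (fst (v ! s)) r k \<omega>" for s r k
  define D where "D s a b = word_entry d p g (drop (Suc s) v) a b \<omega>" for s a b
  define U where "U q a = word_entry d p g u q a \<omega>" for q a
  have "(\<Sum>a<d. \<Sum>q<d. \<Sum>k<p. cnj (g j q k \<omega>) * word_entry d p g u q a \<omega> * word_trace_deriv d p g (i, a, k) v \<omega>) =
      (\<Sum>a<d. \<Sum>q<d. \<Sum>k<p. \<Sum>b<d. \<Sum>s<length v. if snd (v ! s) = i
        then cnj (g j q k \<omega>) * U q a * (1 / of_nat d * (1 / of_nat d * (\<Sum>r<d. T s b r * C s r k) * D s a b)) else 0)"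
    unfolding word_trace_deriv_def word_entry_deriv_def prod.case sum_distrib_left T_def C_def D_def U_def
    by (intro sum.cong refl) (auto simp: sum_distrib_left)
  also have "\<dots> = (\<Sum>s<length v. \<Sum>a<d. \<Sum>q<d. \<Sum>k<p. \<Sum>b<d. if snd (v ! s) = i
        then cnj (g j q k \<omega>) * U q a * (1 / of_nat d * (1 / of_nat d * (\<Sum>r<d. T s b r * C s r k) * D s a b)) else 0)"
    unfolding sum.cartesian_product
    by (rule sum.reindex_bij_witness[of _ "\<lambda>(s, a, q, k, b). (a, q, k, b, s)" "\<lambda>(a, q, k, b, s). (s, a, q, k, b)"]) auto
  also have "\<dots> = (\<Sum>s<length v. if snd (v ! s) = i
      then word_trace d p g ((fst (v ! s), j) # u @ drop (Suc s) v @ take s v) \<omega> else 0)"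
  proof (intro sum.cong refl)
    fix s
    have "(\<Sum>a<d. \<Sum>q<d. \<Sum>k<p. \<Sum>b<d. cnj (g j q k \<omega>) * U q a * (1 / of_nat d * (1 / of_nat d * (\<Sum>r<d. T s b r * C s r k) * D s a b))) =
       (\<Sum>a<d. \<Sum>q<d. \<Sum>k<p. \<Sum>b<d. \<Sum>r<d. 1 / of_nat d * (1 / of_nat d * (C s r k * cnj (g j q k \<omega>) * (U q a * (D s a b * T s b r)))))"
      by (simp add: sum_distrib_left sum_distrib_right mult_ac)
    also have "\<dots> = (\<Sum>r<d. \<Sum>q<d. \<Sum>k<p. \<Sum>a<d. \<Sum>b<d. 1 / of_nat d * (1 / of_nat d * (C s r k * cnj (g j q k \<omega>) * (U q a * (D s a b * T s b r)))))"
      by (rule sum_permute5)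
    also have "\<dots> = word_trace d p g ((fst (v ! s), j) # u @ drop (Suc s) v @ take s v) \<omega>"
      unfolding word_trace_def word_entry.simps sum_distrib_left fst_conv snd_conv C_def[symmetric]
    proof (intro sum.cong refl)
      fix r q k assume "q \<in> {..<d}"
      then have "word_entry d p g (u @ drop (Suc s) v @ take s v) q r \<omega> = (\<Sum>a<d. U q a * (\<Sum>b<d. D s a b * T s b r))"
        by (simp add: word_entry_append U_def D_def T_def)
      then show "(\<Sum>a<d. \<Sum>b<d. 1 / of_nat d * (1 / of_nat d * (C s r k * cnj (g j q k \<omega>) * (U q a * (D s a b * T s b r))))) =
          1 / of_nat d * (1 / of_nat d * (C s r k * cnj (g j q k \<omega>) * word_entry d p g (u @ drop (Suc s) v @ take s v) q r \<omega>))"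
        by (simp add: sum_distrib_left)
    qed
    finally show "(\<Sum>a<d. \<Sum>q<d. \<Sum>k<p. \<Sum>b<d. if snd (v ! s) = i
        then cnj (g j q k \<omega>) * U q a * (1 / of_nat d * (1 / of_nat d * (\<Sum>r<d. T s b r * C s r k) * D s a b)) else 0) =
      (if snd (v ! s) = i then word_trace d p g ((fst (v ! s), j) # u @ drop (Suc s) v @ take s v) \<omega> else 0)"
      by simp
  qed
  finally show ?thesis .
qed

text \<open>The column index \<open>k\<close> is left free, which gives the factor \<open>p\<close>;
  the prefactor 1 / d^2 then turns the sum into p / d times a normalized trace.\<close>

lemma contraction_first:
  "(\<Sum>a<d. \<Sum>q<d. \<Sum>k<p. if j = i \<and> q = a then word_entry d p g u q a \<omega> else 0) =
    (if i = j then of_nat p * (\<Sum>a<d. word_entry d p g u a a \<omega>) else 0)"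
proof (cases "i = j")
  case True
  have "(\<Sum>a<d. \<Sum>q<d. \<Sum>k<p. if j = i \<and> q = a then word_entry d p g u q a \<omega> else 0) =
      (\<Sum>a<d. \<Sum>q<d. if q = a then of_nat p * word_entry d p g u a a \<omega> else 0)"
    using True by (intro sum.cong refl) auto
  also have "\<dots> = (\<Sum>a<d. of_nat p * word_entry d p g u a a \<omega>)"
    by (intro sum.cong refl) (simp add: sum.delta)
  finally show ?thesis using True by (simp add: sum_distrib_left)
qed auto

abbreviation "block_words \<equiv> lists ({1, 2 :: nat} \<times> {1, 2 :: nat})"

lemma block_words_take: "w \<in> block_words \<Longrightarrow> take s w \<in> block_words"
  and block_words_drop: "w \<in> block_words \<Longrightarrow> drop s w \<in> block_words"
  unfolding in_lists_conv_set by (meson in_set_takeD, meson in_set_dropD)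

lemma block_words_nth: "w \<in> block_words \<Longrightarrow> s < length w \<Longrightarrow> fst (w ! s) \<in> {1, 2}"
  unfolding in_lists_conv_set using nth_mem[of s w] by (metis mem_Times_iff)

section \<open>Integrability of traces and the loop equation\<close>

locale wishart_blocks = complex_gaussian_family M "{1, 2} \<times> {..<d} \<times> {..<p}" "\<lambda>(i, r, k). g i r k"
  for M :: "'a measure" and d p :: nat and g :: "'a gaussian_array"
begin

lemma gpoly_entry:
  assumes "w \<in> block_words" "a < d" "r < d" "k < p"
  shows "gpoly (i, r, k) (word_entry d p g w a b) (word_entry_deriv d p g (i, r, k) w a b)"
  using assms(1,2)
proof (induction w arbitrary: a)
  case Nil
  then show ?case
    using gpoly_const[of "(i, r, k)" "if a = b then 1 else 0"]
    by (simp add: word_entry_deriv_def[abs_def] word_entry.simps(1)[abs_def])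
next
  case (Cons x u)
  have x: "fst x \<in> {1, 2}" "snd x \<in> {1, 2}" using Cons by auto
  have G: "gpoly y (g j r k) (\<lambda>_. 0)"
    and G': "gpoly y (\<lambda>\<omega>. cnj (g j r k \<omega>)) (\<lambda>_. if (j, r, k) = y then 1 else 0)"
    if "j \<in> {1, 2}" "r < d" "k < p" for y j r k
    using gpoly_gauss[of "(j, r, k)" y] gpoly_gauss_cnj[of "(j, r, k)" y] that by auto
  have "gpoly (i, r, k) (\<lambda>\<omega>. 1 / of_nat d *
      (\<Sum>q<d. \<Sum>l<p. g (fst x) a l \<omega> * cnj (g (snd x) q l \<omega>) * word_entry d p g u q b \<omega>))
    (\<lambda>\<omega>. 1 / of_nat d * (\<Sum>q<d. \<Sum>l<p. (0 * cnj (g (snd x) q l \<omega>) +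
         g (fst x) a l \<omega> * (if (snd x, q, l) = (i, r, k) then 1 else 0)) * word_entry d p g u q b \<omega> +
       (g (fst x) a l \<omega> * cnj (g (snd x) q l \<omega>)) * word_entry_deriv d p g (i, r, k) u q b \<omega>))"
    using Cons x by (intro gpoly_scale gpoly_sum gpoly_mult G G') auto
  moreover have "word_entry d p g (x # u) a b = (\<lambda>\<omega>. 1 / of_nat d *
      (\<Sum>q<d. \<Sum>l<p. g (fst x) a l \<omega> * cnj (g (snd x) q l \<omega>) * word_entry d p g u q b \<omega>))"
    by (rule ext) simp
  moreover have "word_entry_deriv d p g (i, r, k) (x # u) a b =
      (\<lambda>\<omega>. 1 / of_nat d * (\<Sum>q<d. \<Sum>l<p. (0 * cnj (g (snd x) q l \<omega>) +
         g (fst x) a l \<omega> * (if (snd x, q, l) = (i, r, k) then 1 else 0)) * word_entry d p g u q b \<omega> +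
       (g (fst x) a l \<omega> * cnj (g (snd x) q l \<omega>)) * word_entry_deriv d p g (i, r, k) u q b \<omega>))"
    by (rule ext, rule word_entry_deriv_Cons) (use Cons.prems assms in auto)
  ultimately show ?case by simp
qed

lemma gpoly_trace:
  assumes "w \<in> block_words" "r < d" "k < p"
  shows "gpoly (i, r, k) (word_trace d p g w) (word_trace_deriv d p g (i, r, k) w)"
  unfolding word_trace_def[abs_def] word_trace_deriv_def[abs_def]
  by (intro gpoly_scale gpoly_sum gpoly_entry assms) auto

lemma gpoly_traces:
  assumes "ws \<in> lists block_words" "r < d" "k < p"
  shows "gpoly (i, r, k) (traces d p g ws) (traces_deriv d p g (i, r, k) ws)"
  using assms(1)
proof induction
  case Nil
  then show ?case
    using gpoly_const[of "(i, r, k)" 1] by (simp add: traces_deriv_def[abs_def] traces_def[abs_def])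
next
  case (Cons w ws)
  have "gpoly (i, r, k) (\<lambda>\<omega>. word_trace d p g w \<omega> * traces d p g ws \<omega>)
      (\<lambda>\<omega>. word_trace_deriv d p g (i, r, k) w \<omega> * traces d p g ws \<omega> +
        word_trace d p g w \<omega> * traces_deriv d p g (i, r, k) ws \<omega>)"
    using Cons by (intro gpoly_mult gpoly_trace assms) auto
  moreover have "traces d p g (w # ws) = (\<lambda>\<omega>. word_trace d p g w \<omega> * traces d p g ws \<omega>)"
    by (rule ext) simp
  moreover have "traces_deriv d p g (i, r, k) (w # ws) =
      (\<lambda>\<omega>. word_trace_deriv d p g (i, r, k) w \<omega> * traces d p g ws \<omega> +
        word_trace d p g w \<omega> * traces_deriv d p g (i, r, k) ws \<omega>)"
    by (rule ext)
       (simp add: traces_deriv_def sum.lessThan_Suc_shift sum_distrib_left mult_ac del: sum.lessThan_Suc)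
  ultimately show ?case by simp
qed

lemma gpoly_letter:
  assumes "j \<in> {1, 2}" "r < d" "k < p"
  shows "gpoly x (g j r k) (\<lambda>_. 0)" "\<exists>f'. gpoly x (\<lambda>\<omega>. cnj (g j r k \<omega>)) f'"
  using gpoly_gauss[of "(j, r, k)" x] gpoly_gauss_cnj[of "(j, r, k)" x] assms by auto

text \<open>Here \<open>x\<close> ranges over everything, so integrability can also be concluded
  when \<open>d\<close> or \<open>p\<close> is zero and there is no Gaussian index to differentiate
  in.\<close>

lemma entry_ex_gpoly:
  assumes "w \<in> block_words" "a < d"
  shows "\<exists>f'. gpoly x (word_entry d p g w a b) f'"
  using assms
proof (induction w arbitrary: a)
  case Nil
  then show ?case
    using gpoly_const[of x "if a = b then 1 else 0"] by (auto simp: word_entry.simps(1)[abs_def])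
next
  case (Cons y u)
  have y: "fst y \<in> {1, 2}" "snd y \<in> {1, 2}" using Cons by auto
  define U where "U q = (SOME f'. gpoly x (word_entry d p g u q b) f')" for q
  have U: "gpoly x (word_entry d p g u q b) (U q)" if "q < d" for q
    using someI_ex[OF Cons.IH[OF that]] by (simp only: U_def)
  define H where "H q l = (SOME f'. gpoly x (\<lambda>\<omega>. cnj (g (snd y) q l \<omega>)) f')" for q l
  have H: "gpoly x (\<lambda>\<omega>. cnj (g (snd y) q l \<omega>)) (H q l)" if "q < d" "l < p" for q l
    using someI_ex[OF gpoly_letter(2)[OF y(2) that]] by (simp only: H_def)
  have "gpoly x (\<lambda>\<omega>. 1 / of_nat d *
      (\<Sum>q<d. \<Sum>l<p. g (fst y) a l \<omega> * cnj (g (snd y) q l \<omega>) * word_entry d p g u q b \<omega>))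
    (\<lambda>\<omega>. 1 / of_nat d * (\<Sum>q<d. \<Sum>l<p. (0 * cnj (g (snd y) q l \<omega>) +
         g (fst y) a l \<omega> * H q l \<omega>) * word_entry d p g u q b \<omega> +
       (g (fst y) a l \<omega> * cnj (g (snd y) q l \<omega>)) * U q \<omega>))"
    using Cons.prems y by (intro gpoly_scale gpoly_sum gpoly_mult gpoly_letter(1) H U) auto
  then show ?case by (auto simp: word_entry.simps(2)[abs_def])
qed

lemma traces_integrable:
  assumes "ws \<in> lists block_words"
  shows "integrable M (traces d p g ws)"
proof -
  have t: "\<exists>f'. gpoly x (word_trace d p g w) f'" if w: "w \<in> block_words" for w x
  proof -
    define U where "U a = (SOME f'. gpoly x (word_entry d p g w a a) f')" for a
    have "gpoly x (word_entry d p g w a a) (U a)" if "a < d" for a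
      using someI_ex[OF entry_ex_gpoly[OF w that]] by (simp only: U_def)
    then have "gpoly x (\<lambda>\<omega>. 1 / of_nat d * (\<Sum>a<d. word_entry d p g w a a \<omega>))
        (\<lambda>\<omega>. 1 / of_nat d * (\<Sum>a<d. U a \<omega>))"
      by (intro gpoly_scale gpoly_sum) auto
    then show ?thesis unfolding word_trace_def[abs_def] by blast
  qed
  have "\<exists>f'. gpoly x (traces d p g ws) f'" for x
    using assms
  proof induction
    case Nil
    then show ?case using gpoly_const[of x 1] by (auto simp: traces_def[abs_def])
  next
    case (Cons w ws)
    then obtain f' h' where "gpoly x (word_trace d p g w) f'" "gpoly x (traces d p g ws) h'"
      using t by blast
    from gpoly_mult[OF this] show ?case by (auto simp: traces_def[abs_def])
  qed
  then show ?thesis using gpoly_integrable by blast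
qed

lemma word_trace_integrable: "w \<in> block_words \<Longrightarrow> integrable M (word_trace d p g w)"
  using traces_integrable[of "[w]"] by (simp add: traces_def[abs_def])

lemma integral_sum3:
  fixes f :: "nat \<Rightarrow> nat \<Rightarrow> nat \<Rightarrow> 'a \<Rightarrow> complex"
  assumes "\<And>a q k. a \<in> A \<Longrightarrow> q \<in> B \<Longrightarrow> k \<in> C \<Longrightarrow> integrable M (f a q k)"
  shows "(\<integral>\<omega>. (\<Sum>a\<in>A. \<Sum>q\<in>B. \<Sum>k\<in>C. f a q k \<omega>) \<partial>M) = (\<Sum>a\<in>A. \<Sum>q\<in>B. \<Sum>k\<in>C. \<integral>\<omega>. f a q k \<omega> \<partial>M)"
  using assms by (simp add: Bochner_Integration.integral_sum Bochner_Integration.integrable_sum)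

definition mixed_moment :: "(nat \<times> nat) list list \<Rightarrow> complex" where
  "mixed_moment ws = (\<integral>\<omega>. traces d p g ws \<omega> \<partial>M)"

lemma mixed_moment_empty:
  "0 < d \<Longrightarrow> mixed_moment ([] # ws) = mixed_moment ws" "mixed_moment [] = 1"
  by (simp_all add: mixed_moment_def word_trace_def prob_space)

text \<open>Integration by parts is applied to the leading Gaussian \<open>g i a k\<close> of the
  first word. Its conjugate can sit in the same factor, later in the same trace, or in another
  trace; these are the three lines.\<close>

theorem loop_equation:
  assumes "(i, j) # u \<in> block_words" "vs \<in> lists block_words"
  shows "mixed_moment (((i, j) # u) # vs) =
    (if i = j then of_nat p / of_nat d * mixed_moment (u # vs) else 0) +
    (\<Sum>s<length u. if snd (u ! s) = i
      then mixed_moment (((fst (u ! s), j) # take s u) # drop (Suc s) u # vs) else 0) +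
    1 / (of_nat d)\<^sup>2 * (\<Sum>t<length vs. \<Sum>s<length (vs ! t). if snd (vs ! t ! s) = i
      then mixed_moment (((fst (vs ! t ! s), j) # u @ drop (Suc s) (vs ! t) @ take s (vs ! t)) #
             take t vs @ drop (Suc t) vs) else 0)"
proof -
  let ?E = "\<lambda>w q a \<omega>. word_entry d p g w q a \<omega>" and ?R = "traces d p g vs"
  have ij: "i \<in> {1, 2}" "j \<in> {1, 2}" and u: "u \<in> block_words" using assms(1) by auto
  \<comment> \<open>\<open>f\<close> is what remains of the product once the leading Gaussian is
    removed, \<open>f'\<close> its derivative in the conjugate of that Gaussian.\<close>
  define f where "f q k a = (\<lambda>\<omega>. cnj (g j q k \<omega>) * ?E u q a \<omega> * ?R \<omega>)" for q k a
  define f' where "f' q k a = (\<lambda>\<omega>.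
      ((if (j, q, k) = (i, a, k) then 1 else 0) * ?E u q a \<omega> +
        cnj (g j q k \<omega>) * word_entry_deriv d p g (i, a, k) u q a \<omega>) * ?R \<omega> +
      cnj (g j q k \<omega>) * ?E u q a \<omega> * traces_deriv d p g (i, a, k) vs \<omega>)" for q k a
  have ff': "gpoly (i, a, k) (f q k a) (f' q k a)" if "a < d" "q < d" "k < p" for q k a
  proof -
    have "gpoly (i, a, k) (\<lambda>\<omega>. cnj (g j q k \<omega>)) (\<lambda>_. if (j, q, k) = (i, a, k) then 1 else 0)"
      using gpoly_gauss_cnj[of "(j, q, k)" "(i, a, k)"] ij that by auto
    then show ?thesis
      unfolding f_def f'_def using that u assms(2)
      by (intro gpoly_mult gpoly_entry gpoly_traces)
  qed
  have st: "integrable M (\<lambda>\<omega>. g i a k \<omega> * f q k a \<omega>)" "integrable M (f' q k a)"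
    "(\<integral>\<omega>. g i a k \<omega> * f q k a \<omega> \<partial>M) = (\<integral>\<omega>. f' q k a \<omega> \<partial>M)" if "a < d" "q < d" "k < p" for q k a
    using gpoly_stein[OF ff'[OF that]] ij that by auto
  have lhs: "traces d p g (((i, j) # u) # vs) \<omega> =
      1 / (of_nat d)\<^sup>2 * (\<Sum>a<d. \<Sum>q<d. \<Sum>k<p. g i a k \<omega> * f q k a \<omega>)" for \<omega>
    by (simp add: word_trace_def f_def sum_distrib_left sum_distrib_right power2_eq_square mult_ac)
  have "mixed_moment (((i, j) # u) # vs) =
      1 / (of_nat d)\<^sup>2 * (\<Sum>a<d. \<Sum>q<d. \<Sum>k<p. \<integral>\<omega>. g i a k \<omega> * f q k a \<omega> \<partial>M)"
    unfolding mixed_moment_def lhs integral_mult_right_zero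
    by (subst integral_sum3) (auto intro: st(1))
  also have "\<dots> = 1 / (of_nat d)\<^sup>2 * (\<Sum>a<d. \<Sum>q<d. \<Sum>k<p. \<integral>\<omega>. f' q k a \<omega> \<partial>M)"
    using st(3) by simp
  also have "\<dots> = (\<integral>\<omega>. 1 / (of_nat d)\<^sup>2 * (\<Sum>a<d. \<Sum>q<d. \<Sum>k<p. f' q k a \<omega>) \<partial>M)"
    unfolding integral_mult_right_zero by (subst integral_sum3) (auto intro: st(2))
  also have "(\<lambda>\<omega>. 1 / (of_nat d)\<^sup>2 * (\<Sum>a<d. \<Sum>q<d. \<Sum>k<p. f' q k a \<omega>)) =
    (\<lambda>\<omega>. (if i = j then of_nat p / of_nat d * traces d p g (u # vs) \<omega> else 0) +
    (\<Sum>s<length u. if snd (u ! s) = i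
      then traces d p g (((fst (u ! s), j) # take s u) # drop (Suc s) u # vs) \<omega> else 0) +
    1 / (of_nat d)\<^sup>2 * (\<Sum>t<length vs. \<Sum>s<length (vs ! t). if snd (vs ! t ! s) = i
      then traces d p g (((fst (vs ! t ! s), j) # u @ drop (Suc s) (vs ! t) @ take s (vs ! t)) #
             take t vs @ drop (Suc t) vs) \<omega> else 0))" (is "_ = (\<lambda>\<omega>. ?A \<omega> + ?B \<omega> + ?C \<omega>)")
  proof
    fix \<omega>
    have "(\<Sum>a<d. \<Sum>q<d. \<Sum>k<p. f' q k a \<omega>) =
        (\<Sum>a<d. \<Sum>q<d. \<Sum>k<p. if j = i \<and> q = a then ?E u q a \<omega> else 0) * ?R \<omega> +
        (\<Sum>a<d. \<Sum>q<d. \<Sum>k<p. cnj (g j q k \<omega>) * word_entry_deriv d p g (i, a, k) u q a \<omega>) * ?R \<omega> +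
        (\<Sum>a<d. \<Sum>q<d. \<Sum>k<p. cnj (g j q k \<omega>) * ?E u q a \<omega> * traces_deriv d p g (i, a, k) vs \<omega>)"
      unfolding sum_distrib_right sum.distrib[symmetric]
      by (intro sum.cong refl) (auto simp: f'_def algebra_simps)
    moreover have "1 / (of_nat d)\<^sup>2 * ((\<Sum>a<d. \<Sum>q<d. \<Sum>k<p. if j = i \<and> q = a then ?E u q a \<omega> else 0) * ?R \<omega>) = ?A \<omega>"
      unfolding contraction_first by (simp add: word_trace_def power2_eq_square)
    moreover have "1 / (of_nat d)\<^sup>2 *
        ((\<Sum>a<d. \<Sum>q<d. \<Sum>k<p. cnj (g j q k \<omega>) * word_entry_deriv d p g (i, a, k) u q a \<omega>) * ?R \<omega>) = ?B \<omega>"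
      by (subst mult.assoc[symmetric], subst contraction_split, subst sum_distrib_right, intro sum.cong refl)
         (simp add: mult.assoc)
    moreover have "(\<Sum>a<d. \<Sum>q<d. \<Sum>k<p. cnj (g j q k \<omega>) * ?E u q a \<omega> * traces_deriv d p g (i, a, k) vs \<omega>) =
        (\<Sum>t<length vs. \<Sum>s<length (vs ! t). if snd (vs ! t ! s) = i
      then traces d p g (((fst (vs ! t ! s), j) # u @ drop (Suc s) (vs ! t) @ take s (vs ! t)) #
             take t vs @ drop (Suc t) vs) \<omega> else 0)"
    proof -
      have "(\<Sum>a<d. \<Sum>q<d. \<Sum>k<p. cnj (g j q k \<omega>) * ?E u q a \<omega> * traces_deriv d p g (i, a, k) vs \<omega>) =
          (\<Sum>a<d. \<Sum>q<d. \<Sum>k<p. \<Sum>t<length vs. cnj (g j q k \<omega>) * ?E u q a \<omega> *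
             word_trace_deriv d p g (i, a, k) (vs ! t) \<omega> * traces d p g (take t vs @ drop (Suc t) vs) \<omega>)"
        by (simp only: traces_deriv_def sum_distrib_left mult.assoc)
      also have "\<dots> = (\<Sum>t<length vs. \<Sum>a<d. \<Sum>q<d. \<Sum>k<p. cnj (g j q k \<omega>) * ?E u q a \<omega> *
             word_trace_deriv d p g (i, a, k) (vs ! t) \<omega> * traces d p g (take t vs @ drop (Suc t) vs) \<omega>)"
        unfolding sum.cartesian_product
        by (rule sum.reindex_bij_witness[of _ "\<lambda>(s, a, q, k). (a, q, k, s)" "\<lambda>(a, q, k, s). (s, a, q, k)"]) auto
      also have "\<dots> = (\<Sum>t<length vs. (\<Sum>a<d. \<Sum>q<d. \<Sum>k<p. cnj (g j q k \<omega>) * ?E u q a \<omega> *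
             word_trace_deriv d p g (i, a, k) (vs ! t) \<omega>) * traces d p g (take t vs @ drop (Suc t) vs) \<omega>)"
        by (simp only: sum_distrib_right)
      finally show ?thesis
        unfolding contraction_merge sum_distrib_right by (auto intro!: sum.cong)
    qed
    ultimately show "1 / (of_nat d)\<^sup>2 * (\<Sum>a<d. \<Sum>q<d. \<Sum>k<p. f' q k a \<omega>) = ?A \<omega> + ?B \<omega> + ?C \<omega>"
      by (simp only: distrib_left)
  qed
  also have "(\<integral>\<omega>. ?A \<omega> + ?B \<omega> + ?C \<omega> \<partial>M) =
    (if i = j then of_nat p / of_nat d * mixed_moment (u # vs) else 0) +
    (\<Sum>s<length u. if snd (u ! s) = i
      then mixed_moment (((fst (u ! s), j) # take s u) # drop (Suc s) u # vs) else 0) +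
    1 / (of_nat d)\<^sup>2 * (\<Sum>t<length vs. \<Sum>s<length (vs ! t). if snd (vs ! t ! s) = i
      then mixed_moment (((fst (vs ! t ! s), j) # u @ drop (Suc s) (vs ! t) @ take s (vs ! t)) #
             take t vs @ drop (Suc t) vs) else 0)"
  proof -
    note sub = block_words_take block_words_drop and fst = block_words_nth
    have iA: "integrable M (traces d p g (u # vs))"
      using u assms(2) by (intro traces_integrable) auto
    have iB: "integrable M (traces d p g (((fst (u ! s), j) # take s u) # drop (Suc s) u # vs))"
      if "s < length u" for s
      using u assms(2) ij fst[OF u that] sub[OF u] by (intro traces_integrable) auto
    have iC: "integrable M (traces d p g (((fst (vs ! t ! s), j) # u @ drop (Suc s) (vs ! t) @ take s (vs ! t)) #
             take t vs @ drop (Suc t) vs))" if "t < length vs" "s < length (vs ! t)" for t s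
    proof -
      have v: "vs ! t \<in> block_words" using assms(2) nth_mem[OF that(1)] by (auto simp: in_lists_conv_set)
      have "take t vs @ drop (Suc t) vs \<in> lists block_words"
        using assms(2) by (auto simp: in_lists_conv_set dest: in_set_takeD in_set_dropD)
      then show ?thesis
        using u ij fst[OF v that(2)] sub[OF v] by (intro traces_integrable) auto
    qed
    have if_int: "integrable M (\<lambda>\<omega>. if P then h \<omega> else 0)" if "P \<Longrightarrow> integrable M h" for P and h :: "'a \<Rightarrow> complex"
      using that by (cases P) auto
    have int_if: "(\<integral>\<omega>. (if P then h \<omega> else 0) \<partial>M) = (if P then \<integral>\<omega>. h \<omega> \<partial>M else 0)" for P and h :: "'a \<Rightarrow> complex"
      by (cases P) auto
    have A: "integrable M ?A" by (intro if_int integrable_mult_right iA)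
    have B: "integrable M ?B"
      by (intro Bochner_Integration.integrable_sum if_int iB) (simp only: lessThan_iff)
    let ?h = "\<lambda>t s \<omega>. if snd (vs ! t ! s) = i
      then traces d p g (((fst (vs ! t ! s), j) # u @ drop (Suc s) (vs ! t) @ take s (vs ! t)) #
             take t vs @ drop (Suc t) vs) \<omega> else 0"
    have C': "integrable M (\<lambda>\<omega>. \<Sum>s<length (vs ! t). ?h t s \<omega>)" if "t < length vs" for t
      by (intro Bochner_Integration.integrable_sum if_int iC that) (simp only: lessThan_iff)
    have C: "integrable M ?C"
      by (intro Bochner_Integration.integrable_sum integrable_mult_right C') (simp only: lessThan_iff)
    have IB: "(\<integral>\<omega>. ?B \<omega> \<partial>M) = (\<Sum>s<length u. if snd (u ! s) = i
      then mixed_moment (((fst (u ! s), j) # take s u) # drop (Suc s) u # vs) else 0)"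
      unfolding mixed_moment_def int_if[symmetric]
      by (intro Bochner_Integration.integral_sum if_int iB) (simp only: lessThan_iff)
    have "(\<integral>\<omega>. (\<Sum>t<length vs. \<Sum>s<length (vs ! t). ?h t s \<omega>) \<partial>M) =
        (\<Sum>t<length vs. \<integral>\<omega>. (\<Sum>s<length (vs ! t). ?h t s \<omega>) \<partial>M)"
      by (intro Bochner_Integration.integral_sum C') (simp only: lessThan_iff)
    also have "\<dots> = (\<Sum>t<length vs. \<Sum>s<length (vs ! t). \<integral>\<omega>. ?h t s \<omega> \<partial>M)"
      by (intro sum.cong refl Bochner_Integration.integral_sum if_int iC) (simp_all only: lessThan_iff)
    finally have IC: "(\<integral>\<omega>. ?C \<omega> \<partial>M) = 1 / (of_nat d)\<^sup>2 * (\<Sum>t<length vs. \<Sum>s<length (vs ! t). if snd (vs ! t ! s) = i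
      then mixed_moment (((fst (vs ! t ! s), j) # u @ drop (Suc s) (vs ! t) @ take s (vs ! t)) #
             take t vs @ drop (Suc t) vs) else 0)"
      unfolding mixed_moment_def int_if integral_mult_right_zero by (simp only:)
    have IA: "(\<integral>\<omega>. ?A \<omega> \<partial>M) = (if i = j then of_nat p / of_nat d * mixed_moment (u # vs) else 0)"
      unfolding mixed_moment_def int_if integral_mult_right_zero ..
    show ?thesis
      using A B C by (simp only: Bochner_Integration.integral_add Bochner_Integration.integrable_add IA IB IC)
  qed
  finally show ?thesis .
qed

end

subsection \<open>Convergence of mixed moments\<close>

text \<open>Every term of the loop equation has one factor less, but a split creates an additional
  trace. Counting factors twice and traces once makes all terms, and also the removal of an empty
  trace, decrease.\<close>

definition weight :: "(nat \<times> nat) list list \<Rightarrow> nat" where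
  "weight ws = (\<Sum>w\<leftarrow>ws. 2 * length w + 1)"

lemma weight_simps [simp]:
  "weight [] = 0" "weight (w # ws) = 2 * length w + 1 + weight ws" "weight (ws @ vs) = weight ws + weight vs"
  by (simp_all add: weight_def)

text \<open>The merging terms carry 1 / d^2 and disappear in the limit; the other terms keep the
  remaining traces as a common factor, so the limit is multiplicative.\<close>

theorem mixed_moment_limit:
  fixes M :: "nat \<Rightarrow> 'a measure" and d p :: "nat \<Rightarrow> nat" and g :: "nat \<Rightarrow> 'a gaussian_array"
  assumes blocks: "\<And>n. wishart_blocks (M n) (d n) (p n) (g n)"
    and d: "filterlim d at_top sequentially"
    and ratio: "(\<lambda>n. of_nat (p n) / of_nat (d n) :: complex) \<longlonglongrightarrow> c"
    and ws: "ws \<in> lists block_words"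
  shows "(\<lambda>n. wishart_blocks.mixed_moment (M n) (d n) (p n) (g n) ws) \<longlonglongrightarrow> (\<Prod>w\<leftarrow>ws. limit_trace c w)"
  using ws
proof (induction "weight ws" arbitrary: ws rule: less_induct)
  case less
  let ?m = "\<lambda>ws n. wishart_blocks.mixed_moment (M n) (d n) (p n) (g n) ws"
  have d0: "eventually (\<lambda>n. 0 < d n) sequentially"
    using d[unfolded filterlim_at_top, rule_format, of 1] by (rule eventually_mono) simp
  show ?case
  proof (cases ws)
    case Nil
    then show ?thesis using wishart_blocks.mixed_moment_empty(2)[OF blocks] by simp
  next
    case (Cons w vs)
    have vs: "vs \<in> lists block_words" and w: "w \<in> block_words" using less.prems Cons by auto
    show ?thesis
    proof (cases w)
      case Nil
      have "?m vs \<longlonglongrightarrow> (\<Prod>w\<leftarrow>vs. limit_trace c w)"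
        using less.hyps[of vs] vs Cons Nil by simp
      \<comment> \<open>An empty word has trace 1 only when \<open>d n\<close> is positive, which
        holds from some point on.\<close>
      moreover have "eventually (\<lambda>n. ?m vs n = ?m ws n) sequentially"
        using d0 by eventually_elim (simp add: Cons Nil wishart_blocks.mixed_moment_empty(1)[OF blocks])
      ultimately show ?thesis using tendsto_cong by (fastforce simp: Cons Nil)
    next
      case w': (Cons x u)
      obtain i j where x: "x = (i, j)" by force
      have ij: "i \<in> {1, 2}" "j \<in> {1, 2}" and u: "u \<in> block_words" using w w' x by auto
      note sub = block_words_take block_words_drop and fst = block_words_nth
      have eq: "?m ws n = (if i = j then of_nat (p n) / of_nat (d n) * ?m (u # vs) n else 0) +
        (\<Sum>s<length u. if snd (u ! s) = i
          then ?m (((fst (u ! s), j) # take s u) # drop (Suc s) u # vs) n else 0) +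
        1 / (of_nat (d n))\<^sup>2 * (\<Sum>t<length vs. \<Sum>s<length (vs ! t). if snd (vs ! t ! s) = i
          then ?m (((fst (vs ! t ! s), j) # u @ drop (Suc s) (vs ! t) @ take s (vs ! t)) #
                 take t vs @ drop (Suc t) vs) n else 0)" for n
        unfolding Cons w' x by (rule wishart_blocks.loop_equation[OF blocks]) (use w w' x vs in auto)
      have lim_if: "(\<lambda>n. if P then h n else 0) \<longlonglongrightarrow> (if P then l else 0)"
        if "P \<Longrightarrow> h \<longlonglongrightarrow> l" for P and h :: "nat \<Rightarrow> complex" and l
        using that by (cases P) auto
      have L1: "?m (u # vs) \<longlonglongrightarrow> (\<Prod>w\<leftarrow>u # vs. limit_trace c w)"
        using less.hyps[of "u # vs"] u vs Cons w' by simp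
      have L2: "?m (((fst (u ! s), j) # take s u) # drop (Suc s) u # vs) \<longlonglongrightarrow>
          (\<Prod>w\<leftarrow>((fst (u ! s), j) # take s u) # drop (Suc s) u # vs. limit_trace c w)" if s: "s < length u" for s
        by (rule less.hyps) (use u vs ij fst[OF u s] sub[OF u] s Cons w' in auto)
      define L3 where "L3 t s = (\<Prod>w\<leftarrow>((fst (vs ! t ! s), j) # u @ drop (Suc s) (vs ! t) @ take s (vs ! t)) #
             take t vs @ drop (Suc t) vs. limit_trace c w)" for t s
      have L3: "?m (((fst (vs ! t ! s), j) # u @ drop (Suc s) (vs ! t) @ take s (vs ! t)) #
             take t vs @ drop (Suc t) vs) \<longlonglongrightarrow> L3 t s" if t: "t < length vs" and s: "s < length (vs ! t)" for t s
        unfolding L3_def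
      proof (rule less.hyps)
        have v: "vs ! t \<in> block_words" using vs nth_mem[OF t] by (auto simp: in_lists_conv_set)
        have "take t vs @ drop (Suc t) vs \<in> lists block_words"
          using vs by (auto simp: in_lists_conv_set dest: in_set_takeD in_set_dropD)
        then show "((fst (vs ! t ! s), j) # u @ drop (Suc s) (vs ! t) @ take s (vs ! t)) #
             take t vs @ drop (Suc t) vs \<in> lists block_words"
          using u ij fst[OF v s] sub[OF v] by auto
        have "weight vs = weight (take t vs) + (2 * length (vs ! t) + 1 + weight (drop (Suc t) vs))"
          by (subst id_take_nth_drop[OF t]) (simp del: append_take_drop_id)
        then show "weight (((fst (vs ! t ! s), j) # u @ drop (Suc s) (vs ! t) @ take s (vs ! t)) #
             take t vs @ drop (Suc t) vs) < weight ws"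
          using s by (simp add: Cons w')
      qed
      have "(\<lambda>n. 1 / real (d n)) \<longlonglongrightarrow> 0"
        using tendsto_divide_0[OF tendsto_const filterlim_at_top_imp_at_infinity[OF
            filterlim_compose[OF filterlim_real_sequentially d]]] by simp
      then have "(\<lambda>n. complex_of_real (1 / real (d n))) \<longlonglongrightarrow> complex_of_real 0"
        by (rule tendsto_of_real)
      from tendsto_power[OF this, of 2] have Z: "(\<lambda>n. 1 / (of_nat (d n))\<^sup>2 :: complex) \<longlonglongrightarrow> 0"
        by (simp add: power_divide)
      \<comment> \<open>The merged moments converge by induction and are therefore removed by their
        vanishing prefactor.\<close>
      have "?m ws \<longlonglongrightarrow> (if i = j then c * (\<Prod>w\<leftarrow>u # vs. limit_trace c w) else 0) +
        (\<Sum>s<length u. if snd (u ! s) = i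
          then (\<Prod>w\<leftarrow>((fst (u ! s), j) # take s u) # drop (Suc s) u # vs. limit_trace c w) else 0) +
        0 * (\<Sum>t<length vs. \<Sum>s<length (vs ! t). if snd (vs ! t ! s) = i then L3 t s else 0)"
        unfolding eq by (intro tendsto_add tendsto_mult tendsto_sum lim_if ratio Z L1 L2 L3)
          (simp_all only: lessThan_iff)
      also have "(if i = j then c * (\<Prod>w\<leftarrow>u # vs. limit_trace c w) else 0) +
        (\<Sum>s<length u. if snd (u ! s) = i
          then (\<Prod>w\<leftarrow>((fst (u ! s), j) # take s u) # drop (Suc s) u # vs. limit_trace c w) else 0) +
        0 * (\<Sum>t<length vs. \<Sum>s<length (vs ! t). if snd (vs ! t ! s) = i then L3 t s else 0) =
          (\<Prod>w\<leftarrow>ws. limit_trace c w)"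
      proof -
        let ?P = "\<Prod>w\<leftarrow>vs. limit_trace c w"
        have "(if i = j then c * (\<Prod>w\<leftarrow>u # vs. limit_trace c w) else 0) =
            (if i = j then c * limit_trace c u else 0) * ?P" by simp
        moreover have "(\<Sum>s<length u. if snd (u ! s) = i
            then (\<Prod>w\<leftarrow>((fst (u ! s), j) # take s u) # drop (Suc s) u # vs. limit_trace c w) else 0) =
          (\<Sum>s<length u. if snd (u ! s) = i
            then limit_trace c ((fst (u ! s), j) # take s u) * limit_trace c (drop (Suc s) u) else 0) * ?P"
          by (subst sum_distrib_right, intro sum.cong refl) simp
        ultimately show ?thesis
          by (simp only: Cons w' x list.map prod_list.Cons limit_trace.simps(2)[of c "(i, j)" u] fst_conv snd_conv
              distrib_right mult_zero_left add_0_right)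
      qed
      finally show ?thesis .
    qed
  qed
qed

section \<open>Freeness in a *-probability space\<close>

context star_algebra
begin

text \<open>This and the following lemmas restate the module laws for plain complex scalars, without
  \<open>class_ring\<close>.\<close>

lemma sm_closed: "x \<in> carrier A \<Longrightarrow> z \<odot> x \<in> carrier A"
  using smult_closed[of z x] by (simp add: class_ring_simps)

lemma sm_add_l: "x \<in> carrier A \<Longrightarrow> (z + z') \<odot> x = z \<odot> x \<oplus> z' \<odot> x"
  using smult_l_distr[of z z' x] by (simp add: class_ring_simps)

lemma sm_add_r: "x \<in> carrier A \<Longrightarrow> y \<in> carrier A \<Longrightarrow> z \<odot> (x \<oplus> y) = z \<odot> x \<oplus> z \<odot> y"
  using smult_r_distr[of z x y] by (simp add: class_ring_simps)

lemma sm_assoc: "x \<in> carrier A \<Longrightarrow> (z * z') \<odot> x = z \<odot> (z' \<odot> x)"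
  using smult_assoc1[of z z' x] by (simp add: class_ring_simps)

lemma sm_one: "x \<in> carrier A \<Longrightarrow> 1 \<odot> x = x"
  using smult_one[of x] by (simp add: class_ring_simps)

lemma sm_zero_l: "x \<in> carrier A \<Longrightarrow> 0 \<odot> x = \<zero>"
  using smult_l_null[of x] by (simp add: class_ring_simps)

lemma sm_zero_r: "z \<odot> \<zero> = \<zero>"
  using smult_r_null[of z] by (simp add: class_ring_simps)

definition word_product :: "('l \<Rightarrow> 'b) \<Rightarrow> 'l list \<Rightarrow> 'b" where
  "word_product X w = foldr (\<lambda>l y. X l \<otimes> y) w \<one>"

lemma word_product_simps [simp]:
  "word_product X [] = \<one>" "word_product X (l # w) = X l \<otimes> word_product X w"
  by (simp_all add: word_product_def)

lemma word_product_closed: "(\<And>l. X l \<in> carrier A) \<Longrightarrow> word_product X w \<in> carrier A"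
  by (induction w) auto

lemma word_product_append:
  "(\<And>l. X l \<in> carrier A) \<Longrightarrow> word_product X (u @ w) = word_product X u \<otimes> word_product X w"
  by (induction u) (auto simp: word_product_closed m_assoc)

lemma word_product_replicate:
  "(\<And>l. X l \<in> carrier A) \<Longrightarrow> word_product X (replicate n l) = X l [^] n"
proof (induction n)
  case (Suc n)
  show ?case
    using nat_pow_Suc2[OF Suc.prems, of l n] by (simp only: replicate_Suc word_product_simps Suc.IH[OF Suc.prems])
qed simp

inductive_set linear_span :: "'b set \<Rightarrow> 'b set" for S where
  span_zero: "\<zero> \<in> linear_span S"
| span_base: "x \<in> S \<Longrightarrow> x \<in> linear_span S"
| span_add: "x \<in> linear_span S \<Longrightarrow> y \<in> linear_span S \<Longrightarrow> x \<oplus> y \<in> linear_span S"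
| span_smult: "x \<in> linear_span S \<Longrightarrow> z \<odot> x \<in> linear_span S"

lemma linear_span_closed:
  assumes "S \<subseteq> carrier A" "x \<in> linear_span S"
  shows "x \<in> carrier A"
  using assms(2) by (induction rule: linear_span.induct) (use assms(1) in \<open>auto simp: sm_closed\<close>)

lemma linear_span_powers_mult:
  assumes x: "x \<in> carrier A" and y: "y \<in> linear_span (range (\<lambda>n::nat. x [^] n))"
    and z: "z \<in> linear_span (range (\<lambda>n::nat. x [^] n))"
  shows "y \<otimes> z \<in> linear_span (range (\<lambda>n::nat. x [^] n))"
proof -
  let ?P = "range (\<lambda>n::nat. x [^] n)"
  have P: "?P \<subseteq> carrier A" using x by auto
  note c = linear_span_closed[OF P]
  have 1: "x [^] m \<otimes> z \<in> linear_span ?P" for m :: nat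
    using z
  proof (induction rule: linear_span.induct)
    case (span_base v)
    then obtain n :: nat where "v = x [^] n" by blast
    then have "x [^] m \<otimes> v = x [^] (m + n)" using x by (simp add: nat_pow_mult)
    then show ?case by (auto intro: linear_span.span_base)
  next
    case (span_add v w)
    then show ?case using x c by (auto simp: r_distr intro!: linear_span.span_add)
  next
    case (span_smult v s)
    then show ?case using x c by (auto simp: smult_mult_right intro!: linear_span.span_smult)
  qed (use x in \<open>auto intro: linear_span.span_zero\<close>)
  show ?thesis
    using y
  proof (induction rule: linear_span.induct)
    case (span_add v w)
    then show ?case using c z by (auto simp: l_distr intro!: linear_span.span_add)
  next
    case (span_smult v s)
    then show ?case using c z by (auto simp: smult_mult_left intro!: linear_span.span_smult)
  qed (use 1 c z in \<open>auto intro: linear_span.span_zero\<close>)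
qed

lemma unital_subalgebra_powers:
  assumes x: "x \<in> carrier A" and y: "y \<in> unital_subalgebra A {x}"
  shows "y \<in> linear_span (range (\<lambda>n::nat. x [^] n))"
  using y
proof (induction rule: unital_subalgebra.induct)
  case (gen y)
  then have "y = x [^] (1::nat)" using x by simp
  then show ?case by (blast intro: span_base)
next
  case one
  have "\<one> = x [^] (0::nat)" by simp
  then show ?case by (blast intro: span_base)
qed (auto intro: span_add span_smult linear_span_powers_mult[OF x])

end

context star_prob_space
begin

lemma state_zero: "\<phi> \<zero> = 0"
  using state_smult[of "\<zero>" 0] by (simp add: sm_zero_r)

definition centring :: "'b \<Rightarrow> 'b" where
  "centring x = x \<oplus> (- \<phi> x) \<odot> \<one>"

lemma centring_closed: "x \<in> carrier A \<Longrightarrow> centring x \<in> carrier A"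
  by (simp add: centring_def sm_closed)

lemma centring_add:
  assumes "x \<in> carrier A" "y \<in> carrier A"
  shows "centring (x \<oplus> y) = centring x \<oplus> centring y"
proof -
  have "- \<phi> (x \<oplus> y) = - \<phi> x + - \<phi> y" using assms by (simp add: state_add)
  then have "centring (x \<oplus> y) = x \<oplus> y \<oplus> ((- \<phi> x) \<odot> \<one> \<oplus> (- \<phi> y) \<odot> \<one>)"
    unfolding centring_def by (simp only: sm_add_l[OF one_closed])
  then show ?thesis using assms by (simp add: centring_def sm_closed a_ac)
qed

lemma centring_smult:
  assumes "x \<in> carrier A"
  shows "centring (z \<odot> x) = z \<odot> centring x"
proof -
  have "- \<phi> (z \<odot> x) = z * (- \<phi> x)" using assms by (simp add: state_smult)
  then have "centring (z \<odot> x) = z \<odot> x \<oplus> z \<odot> ((- \<phi> x) \<odot> \<one>)"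
    unfolding centring_def by (simp only: sm_assoc[OF one_closed])
  then show ?thesis using assms by (simp add: centring_def sm_closed sm_add_r)
qed

lemma centring_zero: "centring \<zero> = \<zero>"
  by (simp add: centring_def state_zero sm_zero_l)

lemma centring_centred: "x \<in> carrier A \<Longrightarrow> \<phi> x = 0 \<Longrightarrow> centring x = x"
  by (simp add: centring_def sm_zero_l)

lemma centring_linear_span:
  assumes "S \<subseteq> carrier A" "x \<in> linear_span S"
  shows "centring x \<in> linear_span (centring ` S)"
  using assms(2)
proof (induction rule: linear_span.induct)
  case (span_add x y)
  then show ?case using linear_span_closed[OF assms(1)] by (auto simp: centring_add intro: linear_span.span_add)
next
  case (span_smult x z)
  then show ?case using linear_span_closed[OF assms(1)] by (auto simp: centring_smult intro: linear_span.span_smult)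
qed (auto simp: centring_zero intro: linear_span.span_zero linear_span.span_base)

definition centred_product :: "('l \<Rightarrow> 'b) \<Rightarrow> ('l \<times> nat) list \<Rightarrow> 'b" where
  "centred_product X r = foldr (\<lambda>(l, n) y. centring (X l [^] n) \<otimes> y) r \<one>"

lemma centred_product_simps [simp]:
  "centred_product X [] = \<one>"
  "centred_product X ((l, n) # r) = centring (X l [^] n) \<otimes> centred_product X r"
  by (simp_all add: centred_product_def)

lemma centred_product_closed: "(\<And>l. X l \<in> carrier A) \<Longrightarrow> centred_product X r \<in> carrier A"
  by (induction r) (auto simp: centring_closed)

lemma centred_product_append:
  "(\<And>l. X l \<in> carrier A) \<Longrightarrow> centred_product X (r @ r') = centred_product X r \<otimes> centred_product X r'"
  by (induction r) (auto simp: centred_product_closed centring_closed m_assoc)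

text \<open>Links the combinatorial functional \<open>centred\<close> to the state. The uncentred
  prefix \<open>u\<close> collects the factors that have been expanded already.\<close>

lemma state_centred_product:
  fixes X :: "'l \<Rightarrow> 'b"
  assumes X: "\<And>l. X l \<in> carrier A"
  shows "\<phi> (word_product X u \<otimes> centred_product X r) =
    centred (\<lambda>l n. \<phi> (word_product X (replicate n l))) r (\<lambda>w. \<phi> (word_product X (u @ w)))"
proof (induction r arbitrary: u)
  case Nil
  then show ?case by (simp add: word_product_closed X)
next
  case (Cons ln r)
  obtain l n where ln: "ln = (l, n)" by force
  let ?u = "word_product X u" and ?x = "X l [^] n" and ?R = "centred_product X r"
  have c: "?u \<in> carrier A" "?x \<in> carrier A" "?R \<in> carrier A"
    using X by (auto simp: word_product_closed centred_product_closed)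
  have "?u \<otimes> (centring ?x \<otimes> ?R) = (?u \<otimes> ?x) \<otimes> ?R \<oplus> (- \<phi> ?x) \<odot> (?u \<otimes> ?R)"
    using c by (simp add: centring_def l_distr r_distr m_assoc sm_closed smult_mult_left smult_mult_right)
  also have "?u \<otimes> ?x = word_product X (u @ replicate n l)"
    by (simp add: word_product_append word_product_replicate X)
  finally have "\<phi> (?u \<otimes> (centring ?x \<otimes> ?R)) =
      \<phi> (word_product X (u @ replicate n l) \<otimes> ?R) + (- \<phi> ?x) * \<phi> (?u \<otimes> ?R)"
    using c by (simp add: state_add state_smult sm_closed word_product_closed X)
  then show ?case
    by (simp add: ln Cons.IH word_product_replicate X)
qed

text \<open>By linearity the factors are replaced from left to right by centred powers, which are
  collected in \<open>r\<close>; once \<open>ys\<close> is used up, \<open>free_moment_free\<close>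
  applies. The exponents 0 in the first part of \<open>alt\<close> are placeholders: it only says
  that \<open>r\<close> and \<open>ys\<close> are not both empty.\<close>

lemma state_alternating_product:
  fixes X :: "'l \<Rightarrow> 'b"
  assumes X: "\<And>l. X l \<in> carrier A" and mom: "\<And>w. \<phi> (word_product X w) = free_moment \<kappa> w"
    and ys: "\<forall>(l, y)\<in>set ys. y \<in> linear_span (range (\<lambda>n::nat. centring (X l [^] n)))"
    and alt: "r @ map (\<lambda>y. (fst y, 0)) ys \<noteq> []" "distinct_adj (map fst r @ map fst ys)"
  shows "\<phi> (centred_product X r \<otimes> foldr (\<otimes>) (map snd ys) \<one>) = 0"
  using ys alt
proof (induction ys arbitrary: r)
  case Nil
  have "\<phi> (centred_product X r) = centred (\<lambda>l n. free_moment \<kappa> (replicate n l)) r (free_moment \<kappa>)"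
    using state_centred_product[OF X, where u = "[]" and r = r] by (simp add: mom centred_product_closed X)
  also have "\<dots> = 0" using Nil by (intro free_moment_free) auto
  finally show ?case by (simp add: centred_product_closed X)
next
  case (Cons ly ys)
  obtain l y where ly: "ly = (l, y)" by force
  let ?R = "foldr (\<otimes>) (map snd ys) \<one>" and ?C = "centred_product X r"
  let ?S = "\<lambda>l. range (\<lambda>n::nat. centring (X l [^] n))"
  have S: "?S l \<subseteq> carrier A" for l using X by (auto simp: centring_closed)
  note lc = linear_span_closed[OF S]
  have ysc: "\<forall>y\<in>set (map snd ys). y \<in> carrier A" using Cons.prems(1) lc by fastforce
  have R: "?R \<in> carrier A" using ysc by (induction ys) auto
  have C: "?C \<in> carrier A" by (rule centred_product_closed[OF X])
  have "y \<in> linear_span (?S l)" using Cons.prems(1) ly by auto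
  then have "\<phi> (?C \<otimes> (y \<otimes> ?R)) = 0"
  proof (induction rule: linear_span.induct)
    case span_zero
    then show ?case using C R by (simp add: state_zero)
  next
    case (span_base y)
    then obtain n :: nat where n: "y = centring (X l [^] n)" by auto
    then have "?C \<otimes> (y \<otimes> ?R) = centred_product X (r @ [(l, n)]) \<otimes> ?R"
      using C R X by (simp add: centred_product_append m_assoc centring_closed)
    then show ?case
      using Cons.IH[of "r @ [(l, n)]"] Cons.prems by (simp add: ly)
  next
    case (span_add y z)
    then show ?case using C R lc by (simp add: l_distr r_distr state_add)
  next
    case (span_smult y s)
    then show ?case using C R lc by (simp add: smult_mult_left smult_mult_right state_smult)
  qed
  then show ?case by (simp add: ly)
qed

text \<open>An element of the algebra generated by \<open>X l\<close> is a combination of powers.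
  Centring is linear and fixes an element of state zero, which is thus a combination of centred
  powers.\<close>

theorem free_elements_of_free_moments:
  fixes X :: "bool \<Rightarrow> 'b"
  assumes X: "\<And>l. X l \<in> carrier A" and mom: "\<And>w. \<phi> (word_product X w) = free_moment \<kappa> w"
  shows "free_elements A \<phi> {1, 2 :: nat} (\<lambda>i. if i = 1 then X False else X True)"
  unfolding free_elements_def
proof (intro allI impI; elim conjE)
  fix ys :: "(nat \<times> 'b) list"
  let ?x = "\<lambda>i::nat. if i = 1 then X False else X True"
  assume ne: "ys \<noteq> []" and alt: "distinct_adj (map fst ys)"
    and ys: "\<forall>(i, y)\<in>set ys. i \<in> {1, 2} \<and> y \<in> unital_subalgebra A {?x i} \<and> \<phi> y = 0"
  \<comment> \<open>The indices 1 and 2 become the letters \<open>False\<close> and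
    \<open>True\<close>.\<close>
  define zs where "zs = map (\<lambda>(i, y). (i \<noteq> 1, y)) ys"
  have fst: "map fst zs = map (\<lambda>i. i \<noteq> 1) (map fst ys)" and snd: "map snd zs = map snd ys"
    by (simp_all add: zs_def case_prod_beta comp_def)
  have i12: "i \<in> {1, 2}" if i: "i \<in> set (map fst ys)" for i
  proof -
    obtain y where "(i, y) \<in> set ys" using i by auto
    then show ?thesis using ys by blast
  qed
  have "distinct_adj (map fst zs)"
    unfolding fst
  proof (rule distinct_adj_mapI[OF alt], rule inj_onI)
    fix i k assume "i \<in> set (map fst ys)" "k \<in> set (map fst ys)" and eq: "(i \<noteq> 1) = (k \<noteq> 1)"
    then have "i \<in> {1, 2}" "k \<in> {1, 2}" using i12 by blast+
    then show "i = k" using eq by auto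
  qed
  moreover have "\<forall>(l, y)\<in>set zs. y \<in> linear_span (range (\<lambda>n::nat. centring (X l [^] n)))"
  proof (clarify)
    fix l y assume "(l, y) \<in> set zs"
    then obtain i where i: "(i, y) \<in> set ys" "l = (i \<noteq> 1)" by (auto simp: zs_def)
    have x: "?x i = X l" using i(2) by simp
    have "y \<in> unital_subalgebra A {?x i}" and y0: "\<phi> y = 0" using ys i(1) by blast+
    then have "y \<in> unital_subalgebra A {X l}" by (simp only: x)
    then have y: "y \<in> linear_span (range (\<lambda>n::nat. X l [^] n))" using unital_subalgebra_powers[OF X] by blast
    have P: "range (\<lambda>n::nat. X l [^] n) \<subseteq> carrier A" using X by auto
    have "y = centring y" using centring_centred[OF linear_span_closed[OF P y] y0] by simp
    also have "\<dots> \<in> linear_span (centring ` range (\<lambda>n::nat. X l [^] n))" by (rule centring_linear_span[OF P y])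
    finally show "y \<in> linear_span (range (\<lambda>n::nat. centring (X l [^] n)))" by (simp add: image_image)
  qed
  moreover have "zs \<noteq> []" using ne by (simp add: zs_def)
  moreover have "foldr (\<otimes>) (map snd zs) \<one> \<in> carrier A"
  proof -
    have "y \<in> carrier A" if y: "y \<in> set (map snd zs)" for y
    proof -
      obtain i where "(i, y) \<in> set ys" using y unfolding snd by auto
      then have y: "y \<in> unital_subalgebra A {?x i}" using ys by blast
      have "?x i \<in> carrier A" using X by simp
      then show ?thesis
        using linear_span_closed[of "range (\<lambda>n::nat. ?x i [^] n)"] unital_subalgebra_powers[OF _ y] by blast
    qed
    then show ?thesis by (induction zs) auto
  qed
  ultimately show "\<phi> (foldr (\<otimes>) (map snd ys) \<one>) = 0"
    using state_alternating_product[OF X mom, of zs "[]"] unfolding snd by simp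
qed

end

section \<open>Transfer of moments between *-algebras\<close>

text \<open>A relation avoids the question whether the polynomial is determined by the element:
  relations that hold in one algebra may fail in the other. Only the values of the states have to
  agree.\<close>

inductive same_poly ::
    "'b star_algebra \<Rightarrow> ('i \<Rightarrow> 'b) \<Rightarrow> 'c star_algebra \<Rightarrow> ('i \<Rightarrow> 'c) \<Rightarrow> 'i set \<Rightarrow> 'b \<Rightarrow> 'c \<Rightarrow> bool"
  for A a B b I where
  word: "ls \<in> lists (I \<times> UNIV) \<Longrightarrow> same_poly A a B b I (star_word A a ls) (star_word B b ls)"
| add: "same_poly A a B b I x y \<Longrightarrow> same_poly A a B b I x' y' \<Longrightarrow>
    same_poly A a B b I (x \<oplus>\<^bsub>A\<^esub> x') (y \<oplus>\<^bsub>B\<^esub> y')"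
| smult: "same_poly A a B b I x y \<Longrightarrow> same_poly A a B b I (z \<odot>\<^bsub>A\<^esub> x) (z \<odot>\<^bsub>B\<^esub> y)"

lemma (in star_algebra) star_word_closed:
  "(\<And>i. i \<in> I \<Longrightarrow> a i \<in> carrier A) \<Longrightarrow> ls \<in> lists (I \<times> UNIV) \<Longrightarrow> star_word A a ls \<in> carrier A"
  by (induction ls) (auto simp: star_word_def adj_closed)

lemma (in star_algebra) star_word_append:
  assumes a: "\<And>i. i \<in> I \<Longrightarrow> a i \<in> carrier A" and ls: "ls \<in> lists (I \<times> UNIV)" "ls' \<in> lists (I \<times> UNIV)"
  shows "star_word A a (ls @ ls') = star_word A a ls \<otimes> star_word A a ls'"
  using ls(1)
proof (induction ls)
  case Nil
  then show ?case using star_word_closed[OF a ls(2)] by (simp add: star_word_def)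
next
  case (Cons l ls)
  obtain i s where l: "l = (i, s)" by force
  have i: "a i \<in> carrier A" using a Cons.hyps l by auto
  have c: "star_word A a ls \<in> carrier A" "star_word A a ls' \<in> carrier A"
    using Cons.hyps ls(2) by (auto intro!: star_word_closed[OF a])
  have S: "star_word A a (l # u) = (if s then adj A (a i) else a i) \<otimes> star_word A a u" for u
    by (simp add: star_word_def l)
  show ?case
    using Cons.IH i c by (simp add: S adj_closed m_assoc)
qed

locale star_algebra_pair = A: star_algebra A + B: star_algebra B
  for A :: "'b star_algebra" and B :: "'c star_algebra" +
  fixes a :: "'i \<Rightarrow> 'b" and b :: "'i \<Rightarrow> 'c" and I :: "'i set"
  assumes aI: "i \<in> I \<Longrightarrow> a i \<in> carrier A" and bI: "i \<in> I \<Longrightarrow> b i \<in> carrier B"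
begin

abbreviation "same \<equiv> same_poly A a B b I"

lemma same_closed: "same x y \<Longrightarrow> x \<in> carrier A \<and> y \<in> carrier B"
  by (induction rule: same_poly.induct)
     (auto simp: A.sm_closed B.sm_closed intro: A.star_word_closed[OF aI] B.star_word_closed[OF bI])

lemma same_one: "same \<one>\<^bsub>A\<^esub> \<one>\<^bsub>B\<^esub>"
  using same_poly.word[of "[]" I A a B b] by (simp add: star_word_def)

lemma same_zero: "same \<zero>\<^bsub>A\<^esub> \<zero>\<^bsub>B\<^esub>"
  using same_poly.smult[OF same_one, of 0] by (simp add: A.sm_zero_l B.sm_zero_l)

lemma same_letter: "i \<in> I \<Longrightarrow> same (a i) (b i)"
  using same_poly.word[of "[(i, False)]" I A a B b] aI bI by (simp add: star_word_def)

lemma same_mult: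
  assumes "same x y" "same x' y'"
  shows "same (x \<otimes>\<^bsub>A\<^esub> x') (y \<otimes>\<^bsub>B\<^esub> y')"
  using assms(1)
proof induction
  case w: (word ls)
  show ?case
    using assms(2)
  proof induction
    case (word ls')
    then show ?case
      using same_poly.word[of "ls @ ls'" I A a B b] w
      by (simp add: A.star_word_append[OF aI] B.star_word_append[OF bI])
  next
    case (add x y x' y')
    then show ?case
      using same_poly.add[OF add.IH] same_closed same_closed[OF same_poly.word[OF w]]
      by (simp add: A.r_distr B.r_distr)
  next
    case (smult x y z)
    then show ?case
      using same_poly.smult[OF smult.IH] same_closed same_closed[OF same_poly.word[OF w]]
      by (simp add: A.smult_mult_right B.smult_mult_right)
  qed
next
  case (add x y x2 y2)
  then show ?case
    using same_poly.add[OF add.IH] same_closed same_closed[OF assms(2)]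
    by (simp add: A.l_distr B.l_distr)
next
  case (smult x y z)
  then show ?case
    using same_poly.smult[OF smult.IH] same_closed same_closed[OF assms(2)]
    by (simp add: A.smult_mult_left B.smult_mult_left)
qed

lemma same_word_product:
  "(\<And>l. same (X l) (Y l)) \<Longrightarrow> same (A.word_product X w) (B.word_product Y w)"
  by (induction w) (auto intro: same_one same_mult)

text \<open>States are linear, so agreement on starred words extends along the construction of the
  pair.\<close>

lemma same_state:
  assumes "star_prob_space A \<phi>" "star_prob_space B \<psi>"
    and "\<And>ls. ls \<in> lists (I \<times> UNIV) \<Longrightarrow> \<phi> (star_word A a ls) = \<psi> (star_word B b ls)"
    and "same x y"
  shows "\<phi> x = \<psi> y"
proof -
  interpret PA: star_prob_space A \<phi> by fact
  interpret PB: star_prob_space B \<psi> by fact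
  show ?thesis using assms(4)
    by induction (use assms(3) same_closed in \<open>auto simp: PA.state_add PB.state_add PA.state_smult PB.state_smult\<close>)
qed

end

section \<open>Block elements\<close>

context star_algebra
begin

lemma block_element_expand:
  assumes "\<And>i j. i \<in> {1, 2} \<Longrightarrow> j \<in> {1, 2} \<Longrightarrow> e i j \<in> carrier A"
    and "\<And>i j. i \<in> {1, 2} \<Longrightarrow> j \<in> {1, 2} \<Longrightarrow> b i j \<in> carrier A"
  shows "block_element A e b =
    (e 1 1 \<otimes> b 1 1 \<otimes> e 1 1 \<oplus> e 1 1 \<otimes> b 1 2 \<otimes> e 1 2) \<oplus>
    (e 2 1 \<otimes> b 2 1 \<otimes> e 1 1 \<oplus> e 2 1 \<otimes> b 2 2 \<otimes> e 1 2)"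
proof -
  have two: "(\<Oplus>i\<in>{1, 2::nat}. f i) = f 1 \<oplus> f 2" if "f 1 \<in> carrier A" "f 2 \<in> carrier A" for f
    using that by (subst finsum_insert) auto
  show ?thesis
    unfolding block_element_def using assms by (subst two) (auto simp: two)
qed

lemma adj_zero: "adj A \<zero> = \<zero>"
  using adj_smult[OF one_closed, of 0] by (simp add: sm_zero_l adj_closed)

lemma block_element_closed:
  assumes "\<And>i j. i \<in> {1, 2} \<Longrightarrow> j \<in> {1, 2} \<Longrightarrow> e i j \<in> carrier A"
    and "\<And>i j. i \<in> {1, 2} \<Longrightarrow> j \<in> {1, 2} \<Longrightarrow> b i j \<in> carrier A"
  shows "block_element A e b \<in> carrier A"
  using assms by (subst block_element_expand) auto

lemma block_element_adj:
  assumes e: "\<And>i j. i \<in> {1, 2} \<Longrightarrow> j \<in> {1, 2} \<Longrightarrow> e i j \<in> carrier A"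
    "\<And>i j. i \<in> {1, 2} \<Longrightarrow> j \<in> {1, 2} \<Longrightarrow> adj A (e i j) = e j i"
    and b: "\<And>i j. i \<in> {1, 2} \<Longrightarrow> j \<in> {1, 2} \<Longrightarrow> b i j \<in> carrier A"
    "\<And>i j. i \<in> {1, 2} \<Longrightarrow> j \<in> {1, 2} \<Longrightarrow> adj A (b i j) = b j i"
  shows "adj A (block_element A e b) = block_element A e b"
proof -
  define T where "T i j = e i 1 \<otimes> b i j \<otimes> e 1 j" for i j
  have T: "T i j \<in> carrier A" "adj A (T i j) = T j i" if "i \<in> {1, 2}" "j \<in> {1, 2}" for i j
  proof -
    have c: "e i 1 \<in> carrier A" "b i j \<in> carrier A" "e 1 j \<in> carrier A" "e j 1 \<in> carrier A"
      "b j i \<in> carrier A" "e 1 i \<in> carrier A"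
      using that by (auto intro: e b)
    have a: "adj A (e i 1) = e 1 i" "adj A (e 1 j) = e j 1" "adj A (b i j) = b j i"
      using that by (auto intro: e b)
    show "T i j \<in> carrier A" using c by (simp add: T_def)
    show "adj A (T i j) = T j i" using c by (simp add: T_def adj_mult a m_assoc del: One_nat_def)
  qed
  have X: "block_element A e b = (T 1 1 \<oplus> T 1 2) \<oplus> (T 2 1 \<oplus> T 2 2)"
    unfolding T_def by (rule block_element_expand[OF e(1) b(1)])
  have cT: "T 1 1 \<in> carrier A" "T 1 2 \<in> carrier A" "T 2 1 \<in> carrier A" "T 2 2 \<in> carrier A"
    by (auto intro: T)
  have "adj A (block_element A e b) = (T 1 1 \<oplus> T 2 1) \<oplus> (T 1 2 \<oplus> T 2 2)"
    unfolding X using cT by (simp add: adj_add T(2))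
  then show ?thesis unfolding X using cT by (simp add: a_ac)
qed

lemma block_entry_closed:
  assumes "\<And>i j. i \<in> {1, 2} \<Longrightarrow> j \<in> {1, 2} \<Longrightarrow> e i j \<in> carrier A" "x \<in> carrier A"
    and "i \<in> {1, 2}" "j \<in> {1, 2}"
  shows "block_entry A e x i j \<in> carrier A"
  using assms unfolding block_entry_def by auto

lemma block_entry_adj:
  assumes e: "\<And>i j. i \<in> {1, 2} \<Longrightarrow> j \<in> {1, 2} \<Longrightarrow> e i j \<in> carrier A"
    "\<And>i j. i \<in> {1, 2} \<Longrightarrow> j \<in> {1, 2} \<Longrightarrow> adj A (e i j) = e j i"
    and x: "x \<in> carrier A" "adj A x = x" and ij: "i \<in> {1, 2}" "j \<in> {1, 2}"
  shows "adj A (block_entry A e x i j) = block_entry A e x j i"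
proof -
  have c: "e 1 i \<in> carrier A" "e j 1 \<in> carrier A" "e 1 j \<in> carrier A" "e i 1 \<in> carrier A"
    using ij by (auto intro: e)
  have a: "adj A (e 1 i) = e i 1" "adj A (e j 1) = e 1 j" using ij by (auto intro: e)
  show ?thesis using c x by (simp add: block_entry_def adj_mult a m_assoc del: One_nat_def)
qed

end

context star_algebra_pair
begin

lemma same_block_element:
  assumes "\<And>i j. i \<in> {1, 2} \<Longrightarrow> j \<in> {1, 2} \<Longrightarrow> same (e i j) (e' i j)"
    and "\<And>i j. i \<in> {1, 2} \<Longrightarrow> j \<in> {1, 2} \<Longrightarrow> same (x i j) (x' i j)"
  shows "same (block_element A e x) (block_element B e' x')"
proof -
  have cl: "e i j \<in> carrier A" "e' i j \<in> carrier B" "x i j \<in> carrier A" "x' i j \<in> carrier B"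
    if "i \<in> {1, 2}" "j \<in> {1, 2}" for i j
    using same_closed[OF assms(1)[OF that]] same_closed[OF assms(2)[OF that]] by simp_all
  have A: "block_element A e x =
    (e 1 1 \<otimes>\<^bsub>A\<^esub> x 1 1 \<otimes>\<^bsub>A\<^esub> e 1 1 \<oplus>\<^bsub>A\<^esub> e 1 1 \<otimes>\<^bsub>A\<^esub> x 1 2 \<otimes>\<^bsub>A\<^esub> e 1 2) \<oplus>\<^bsub>A\<^esub>
    (e 2 1 \<otimes>\<^bsub>A\<^esub> x 2 1 \<otimes>\<^bsub>A\<^esub> e 1 1 \<oplus>\<^bsub>A\<^esub> e 2 1 \<otimes>\<^bsub>A\<^esub> x 2 2 \<otimes>\<^bsub>A\<^esub> e 1 2)"
    by (rule A.block_element_expand[OF cl(1,3)])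
  have B: "block_element B e' x' =
    (e' 1 1 \<otimes>\<^bsub>B\<^esub> x' 1 1 \<otimes>\<^bsub>B\<^esub> e' 1 1 \<oplus>\<^bsub>B\<^esub> e' 1 1 \<otimes>\<^bsub>B\<^esub> x' 1 2 \<otimes>\<^bsub>B\<^esub> e' 1 2) \<oplus>\<^bsub>B\<^esub>
    (e' 2 1 \<otimes>\<^bsub>B\<^esub> x' 2 1 \<otimes>\<^bsub>B\<^esub> e' 1 1 \<oplus>\<^bsub>B\<^esub> e' 2 1 \<otimes>\<^bsub>B\<^esub> x' 2 2 \<otimes>\<^bsub>B\<^esub> e' 1 2)"
    by (rule B.block_element_expand[OF cl(2,4)])
  show ?thesis unfolding A B
    by (intro same_poly.add same_mult assms) auto
qed

end

section \<open>The algebra of sequences of Wishart matrices\<close>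

lemma mat_adjoint_index:
  fixes B :: "complex mat"
  shows "mat_adjoint B = Matrix.mat (dim_col B) (dim_row B) (\<lambda>(i, j). cnj (B $$ (j, i)))"
  by (rule eq_matI) (auto simp: mat_adjoint_def mat_of_rows_def conjugate_complex_def)

lemma mat_adjoint_add:
  "B \<in> carrier_mat n n \<Longrightarrow> C \<in> carrier_mat n n \<Longrightarrow> mat_adjoint (B + C) = mat_adjoint B + mat_adjoint C"
  for B C :: "complex mat"
  by (rule eq_matI) (auto simp: mat_adjoint_index)

lemma mat_adjoint_smult: "mat_adjoint (z \<cdot>\<^sub>m B) = cnj z \<cdot>\<^sub>m mat_adjoint B" for B :: "complex mat"
  by (rule eq_matI) (auto simp: mat_adjoint_index)

lemma mat_adjoint_mult:
  "B \<in> carrier_mat n n \<Longrightarrow> C \<in> carrier_mat n n \<Longrightarrow> mat_adjoint (B * C) = mat_adjoint C * mat_adjoint B"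
  for B C :: "complex mat"
  by (rule eq_matI) (auto simp: mat_adjoint_index scalar_prod_def mult.commute)

lemma mat_adjoint_adjoint: "mat_adjoint (mat_adjoint B) = B" for B :: "complex mat"
  by (rule eq_matI) (auto simp: mat_adjoint_index)

section \<open>Words placed in a single block, and their span\<close>

definition word_mat :: "nat \<Rightarrow> nat \<Rightarrow> 'a gaussian_array \<Rightarrow> (nat \<times> nat) list \<Rightarrow> 'a \<Rightarrow> complex mat" where
  "word_mat d p g w \<omega> = Matrix.mat d d (\<lambda>(a, b). word_entry d p g w a b \<omega>)"

definition word_block ::
    "nat \<Rightarrow> nat \<Rightarrow> 'a gaussian_array \<Rightarrow> nat \<Rightarrow> nat \<Rightarrow> (nat \<times> nat) list \<Rightarrow> 'a \<Rightarrow> complex mat" where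
  "word_block d p g i j w \<omega> =
     block_mat2 (\<lambda>k l. if k = i \<and> l = j then word_mat d p g w \<omega> else 0\<^sub>m d d)"

lemma word_mat_carrier [simp]: "word_mat d p g w \<omega> \<in> carrier_mat d d"
  by (simp add: word_mat_def)

lemma word_block_carrier [simp]: "word_block d p g i j w \<omega> \<in> carrier_mat (2 * d) (2 * d)"
  by (simp add: word_block_def block_mat2_def mult_2)

lemma block_mat2_mult:
  assumes "\<And>i j. i \<in> {1, 2} \<Longrightarrow> j \<in> {1, 2} \<Longrightarrow> B i j \<in> carrier_mat d d"
    and "\<And>i j. i \<in> {1, 2} \<Longrightarrow> j \<in> {1, 2} \<Longrightarrow> C i j \<in> carrier_mat d d"
  shows "block_mat2 B * block_mat2 C = block_mat2 (\<lambda>i j. B i 1 * C 1 j + B i 2 * C 2 j)"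
  unfolding block_mat2_def
  by (rule mult_four_block_mat[of _ d d _ d _ d _ _ d _ d]) (simp_all add: assms)

lemma word_mat_mult: "word_mat d p g u \<omega> * word_mat d p g v \<omega> = word_mat d p g (u @ v) \<omega>"
  by (rule eq_matI)
     (auto simp: word_mat_def scalar_prod_def word_entry_append atLeast0LessThan intro!: sum.cong)

lemma word_block_mult:
  assumes "i \<in> {1, 2}" "j \<in> {1, 2}" "k \<in> {1, 2}" "l \<in> {1, 2}"
  shows "word_block d p g i j u \<omega> * word_block d p g k l v \<omega> =
    (if j = k then word_block d p g i l (u @ v) \<omega> else 0\<^sub>m (2 * d) (2 * d))"
proof -
  have z: "0\<^sub>m (2 * d) (2 * d) = block_mat2 (\<lambda>_ _. 0\<^sub>m d d :: complex mat)"
    by (rule eq_matI) (auto simp: block_mat2_def)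
  have "word_block d p g i j u \<omega> * word_block d p g k l v \<omega> = block_mat2 (\<lambda>r s.
      (if r = i \<and> 1 = j then word_mat d p g u \<omega> else 0\<^sub>m d d) * (if 1 = k \<and> s = l then word_mat d p g v \<omega> else 0\<^sub>m d d) +
      (if r = i \<and> 2 = j then word_mat d p g u \<omega> else 0\<^sub>m d d) * (if 2 = k \<and> s = l then word_mat d p g v \<omega> else 0\<^sub>m d d))"
    unfolding word_block_def by (subst block_mat2_mult) auto
  also have "\<dots> = block_mat2 (\<lambda>r s. if j = k \<and> r = i \<and> s = l then word_mat d p g (u @ v) \<omega> else 0\<^sub>m d d)"
  proof -
    have "(if r = i \<and> 1 = j then word_mat d p g u \<omega> else 0\<^sub>m d d) * (if 1 = k \<and> s = l then word_mat d p g v \<omega> else 0\<^sub>m d d) +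
      (if r = i \<and> 2 = j then word_mat d p g u \<omega> else 0\<^sub>m d d) * (if 2 = k \<and> s = l then word_mat d p g v \<omega> else 0\<^sub>m d d) =
      (if j = k \<and> r = i \<and> s = l then word_mat d p g (u @ v) \<omega> else 0\<^sub>m d d)" for r s
    proof -
      have c: "word_mat d p g w \<omega> \<in> carrier_mat d d" for w by simp
      have "word_mat d p g w \<omega> * 0\<^sub>m d d = 0\<^sub>m d d" "0\<^sub>m d d * word_mat d p g w \<omega> = 0\<^sub>m d d"
        "0\<^sub>m d d + word_mat d p g w \<omega> = word_mat d p g w \<omega>"
        "word_mat d p g w \<omega> + 0\<^sub>m d d = word_mat d p g w \<omega>" for w
        by (rule right_mult_zero_mat[OF c], rule left_mult_zero_mat[OF c],
            rule left_add_zero_mat[OF c], rule right_add_zero_mat[OF c])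
      then show ?thesis using assms by (auto simp: word_mat_mult)
    qed
    then show ?thesis by simp
  qed
  finally show ?thesis by (auto simp: word_block_def z)
qed

lemma word_entry_single:
  assumes "b < d"
  shows "word_entry d p g [x] a b \<omega> = 1 / of_nat d * (\<Sum>k<p. g (fst x) a k \<omega> * cnj (g (snd x) b k \<omega>))"
proof -
  have "(\<Sum>q<d. \<Sum>k<p. g (fst x) a k \<omega> * cnj (g (snd x) q k \<omega>) * (if q = b then 1 else 0)) =
      (\<Sum>q<d. if q = b then \<Sum>k<p. g (fst x) a k \<omega> * cnj (g (snd x) b k \<omega>) else 0)"
    by (intro sum.cong refl) auto
  then show ?thesis using assms by (simp only: word_entry.simps) simp
qed

lemma word_mat_single:
  "word_mat d p g [(i, j)] \<omega> = wishart_block d p g i j \<omega>"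
  by (rule eq_matI)
     (auto simp: word_mat_def wishart_block_def gaussian_matrix_def mat_adjoint_index scalar_prod_def
        atLeast0LessThan word_entry_single simp del: word_entry.simps)

lemma word_mat_Nil: "word_mat d p g [] \<omega> = 1\<^sub>m d"
  by (rule eq_matI) (auto simp: word_mat_def)

text \<open>The adjoint of W(i,j) is W(j,i), and adjoints reverse products.\<close>

lemma word_entry_adjoint:
  "a < d \<Longrightarrow> b < d \<Longrightarrow>
    cnj (word_entry d p g w a b \<omega>) = word_entry d p g (rev (map prod.swap w)) b a \<omega>"
proof (induction w arbitrary: a)
  case (Cons x w)
  have "word_entry d p g (rev (map prod.swap (x # w))) b a \<omega> =
      (\<Sum>q<d. cnj (word_entry d p g w q b \<omega>) * word_entry d p g [prod.swap x] q a \<omega>)"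
    using Cons by (simp add: word_entry_append del: word_entry.simps)
  also have "\<dots> = (\<Sum>q<d. cnj (word_entry d p g w q b \<omega>) *
      (1 / of_nat d * (\<Sum>k<p. g (snd x) q k \<omega> * cnj (g (fst x) a k \<omega>))))"
    using Cons.prems by (simp only: word_entry_single fst_swap snd_swap)
  finally show ?case
    by (simp add: sum_distrib_left sum_distrib_right mult_ac)
qed auto

lemma word_block_index:
  assumes "i \<in> {1, 2}" "j \<in> {1, 2}" "a < d + d" "b < d + d"
  shows "word_block d p g i j w \<omega> $$ (a, b) = (if (a < d \<longleftrightarrow> i = 1) \<and> (b < d \<longleftrightarrow> j = 1)
    then word_entry d p g w (if a < d then a else a - d) (if b < d then b else b - d) \<omega> else 0)"
proof -
  have "a - d < d" "b - d < d" if "d \<noteq> 0" using assms that by auto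
  moreover have "i = 1 \<or> i = 2" "j = 1 \<or> j = 2" using assms by auto
  ultimately show ?thesis using assms(3,4)
    by (elim disjE) (simp_all add: word_block_def block_mat2_def word_mat_def)
qed

lemma word_block_adjoint:
  assumes "i \<in> {1, 2}" "j \<in> {1, 2}"
  shows "mat_adjoint (word_block d p g i j w \<omega>) = word_block d p g j i (rev (map prod.swap w)) \<omega>"
proof (rule eq_matI)
  fix a b assume "a < dim_row (word_block d p g j i (rev (map prod.swap w)) \<omega>)"
    "b < dim_col (word_block d p g j i (rev (map prod.swap w)) \<omega>)"
  then have ab: "a < d + d" "b < d + d"
    by (simp_all add: carrier_matD[OF word_block_carrier])
  have "mat_adjoint (word_block d p g i j w \<omega>) $$ (a, b) = cnj (word_block d p g i j w \<omega> $$ (b, a))"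
    using ab by (simp add: mat_adjoint_index carrier_matD[OF word_block_carrier])
  also have "\<dots> = word_block d p g j i (rev (map prod.swap w)) \<omega> $$ (a, b)"
  proof -
    have "(if a < d then a else a - d) < d" "(if b < d then b else b - d) < d" using ab by auto
    then show ?thesis
      unfolding word_block_index[OF assms ab(2,1)] word_block_index[OF assms(2,1) ab] if_distrib[of cnj]
      by (simp only: word_entry_adjoint complex_cnj_zero conj_commute)
  qed
  finally show "mat_adjoint (word_block d p g i j w \<omega>) $$ (a, b) =
      word_block d p g j i (rev (map prod.swap w)) \<omega> $$ (a, b)" .
qed (simp_all add: mat_adjoint_index carrier_matD[OF word_block_carrier])

lemma normalized_trace_word_block:
  assumes "i \<in> {1, 2}" "j \<in> {1, 2}"
  shows "normalized_trace (2 * d) (word_block d p g i j w \<omega>) = (if i = j then word_trace d p g w \<omega> / 2 else 0)"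
proof -
  have eq: "{..<2 * d} = {..<d} \<union> (+) d ` {..<d}"
  proof (intro equalityI subsetI)
    fix x assume "x \<in> {..<2 * d}"
    then show "x \<in> {..<d} \<union> (+) d ` {..<d}"
      by (cases "x < d") (auto intro!: image_eqI[of _ _ "x - d"])
  qed auto
  have "(\<Sum>a<2 * d. word_block d p g i j w \<omega> $$ (a, a)) =
      (\<Sum>a<d. word_block d p g i j w \<omega> $$ (a, a)) + (\<Sum>a<d. word_block d p g i j w \<omega> $$ (d + a, d + a))"
    unfolding eq by (subst sum.union_disjoint) (auto simp: sum.reindex)
  also have "\<dots> = (\<Sum>a<d. if i = 1 \<and> j = 1 then word_entry d p g w a a \<omega> else 0) +
      (\<Sum>a<d. if i \<noteq> 1 \<and> j \<noteq> 1 then word_entry d p g w a a \<omega> else 0)"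
    by (intro arg_cong2[where f = "(+)"] sum.cong refl; subst word_block_index[OF assms]) auto
  also have "\<dots> = (if i = j then \<Sum>a<d. word_entry d p g w a a \<omega> else 0)"
    using assms by auto
  finally show ?thesis
    by (simp add: normalized_trace_def word_trace_def)
qed

text \<open>An element is a whole sequence of random matrices, with coefficients independent of
  \<open>n\<close> and of the random point. That is what lets the convergence of expected traces
  extend from single blocks to the span.\<close>

inductive_set block_span :: "(nat \<Rightarrow> nat) \<Rightarrow> (nat \<Rightarrow> nat) \<Rightarrow> (nat \<Rightarrow> 'a gaussian_array) \<Rightarrow>
    (nat \<Rightarrow> 'a \<Rightarrow> complex mat) set" for d p g where
  block: "i \<in> {1, 2} \<Longrightarrow> j \<in> {1, 2} \<Longrightarrow> w \<in> block_words \<Longrightarrow>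
    (\<lambda>n. word_block (d n) (p n) (g n) i j w) \<in> block_span d p g"
| add: "x \<in> block_span d p g \<Longrightarrow> y \<in> block_span d p g \<Longrightarrow> (\<lambda>n \<omega>. x n \<omega> + y n \<omega>) \<in> block_span d p g"
| smult: "x \<in> block_span d p g \<Longrightarrow> (\<lambda>n \<omega>. z \<cdot>\<^sub>m x n \<omega>) \<in> block_span d p g"

definition block_algebra :: "(nat \<Rightarrow> nat) \<Rightarrow> (nat \<Rightarrow> nat) \<Rightarrow> (nat \<Rightarrow> 'a gaussian_array) \<Rightarrow>
    (nat \<Rightarrow> 'a \<Rightarrow> complex mat) star_algebra" where
  "block_algebra d p g = \<lparr>carrier = block_span d p g, mult = (\<lambda>x y n \<omega>. x n \<omega> * y n \<omega>),
     one = (\<lambda>n \<omega>. 1\<^sub>m (2 * d n)), zero = (\<lambda>n \<omega>. 0\<^sub>m (2 * d n) (2 * d n)),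
     add = (\<lambda>x y n \<omega>. x n \<omega> + y n \<omega>), smult = (\<lambda>z x n \<omega>. z \<cdot>\<^sub>m x n \<omega>),
     adj = (\<lambda>x n \<omega>. mat_adjoint (x n \<omega>))\<rparr>"

lemma block_algebra_simps:
  "carrier (block_algebra d p g) = block_span d p g"
  "x \<otimes>\<^bsub>block_algebra d p g\<^esub> y = (\<lambda>n \<omega>. x n \<omega> * y n \<omega>)"
  "\<one>\<^bsub>block_algebra d p g\<^esub> = (\<lambda>n \<omega>. 1\<^sub>m (2 * d n))"
  "\<zero>\<^bsub>block_algebra d p g\<^esub> = (\<lambda>n \<omega>. 0\<^sub>m (2 * d n) (2 * d n))"
  "x \<oplus>\<^bsub>block_algebra d p g\<^esub> y = (\<lambda>n \<omega>. x n \<omega> + y n \<omega>)"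
  "z \<odot>\<^bsub>block_algebra d p g\<^esub> x = (\<lambda>n \<omega>. z \<cdot>\<^sub>m x n \<omega>)"
  "adj (block_algebra d p g) x = (\<lambda>n \<omega>. mat_adjoint (x n \<omega>))"
  by (simp_all add: block_algebra_def)

lemma block_span_carrier: "x \<in> block_span d p g \<Longrightarrow> x n \<omega> \<in> carrier_mat (2 * d n) (2 * d n)"
  by (induction rule: block_span.induct) auto

lemma block_span_zero: "(\<lambda>n \<omega>. 0\<^sub>m (2 * d n) (2 * d n)) \<in> block_span d p g"
proof -
  have "0 \<cdot>\<^sub>m word_block (d n) (p n) (g n) 1 1 [] \<omega> = 0\<^sub>m (2 * d n) (2 * d n)" for n \<omega>
    by (rule eq_matI) (auto simp: word_block_def block_mat2_def word_mat_def)
  moreover have "(\<lambda>n \<omega>. 0 \<cdot>\<^sub>m word_block (d n) (p n) (g n) 1 1 [] \<omega>) \<in> block_span d p g"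
    by (intro block_span.smult block_span.block) auto
  ultimately show ?thesis by (simp only:)
qed

lemma one_eq_blocks:
  "1\<^sub>m (2 * d) = word_block d p g 1 1 [] \<omega> + word_block d p g 2 2 [] \<omega>"
  by (rule eq_matI) (auto simp: word_block_def block_mat2_def word_mat_def)

lemma block_span_one: "(\<lambda>n \<omega>. 1\<^sub>m (2 * d n)) \<in> block_span d p g"
proof -
  have "(\<lambda>n \<omega>. word_block (d n) (p n) (g n) 1 1 [] \<omega> + word_block (d n) (p n) (g n) 2 2 [] \<omega>) \<in> block_span d p g"
    by (intro block_span.add block_span.block) auto
  then show ?thesis by (simp only: one_eq_blocks[symmetric])
qed

lemma block_span_mult:
  assumes "x \<in> block_span d p g" "y \<in> block_span d p g"
  shows "(\<lambda>n \<omega>. x n \<omega> * y n \<omega>) \<in> block_span d p g"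
  using assms(1)
proof induction
  case x: (block i j w)
  show ?case
    using assms(2)
  proof induction
    case (block k l v)
    show ?case
    proof (cases "j = k")
      case True
      have "w @ v \<in> block_words" using x(3) block(3) by (simp only: append_in_lists_conv)
      from block_span.block[OF x(1) block(2) this] show ?thesis
        unfolding word_block_mult[OF x(1,2) block(1,2)] if_P[OF True] .
    next
      case False
      then show ?thesis
        unfolding word_block_mult[OF x(1,2) block(1,2)] by (simp only: if_False block_span_zero)
    qed
  next
    case (add y y')
    have "word_block (d n) (p n) (g n) i j w \<omega> * (y n \<omega> + y' n \<omega>) =
        word_block (d n) (p n) (g n) i j w \<omega> * y n \<omega> + word_block (d n) (p n) (g n) i j w \<omega> * y' n \<omega>" for n \<omega>
      by (rule mult_add_distrib_mat[OF word_block_carrier block_span_carrier[OF add.hyps(1)] block_span_carrier[OF add.hyps(2)]])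
    then show ?case using block_span.add[OF add.IH] by simp
  next
    case (smult y z)
    have "word_block (d n) (p n) (g n) i j w \<omega> * (z \<cdot>\<^sub>m y n \<omega>) =
        z \<cdot>\<^sub>m (word_block (d n) (p n) (g n) i j w \<omega> * y n \<omega>)" for n \<omega>
      by (rule mult_smult_distrib[OF word_block_carrier block_span_carrier[OF smult.hyps]])
    then show ?case using block_span.smult[OF smult.IH] by simp
  qed
next
  case (add x x')
  have "(x n \<omega> + x' n \<omega>) * y n \<omega> = x n \<omega> * y n \<omega> + x' n \<omega> * y n \<omega>" for n \<omega>
    by (rule add_mult_distrib_mat[OF block_span_carrier[OF add.hyps(1)] block_span_carrier[OF add.hyps(2)] block_span_carrier[OF assms(2)]])
  then show ?case using block_span.add[OF add.IH] by simp
next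
  case (smult x z)
  have "(z \<cdot>\<^sub>m x n \<omega>) * y n \<omega> = z \<cdot>\<^sub>m (x n \<omega> * y n \<omega>)" for n \<omega>
    by (rule mult_smult_assoc_mat[OF block_span_carrier[OF smult.hyps] block_span_carrier[OF assms(2)]])
  then show ?case using block_span.smult[OF smult.IH] by simp
qed

lemma block_words_adjoint: "w \<in> block_words \<Longrightarrow> rev (map prod.swap w) \<in> block_words"
  by (auto simp: in_lists_conv_set)

lemma block_span_adjoint:
  assumes "x \<in> block_span d p g"
  shows "(\<lambda>n \<omega>. mat_adjoint (x n \<omega>)) \<in> block_span d p g"
  using assms
proof induction
  case (block i j w)
  then show ?case
    using block_span.block[OF block(2,1) block_words_adjoint[OF block(3)]]
    by (simp only: word_block_adjoint)
next
  case (add x y)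
  then show ?case
    using block_span.add[OF add.IH]
    by (simp add: mat_adjoint_add[OF block_span_carrier[OF add.hyps(1)] block_span_carrier[OF add.hyps(2)]])
next
  case (smult x z)
  then show ?case using block_span.smult[OF smult.IH] by (simp add: mat_adjoint_smult)
qed

lemma class_ring_cring: "cring (class_ring :: complex ring)"
  by (rule domain.axioms(1)[OF field.axioms(1)[OF class_field]])

text \<open>The identities hold for matrices at each \<open>n\<close> and each random point; the
  special form of the blocks enters only through the closure properties of the span.\<close>

lemma block_algebra_star: "star_algebra (block_algebra d p g)"
proof -
  note block_algebra_simps [simp]
  let ?A = "block_algebra d p g"
  have c: "x n \<omega> \<in> carrier_mat (2 * d n) (2 * d n)" if "x \<in> block_span d p g" for x n \<omega>
    using that by (rule block_span_carrier)
  have grp: "abelian_group ?A"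
  proof (rule abelian_groupI)
    fix x assume x: "x \<in> carrier ?A"
    have "(\<lambda>n \<omega>. (-1) \<cdot>\<^sub>m x n \<omega>) \<in> block_span d p g" using x by (intro block_span.smult) simp
    moreover have "(-1) \<cdot>\<^sub>m x n \<omega> + x n \<omega> = 0\<^sub>m (2 * d n) (2 * d n)" for n \<omega>
      using c[of x n \<omega>] x by (intro eq_matI) auto
    ultimately show "\<exists>y\<in>carrier ?A. y \<oplus>\<^bsub>?A\<^esub> x = \<zero>\<^bsub>?A\<^esub>"
      by (intro bexI[of _ "\<lambda>n \<omega>. (-1) \<cdot>\<^sub>m x n \<omega>"]) simp_all
  next
    fix x y z assume "x \<in> carrier ?A" "y \<in> carrier ?A" "z \<in> carrier ?A"
    then show "x \<oplus>\<^bsub>?A\<^esub> y \<oplus>\<^bsub>?A\<^esub> z = x \<oplus>\<^bsub>?A\<^esub> (y \<oplus>\<^bsub>?A\<^esub> z)"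
      by (auto intro!: ext assoc_add_mat c)
  next
    fix x y assume "x \<in> carrier ?A" "y \<in> carrier ?A"
    then show "x \<oplus>\<^bsub>?A\<^esub> y = y \<oplus>\<^bsub>?A\<^esub> x" by (auto intro!: ext comm_add_mat c)
  next
    fix x assume "x \<in> carrier ?A"
    then show "\<zero>\<^bsub>?A\<^esub> \<oplus>\<^bsub>?A\<^esub> x = x" by (auto intro!: ext left_add_zero_mat c)
  qed (auto intro: block_span_zero block_span.add)
  have mon: "Group.monoid ?A"
    by (rule monoidI)
       (auto intro!: ext assoc_mult_mat left_mult_one_mat right_mult_one_mat c block_span_mult block_span_one)
  have ring: "ring ?A"
    by (rule ringI[OF grp mon])
       (auto intro!: ext add_mult_distrib_mat mult_add_distrib_mat c)
  have modu: "module (class_ring :: complex ring) ?A"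
  proof (rule moduleI[OF class_ring_cring grp])
    fix z z' and x y :: "nat \<Rightarrow> 'a \<Rightarrow> complex mat"
    assume x: "x \<in> carrier ?A"
    note cx = carrier_matD[OF c[of x]]
    show "z \<odot>\<^bsub>?A\<^esub> x \<in> carrier ?A" using x by (auto intro: block_span.smult)
    show "(z \<oplus>\<^bsub>class_ring\<^esub> z') \<odot>\<^bsub>?A\<^esub> x = z \<odot>\<^bsub>?A\<^esub> x \<oplus>\<^bsub>?A\<^esub> z' \<odot>\<^bsub>?A\<^esub> x"
      by (auto simp: class_ring_simps distrib_right intro!: ext eq_matI)
    show "(z \<otimes>\<^bsub>class_ring\<^esub> z') \<odot>\<^bsub>?A\<^esub> x = z \<odot>\<^bsub>?A\<^esub> (z' \<odot>\<^bsub>?A\<^esub> x)"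
      by (auto simp: class_ring_simps intro!: ext eq_matI)
    show "\<one>\<^bsub>class_ring\<^esub> \<odot>\<^bsub>?A\<^esub> x = x"
      by (auto simp: class_ring_simps intro!: ext eq_matI)
    assume y: "y \<in> carrier ?A"
    show "z \<odot>\<^bsub>?A\<^esub> (x \<oplus>\<^bsub>?A\<^esub> y) = z \<odot>\<^bsub>?A\<^esub> x \<oplus>\<^bsub>?A\<^esub> z \<odot>\<^bsub>?A\<^esub> y"
      using x y cx carrier_matD[OF c[of y]] by (auto simp: distrib_left intro!: ext eq_matI)
  qed
  show ?thesis
  proof (intro star_algebra.intro modu ring star_algebra_axioms.intro)
    fix x y and z :: complex assume xy: "x \<in> carrier ?A" "y \<in> carrier ?A"
    show "(z \<odot>\<^bsub>?A\<^esub> x) \<otimes>\<^bsub>?A\<^esub> y = z \<odot>\<^bsub>?A\<^esub> (x \<otimes>\<^bsub>?A\<^esub> y)"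
      using xy by (auto intro!: ext mult_smult_assoc_mat c)
    show "x \<otimes>\<^bsub>?A\<^esub> (z \<odot>\<^bsub>?A\<^esub> y) = z \<odot>\<^bsub>?A\<^esub> (x \<otimes>\<^bsub>?A\<^esub> y)"
      using xy by (auto intro!: ext mult_smult_distrib c)
    show "adj ?A (x \<oplus>\<^bsub>?A\<^esub> y) = adj ?A x \<oplus>\<^bsub>?A\<^esub> adj ?A y"
      using xy by (auto intro!: ext mat_adjoint_add c)
    show "adj ?A (x \<otimes>\<^bsub>?A\<^esub> y) = adj ?A y \<otimes>\<^bsub>?A\<^esub> adj ?A x"
      using xy by (auto intro!: ext mat_adjoint_mult c)
  qed (auto simp: mat_adjoint_adjoint mat_adjoint_smult intro: block_span_adjoint)
qed

section \<open>The limit of the Wishart family\<close>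

lemma normalized_trace_add:
  "B \<in> carrier_mat n n \<Longrightarrow> C \<in> carrier_mat n n \<Longrightarrow>
    normalized_trace n (B + C) = normalized_trace n B + normalized_trace n C"
  by (simp add: normalized_trace_def sum.distrib add_divide_distrib)

lemma normalized_trace_smult:
  "B \<in> carrier_mat n n \<Longrightarrow> normalized_trace n (z \<cdot>\<^sub>m B) = z * normalized_trace n B"
  by (simp add: normalized_trace_def sum_distrib_left)

lemma normalized_trace_positive:
  assumes "B \<in> carrier_mat n n"
  shows "normalized_trace n (mat_adjoint B * B) =
    complex_of_real ((\<Sum>i<n. \<Sum>j<n. (cmod (B $$ (j, i)))\<^sup>2) / real n)"
proof -
  have "(mat_adjoint B * B) $$ (i, i) = (\<Sum>j<n. complex_of_real ((cmod (B $$ (j, i)))\<^sup>2))" if "i < n" for i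
  proof -
    have "(mat_adjoint B * B) $$ (i, i) = (\<Sum>j<n. cnj (B $$ (j, i)) * B $$ (j, i))"
      using assms that by (simp add: mat_adjoint_index scalar_prod_def atLeast0LessThan)
    also have "\<dots> = (\<Sum>j<n. complex_of_real ((cmod (B $$ (j, i)))\<^sup>2))"
      by (intro sum.cong refl) (simp add: complex_norm_square mult.commute del: of_real_power)
    finally show ?thesis .
  qed
  then show ?thesis by (simp add: normalized_trace_def)
qed

lemma block_mat2_words:
  "block_mat2 (\<lambda>i j. word_mat d p g (w i j) \<omega>) =
    (word_block d p g 1 1 (w 1 1) \<omega> + word_block d p g 1 2 (w 1 2) \<omega>) +
    (word_block d p g 2 1 (w 2 1) \<omega> + word_block d p g 2 2 (w 2 2) \<omega>)"
  by (rule eq_matI) (auto simp: word_block_def block_mat2_def word_mat_def)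

section \<open>Convergence of expected traces and the limit state\<close>

locale wishart_sequence =
  fixes M :: "nat \<Rightarrow> 'a measure" and d p :: "nat \<Rightarrow> nat" and g :: "nat \<Rightarrow> 'a gaussian_array"
    and c :: complex
  assumes blocks: "wishart_blocks (M n) (d n) (p n) (g n)"
    and d_limit: "filterlim d at_top sequentially"
    and ratio: "(\<lambda>n. of_nat (p n) / of_nat (d n) :: complex) \<longlonglongrightarrow> c"
begin

abbreviation "BA \<equiv> block_algebra d p g"

sublocale BA: star_algebra BA
  by (rule block_algebra_star)

definition block_state :: "(nat \<Rightarrow> 'a \<Rightarrow> complex mat) \<Rightarrow> complex" where
  "block_state x = lim (\<lambda>n. \<integral>\<omega>. normalized_trace (2 * d n) (x n \<omega>) \<partial>M n)"

abbreviation tr_expect :: "(nat \<Rightarrow> 'a \<Rightarrow> complex mat) \<Rightarrow> nat \<Rightarrow> complex" where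
  "tr_expect x n \<equiv> \<integral>\<omega>. normalized_trace (2 * d n) (x n \<omega>) \<partial>M n"

lemma block_limit:
  assumes "i \<in> {1, 2}" "j \<in> {1, 2}" "w \<in> block_words"
  shows "integrable (M n) (\<lambda>\<omega>. normalized_trace (2 * d n) (word_block (d n) (p n) (g n) i j w \<omega>))"
    and "tr_expect (\<lambda>n. word_block (d n) (p n) (g n) i j w) \<longlonglongrightarrow> (if i = j then limit_trace c w / 2 else 0)"
proof -
  have eq: "normalized_trace (2 * d n) (word_block (d n) (p n) (g n) i j w \<omega>) =
      (if i = j then word_trace (d n) (p n) (g n) w \<omega> / 2 else 0)" for n \<omega>
    by (rule normalized_trace_word_block[OF assms(1,2)])
  show "integrable (M n) (\<lambda>\<omega>. normalized_trace (2 * d n) (word_block (d n) (p n) (g n) i j w \<omega>))"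
    unfolding eq using wishart_blocks.word_trace_integrable[OF blocks assms(3), of n] by (cases "i = j") auto
  have "(\<lambda>n. \<integral>\<omega>. word_trace (d n) (p n) (g n) w \<omega> \<partial>M n) \<longlonglongrightarrow> limit_trace c w"
  proof -
    have "[w] \<in> lists block_words" using assms(3) by (intro lists.Cons lists.Nil)
    from mixed_moment_limit[OF blocks d_limit ratio this] show ?thesis
      by (simp add: wishart_blocks.mixed_moment_def[OF blocks])
  qed
  then have lim: "(\<lambda>n. (\<integral>\<omega>. word_trace (d n) (p n) (g n) w \<omega> \<partial>M n) / 2) \<longlonglongrightarrow> limit_trace c w / 2"
    by (intro tendsto_divide tendsto_const) auto
  show "tr_expect (\<lambda>n. word_block (d n) (p n) (g n) i j w) \<longlonglongrightarrow> (if i = j then limit_trace c w / 2 else 0)"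
  proof (cases "i = j")
    case True
    show ?thesis unfolding eq if_P[OF True] integral_divide_zero by (rule lim)
  next
    case False
    then show ?thesis unfolding eq by simp
  qed
qed

text \<open>Integrability is part of the induction because the expected trace of a sum must split
  before the limits can be added.\<close>

lemma span_limit_ex:
  assumes "x \<in> block_span d p g"
  shows "(\<forall>n. integrable (M n) (\<lambda>\<omega>. normalized_trace (2 * d n) (x n \<omega>))) \<and> (\<exists>l. tr_expect x \<longlonglongrightarrow> l)"
  using assms
proof induction
  case (block i j w)
  show ?case by (intro conjI allI exI) (rule block_limit(1)[OF block], rule block_limit(2)[OF block])
next
  case (add x y)
  have eq: "normalized_trace (2 * d n) (x n \<omega> + y n \<omega>) =
      normalized_trace (2 * d n) (x n \<omega>) + normalized_trace (2 * d n) (y n \<omega>)" for n \<omega>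
    by (rule normalized_trace_add[OF block_span_carrier[OF add.hyps(1)] block_span_carrier[OF add.hyps(2)]])
  obtain l l' where l: "tr_expect x \<longlonglongrightarrow> l" "tr_expect y \<longlonglongrightarrow> l'"
    using add.IH(1)[THEN conjunct2] add.IH(2)[THEN conjunct2] by (elim exE)
  note int = add.IH(1)[THEN conjunct1, rule_format] add.IH(2)[THEN conjunct1, rule_format]
  show ?case
    unfolding eq Bochner_Integration.integral_add[OF int]
    by (intro conjI allI exI) (rule Bochner_Integration.integrable_add[OF int], rule tendsto_add[OF l])
next
  case (smult x z)
  have eq: "normalized_trace (2 * d n) (z \<cdot>\<^sub>m x n \<omega>) = z * normalized_trace (2 * d n) (x n \<omega>)" for n \<omega>
    by (rule normalized_trace_smult[OF block_span_carrier[OF smult.hyps]])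
  obtain l where l: "tr_expect x \<longlonglongrightarrow> l" using smult.IH[THEN conjunct2] by (elim exE)
  show ?case
    unfolding eq integral_mult_right_zero
    by (intro conjI allI exI)
       (rule integrable_mult_right[OF smult.IH[THEN conjunct1, rule_format]], rule tendsto_mult_left[OF l])
qed

lemma span_integrable:
  assumes "x \<in> block_span d p g"
  shows "integrable (M n) (\<lambda>\<omega>. normalized_trace (2 * d n) (x n \<omega>))"
  by (rule span_limit_ex[OF assms, THEN conjunct1, rule_format])

lemma span_limit:
  assumes "x \<in> block_span d p g"
  shows "tr_expect x \<longlonglongrightarrow> block_state x"
proof -
  have "convergent (tr_expect x)"
    unfolding convergent_def by (rule span_limit_ex[OF assms, THEN conjunct2])
  then show ?thesis unfolding block_state_def convergent_LIMSEQ_iff .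
qed

lemma block_state_block:
  assumes "i \<in> {1, 2}" "j \<in> {1, 2}" "w \<in> block_words"
  shows "block_state (\<lambda>n. word_block (d n) (p n) (g n) i j w) = (if i = j then limit_trace c w / 2 else 0)"
  using LIMSEQ_unique[OF span_limit[OF block_span.block[OF assms]] block_limit(2)[OF assms]] .

lemma block_state_add:
  assumes "x \<in> block_span d p g" "y \<in> block_span d p g"
  shows "block_state (\<lambda>n \<omega>. x n \<omega> + y n \<omega>) = block_state x + block_state y"
proof -
  have "tr_expect (\<lambda>n \<omega>. x n \<omega> + y n \<omega>) n = tr_expect x n + tr_expect y n" for n
    unfolding normalized_trace_add[OF block_span_carrier[OF assms(1)] block_span_carrier[OF assms(2)]]
    by (rule Bochner_Integration.integral_add[OF span_integrable[OF assms(1)] span_integrable[OF assms(2)]])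
  then have "(\<lambda>n. tr_expect x n + tr_expect y n) \<longlonglongrightarrow> block_state (\<lambda>n \<omega>. x n \<omega> + y n \<omega>)"
    using span_limit[OF block_span.add[OF assms]] by (simp only:)
  then show ?thesis
    by (rule LIMSEQ_unique[OF _ tendsto_add[OF span_limit[OF assms(1)] span_limit[OF assms(2)]]])
qed

lemma block_state_smult:
  assumes "x \<in> block_span d p g"
  shows "block_state (\<lambda>n \<omega>. z \<cdot>\<^sub>m x n \<omega>) = z * block_state x"
proof -
  have "tr_expect (\<lambda>n \<omega>. z \<cdot>\<^sub>m x n \<omega>) n = z * tr_expect x n" for n
    unfolding normalized_trace_smult[OF block_span_carrier[OF assms]] integral_mult_right_zero ..
  then have "(\<lambda>n. z * tr_expect x n) \<longlonglongrightarrow> block_state (\<lambda>n \<omega>. z \<cdot>\<^sub>m x n \<omega>)"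
    using span_limit[OF block_span.smult[OF assms, of z]] by (simp only:)
  then show ?thesis
    by (rule LIMSEQ_unique[OF _ tendsto_mult_left[OF span_limit[OF assms]]])
qed

lemma block_state_one: "block_state (\<lambda>n \<omega>. 1\<^sub>m (2 * d n)) = 1"
proof -
  have "block_state (\<lambda>n \<omega>. word_block (d n) (p n) (g n) 1 1 [] \<omega> + word_block (d n) (p n) (g n) 2 2 [] \<omega>) =
      limit_trace c [] / 2 + limit_trace c [] / 2"
    by (subst block_state_add) (auto intro!: block_span.block simp: block_state_block)
  then show ?thesis by (simp only: one_eq_blocks[symmetric]) simp
qed

text \<open>At each \<open>n\<close> the expected trace is an average of squared moduli, and the
  nonnegative reals are closed.\<close>

lemma block_state_positive:
  assumes "x \<in> block_span d p g"
  shows "block_state (\<lambda>n \<omega>. mat_adjoint (x n \<omega>) * x n \<omega>) \<in> \<real>\<^sub>\<ge>\<^sub>0"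
proof -
  have s: "(\<lambda>n \<omega>. mat_adjoint (x n \<omega>) * x n \<omega>) \<in> block_span d p g"
    by (rule block_span_mult[OF block_span_adjoint[OF assms] assms])
  have "tr_expect (\<lambda>n \<omega>. mat_adjoint (x n \<omega>) * x n \<omega>) n \<in> \<real>\<^sub>\<ge>\<^sub>0" for n
    unfolding normalized_trace_positive[OF block_span_carrier[OF assms]] integral_complex_of_real
      nonneg_Reals_of_real_iff
    by (intro Bochner_Integration.integral_nonneg divide_nonneg_nonneg sum_nonneg) auto
  then show ?thesis
    by (intro Lim_in_closed_set[OF closed_nonneg_Reals_complex _ _ span_limit[OF s]]) auto
qed

sublocale BA: star_prob_space BA block_state
  by unfold_locales
     (auto simp: block_algebra_simps block_state_add block_state_smult block_state_one block_state_positive)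

section \<open>The Wishart family and its matrix units in the sequence algebra\<close>

definition wfam :: "letter \<Rightarrow> nat \<Rightarrow> 'a \<Rightarrow> complex mat" where
  "wfam l = (\<lambda>n \<omega>. wishart_family (d n) (p n) (g n) \<omega> l)"

definition block_seq :: "nat \<Rightarrow> nat \<Rightarrow> (nat \<times> nat) list \<Rightarrow> nat \<Rightarrow> 'a \<Rightarrow> complex mat" where
  "block_seq i j w = (\<lambda>n. word_block (d n) (p n) (g n) i j w)"

lemma block_seq_closed: "i \<in> {1, 2} \<Longrightarrow> j \<in> {1, 2} \<Longrightarrow> w \<in> block_words \<Longrightarrow> block_seq i j w \<in> carrier BA"
  unfolding block_seq_def block_algebra_simps by (rule block_span.block)

lemma block_seq_mult:
  assumes "i \<in> {1, 2}" "j \<in> {1, 2}" "k \<in> {1, 2}" "l \<in> {1, 2}"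
  shows "block_seq i j u \<otimes>\<^bsub>BA\<^esub> block_seq k l v = (if j = k then block_seq i l (u @ v) else \<zero>\<^bsub>BA\<^esub>)"
  unfolding block_seq_def block_algebra_simps word_block_mult[OF assms] by simp

lemma block_seq_adj:
  "i \<in> {1, 2} \<Longrightarrow> j \<in> {1, 2} \<Longrightarrow> adj BA (block_seq i j w) = block_seq j i (rev (map prod.swap w))"
  unfolding block_seq_def block_algebra_simps by (simp only: word_block_adjoint)

lemma one_block_seq: "\<one>\<^bsub>BA\<^esub> = block_seq 1 1 [] \<oplus>\<^bsub>BA\<^esub> block_seq 2 2 []"
  unfolding block_seq_def block_algebra_simps by (simp only: one_eq_blocks[symmetric])

lemma wfam_E: "wfam (E i j) = block_seq i j []"
  unfolding wfam_def block_seq_def wishart_family.simps block_unit_def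
  by (intro ext) (simp only: word_block_def word_mat_Nil)

lemma wfam_W: "wfam W = (1 / 2) \<odot>\<^bsub>BA\<^esub> ((block_seq 1 1 [(1, 1)] \<oplus>\<^bsub>BA\<^esub> block_seq 1 2 [(1, 2)]) \<oplus>\<^bsub>BA\<^esub>
    (block_seq 2 1 [(2, 1)] \<oplus>\<^bsub>BA\<^esub> block_seq 2 2 [(2, 2)]))"
  unfolding wfam_def block_seq_def block_algebra_simps
  by (simp only: wishart_family.simps wishart_def word_mat_single[symmetric]
      block_mat2_words[where w = "\<lambda>i j. [(i, j)]"])

lemma wfam_WL: "wfam WL = (1 / 2) \<odot>\<^bsub>BA\<^esub> ((block_seq 1 1 [(1, 1)] \<oplus>\<^bsub>BA\<^esub> block_seq 1 2 [(2, 1)]) \<oplus>\<^bsub>BA\<^esub>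
    (block_seq 2 1 [(1, 2)] \<oplus>\<^bsub>BA\<^esub> block_seq 2 2 [(2, 2)]))"
  unfolding wfam_def block_seq_def block_algebra_simps
  by (simp only: wishart_family.simps wishart_left_transpose_def word_mat_single[symmetric]
      block_mat2_words[where w = "\<lambda>i j. [(j, i)]"])

lemma single_word_in: "i \<in> {1, 2} \<Longrightarrow> j \<in> {1, 2} \<Longrightarrow> [(i, j)] \<in> block_words" "[] \<in> block_words"
  by auto

lemma wfam_closed:
  assumes "l \<in> letters"
  shows "wfam l \<in> carrier BA"
proof -
  have m: "(1 :: nat) \<in> {1, 2}" "(2 :: nat) \<in> {1, 2}" by auto
  have "l = W \<or> l = WL \<or> (\<exists>i\<in>{1, 2}. \<exists>j\<in>{1, 2}. l = E i j)"
    using assms unfolding letters_def by blast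
  then show ?thesis
    unfolding wfam_W[symmetric]
    by (elim disjE bexE; simp only: wfam_W wfam_WL wfam_E; intro BA.sm_closed BA.a_closed block_seq_closed single_word_in m; assumption?)
qed

lemma one_two: "(1 :: nat) \<in> {1, 2}" "(2 :: nat) \<in> {1, 2}"
  by auto

text \<open>Compression by matrix units selects one block of \<open>W\<close>; the 1/2 is the
  normalisation of the Wishart matrix and is cancelled in \<open>wfam_entry\<close>.\<close>

lemma corner_W:
  assumes "i \<in> {1, 2}" "j \<in> {1, 2}" "k \<in> {1, 2}" "l \<in> {1, 2}"
  shows "wfam (E k i) \<otimes>\<^bsub>BA\<^esub> wfam W \<otimes>\<^bsub>BA\<^esub> wfam (E j l) = (1 / 2) \<odot>\<^bsub>BA\<^esub> block_seq k l [(i, j)]"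
proof -
  let ?u = "block_seq k i []" and ?v = "block_seq j l []" and ?T = "\<lambda>r s. block_seq r s [(r, s)]"
  have u: "?u \<in> carrier BA" and v: "?v \<in> carrier BA" by (intro block_seq_closed single_word_in assms)+
  have T: "?T 1 1 \<in> carrier BA" "?T 1 2 \<in> carrier BA" "?T 2 1 \<in> carrier BA" "?T 2 2 \<in> carrier BA"
    by (intro block_seq_closed single_word_in one_two)+
  have R: "block_seq k l [(i, j)] \<in> carrier BA" by (intro block_seq_closed single_word_in assms)
  have uTv: "?u \<otimes>\<^bsub>BA\<^esub> ?T r s \<otimes>\<^bsub>BA\<^esub> ?v = (if i = r \<and> s = j then block_seq k l [(i, j)] else \<zero>\<^bsub>BA\<^esub>)"
    if "r \<in> {1, 2}" "s \<in> {1, 2}" for r s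
  proof (cases "i = r")
    case True
    then show ?thesis
      unfolding block_seq_mult[OF assms(3,1) that] if_P[OF True] block_seq_mult[OF assms(3) that(2) assms(2,4)] by simp
  next
    case False
    then show ?thesis
      unfolding block_seq_mult[OF assms(3,1) that] if_not_P[OF False] BA.l_null[OF v] by simp
  qed
  have "?u \<otimes>\<^bsub>BA\<^esub> wfam W \<otimes>\<^bsub>BA\<^esub> ?v = (1 / 2) \<odot>\<^bsub>BA\<^esub>
      ((?u \<otimes>\<^bsub>BA\<^esub> ?T 1 1 \<otimes>\<^bsub>BA\<^esub> ?v \<oplus>\<^bsub>BA\<^esub> ?u \<otimes>\<^bsub>BA\<^esub> ?T 1 2 \<otimes>\<^bsub>BA\<^esub> ?v) \<oplus>\<^bsub>BA\<^esub>
       (?u \<otimes>\<^bsub>BA\<^esub> ?T 2 1 \<otimes>\<^bsub>BA\<^esub> ?v \<oplus>\<^bsub>BA\<^esub> ?u \<otimes>\<^bsub>BA\<^esub> ?T 2 2 \<otimes>\<^bsub>BA\<^esub> ?v))"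
    unfolding wfam_W
    by (simp only: BA.smult_mult_right BA.smult_mult_left BA.r_distr BA.l_distr BA.a_closed BA.m_closed u v T)
  also have "\<dots> = (1 / 2) \<odot>\<^bsub>BA\<^esub> block_seq k l [(i, j)]"
  proof -
    have "i = 1 \<or> i = 2" "j = 1 \<or> j = 2" using assms(1,2) by auto
    then show ?thesis
      unfolding uTv[OF one_two(1) one_two(1)] uTv[OF one_two(1) one_two(2)]
        uTv[OF one_two(2) one_two(1)] uTv[OF one_two(2) one_two(2)]
      using R by (elim disjE) (simp_all add: BA.l_zero BA.r_zero del: One_nat_def)
  qed
  finally show ?thesis unfolding wfam_E .
qed

abbreviation "wfam_unit \<equiv> \<lambda>i j. wfam (E i j)"
abbreviation "wfam_entry \<equiv> \<lambda>i j. 2 \<odot>\<^bsub>BA\<^esub> block_entry BA wfam_unit (wfam W) i j"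

lemma wfam_unit_closed: "i \<in> {1, 2} \<Longrightarrow> j \<in> {1, 2} \<Longrightarrow> wfam_unit i j \<in> carrier BA"
  unfolding wfam_E by (intro block_seq_closed single_word_in)

lemma wfam_units: "matrix_units2 BA wfam_unit"
  unfolding matrix_units2_def
proof (intro conjI ballI)
  fix i j :: nat assume ij: "i \<in> {1, 2}" "j \<in> {1, 2}"
  show "wfam (E i j) \<in> carrier BA" by (rule wfam_unit_closed[OF ij])
  show "adj BA (wfam (E i j)) = wfam (E j i)" unfolding wfam_E block_seq_adj[OF ij] by simp
  fix k l :: nat assume kl: "k \<in> {1, 2}" "l \<in> {1, 2}"
  show "wfam (E i j) \<otimes>\<^bsub>BA\<^esub> wfam (E k l) = (if j = k then wfam (E i l) else \<zero>\<^bsub>BA\<^esub>)"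
    unfolding wfam_E block_seq_mult[OF ij kl] by simp
next
  show "wfam (E 1 1) \<oplus>\<^bsub>BA\<^esub> wfam (E 2 2) = \<one>\<^bsub>BA\<^esub>"
    unfolding wfam_E by (rule one_block_seq[symmetric])
qed

lemma wfam_entry:
  assumes "i \<in> {1, 2}" "j \<in> {1, 2}"
  shows "wfam_entry i j = block_seq 1 1 [(i, j)]"
proof -
  have cl: "block_seq 1 1 [(i, j)] \<in> carrier BA" by (intro block_seq_closed single_word_in one_two assms)
  have "wfam_entry i j = 2 \<odot>\<^bsub>BA\<^esub> ((1 / 2) \<odot>\<^bsub>BA\<^esub> block_seq 1 1 [(i, j)])"
    unfolding block_entry_def corner_W[OF assms one_two(1) one_two(1)] ..
  also have "\<dots> = (2 * (1 / 2)) \<odot>\<^bsub>BA\<^esub> block_seq 1 1 [(i, j)]" by (rule BA.sm_assoc[OF cl, symmetric])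
  also have "\<dots> = block_seq 1 1 [(i, j)]" using BA.sm_one[OF cl] by simp
  finally show ?thesis .
qed

lemma corner_block_seq:
  assumes "i \<in> {1, 2}" "j \<in> {1, 2}"
  shows "wfam_unit i 1 \<otimes>\<^bsub>BA\<^esub> block_seq 1 1 w \<otimes>\<^bsub>BA\<^esub> wfam_unit 1 j = block_seq i j w"
  unfolding wfam_E block_seq_mult[OF assms(1) one_two(1) one_two(1) one_two(1)] if_P[OF refl]
    block_seq_mult[OF assms(1) one_two(1) one_two(1) assms(2)] by simp

lemma wfam_block_element:
  assumes "\<And>i j. i \<in> {1, 2} \<Longrightarrow> j \<in> {1, 2} \<Longrightarrow> x i j \<in> carrier BA"
    and "\<And>i j. i \<in> {1, 2} \<Longrightarrow> j \<in> {1, 2} \<Longrightarrow> wfam_unit i 1 \<otimes>\<^bsub>BA\<^esub> x i j \<otimes>\<^bsub>BA\<^esub> wfam_unit 1 j = y i j"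
  shows "block_element BA wfam_unit x = (y 1 1 \<oplus>\<^bsub>BA\<^esub> y 1 2) \<oplus>\<^bsub>BA\<^esub> (y 2 1 \<oplus>\<^bsub>BA\<^esub> y 2 2)"
  by (rule trans[OF BA.block_element_expand[OF wfam_unit_closed assms(1)]])
     (simp_all only: assms(2)[OF one_two(1) one_two(1)] assms(2)[OF one_two(1) one_two(2)]
      assms(2)[OF one_two(2) one_two(1)] assms(2)[OF one_two(2) one_two(2)])

lemma wfam_entry_closed: "i \<in> {1, 2} \<Longrightarrow> j \<in> {1, 2} \<Longrightarrow> wfam_entry i j \<in> carrier BA"
  unfolding wfam_entry by (intro block_seq_closed single_word_in one_two)

lemma corner_entry:
  assumes "i \<in> {1, 2}" "j \<in> {1, 2}" "k \<in> {1, 2}" "l \<in> {1, 2}"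
  shows "wfam_unit i 1 \<otimes>\<^bsub>BA\<^esub> wfam_entry k l \<otimes>\<^bsub>BA\<^esub> wfam_unit 1 j = block_seq i j [(k, l)]"
  unfolding wfam_entry[OF assms(3,4)] by (rule corner_block_seq[OF assms(1,2)])

lemma corner_zero:
  assumes "i \<in> {1, 2}" "j \<in> {1, 2}"
  shows "wfam_unit i 1 \<otimes>\<^bsub>BA\<^esub> \<zero>\<^bsub>BA\<^esub> \<otimes>\<^bsub>BA\<^esub> wfam_unit 1 j = \<zero>\<^bsub>BA\<^esub>"
  using wfam_unit_closed[OF assms(1) one_two(1)] wfam_unit_closed[OF one_two(1) assms(2)]
  by (simp only: BA.r_null BA.l_null)

lemma wfam_W_blocks: "wfam W = (1 / 2) \<odot>\<^bsub>BA\<^esub> block_element BA wfam_unit (\<lambda>i j. wfam_entry i j)"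
proof -
  have "block_element BA wfam_unit (\<lambda>i j. wfam_entry i j) =
      (block_seq 1 1 [(1, 1)] \<oplus>\<^bsub>BA\<^esub> block_seq 1 2 [(1, 2)]) \<oplus>\<^bsub>BA\<^esub> (block_seq 2 1 [(2, 1)] \<oplus>\<^bsub>BA\<^esub> block_seq 2 2 [(2, 2)])"
  proof (rule wfam_block_element[where y = "\<lambda>i j. block_seq i j [(i, j)]"])
    fix i j :: nat assume ij: "i \<in> {1, 2}" "j \<in> {1, 2}"
    show "wfam_entry i j \<in> carrier BA" by (rule wfam_entry_closed[OF ij])
    show "wfam_unit i 1 \<otimes>\<^bsub>BA\<^esub> wfam_entry i j \<otimes>\<^bsub>BA\<^esub> wfam_unit 1 j = block_seq i j [(i, j)]"
      by (rule corner_entry[OF ij ij])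
  qed
  then show ?thesis by (simp only: wfam_W)
qed

lemma wfam_WL_blocks: "wfam WL = (1 / 2) \<odot>\<^bsub>BA\<^esub> block_element BA wfam_unit (\<lambda>i j. wfam_entry j i)"
proof -
  have "block_element BA wfam_unit (\<lambda>i j. wfam_entry j i) =
      (block_seq 1 1 [(1, 1)] \<oplus>\<^bsub>BA\<^esub> block_seq 1 2 [(2, 1)]) \<oplus>\<^bsub>BA\<^esub> (block_seq 2 1 [(1, 2)] \<oplus>\<^bsub>BA\<^esub> block_seq 2 2 [(2, 2)])"
  proof (rule wfam_block_element[where y = "\<lambda>i j. block_seq i j [(j, i)]"])
    fix i j :: nat assume ij: "i \<in> {1, 2}" "j \<in> {1, 2}"
    show "wfam_entry j i \<in> carrier BA" by (rule wfam_entry_closed[OF ij(2,1)])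
    show "wfam_unit i 1 \<otimes>\<^bsub>BA\<^esub> wfam_entry j i \<otimes>\<^bsub>BA\<^esub> wfam_unit 1 j = block_seq i j [(j, i)]"
      by (rule corner_entry[OF ij ij(2,1)])
  qed
  then show ?thesis by (simp only: wfam_WL)
qed

text \<open>\<open>False\<close> is \<open>X1\<close>, \<open>True\<close> is \<open>X2\<close>. Row
  \<open>i\<close> has its only nonzero block in column \<open>flip b i\<close>, and the indices of
  W there are interchanged by the transpose.\<close>

definition wfam_X :: "bool \<Rightarrow> nat \<Rightarrow> 'a \<Rightarrow> complex mat" where
  "wfam_X b = block_seq 1 (flip b 1) [(flip b 1, 1)] \<oplus>\<^bsub>BA\<^esub> block_seq 2 (flip b 2) [(flip b 2, 2)]"

lemma flip_simps: "flip False i = i" "flip True 1 = 2" "flip True 2 = 1"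
  by (simp_all add: flip_def)

lemma wfam_X1: "block_element BA wfam_unit (\<lambda>i j. if i = j then wfam_entry i j else \<zero>\<^bsub>BA\<^esub>) = wfam_X False"
proof -
  have "block_element BA wfam_unit (\<lambda>i j. if i = j then wfam_entry i j else \<zero>\<^bsub>BA\<^esub>) =
      (block_seq 1 1 [(1, 1)] \<oplus>\<^bsub>BA\<^esub> \<zero>\<^bsub>BA\<^esub>) \<oplus>\<^bsub>BA\<^esub> (\<zero>\<^bsub>BA\<^esub> \<oplus>\<^bsub>BA\<^esub> block_seq 2 2 [(2, 2)])"
    using wfam_block_element[of "\<lambda>i j. if i = j then wfam_entry i j else \<zero>\<^bsub>BA\<^esub>"
        "\<lambda>i j. if i = j then block_seq i j [(i, j)] else \<zero>\<^bsub>BA\<^esub>"]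
      wfam_entry_closed BA.zero_closed corner_entry corner_zero
    by (simp del: One_nat_def)
  also have "\<dots> = wfam_X False"
    unfolding wfam_X_def flip_simps
    using block_seq_closed[OF one_two(1) one_two(1) single_word_in(1)[OF one_two(1) one_two(1)]]
      block_seq_closed[OF one_two(2) one_two(2) single_word_in(1)[OF one_two(2) one_two(2)]]
    by (simp only: BA.r_zero BA.l_zero)
  finally show ?thesis .
qed

lemma wfam_X2: "block_element BA wfam_unit (\<lambda>i j. if i \<noteq> j then wfam_entry j i else \<zero>\<^bsub>BA\<^esub>) = wfam_X True"
proof -
  have "block_element BA wfam_unit (\<lambda>i j. if i \<noteq> j then wfam_entry j i else \<zero>\<^bsub>BA\<^esub>) =
      (\<zero>\<^bsub>BA\<^esub> \<oplus>\<^bsub>BA\<^esub> block_seq 1 2 [(2, 1)]) \<oplus>\<^bsub>BA\<^esub> (block_seq 2 1 [(1, 2)] \<oplus>\<^bsub>BA\<^esub> \<zero>\<^bsub>BA\<^esub>)"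
    using wfam_block_element[of "\<lambda>i j. if i \<noteq> j then wfam_entry j i else \<zero>\<^bsub>BA\<^esub>"
        "\<lambda>i j. if i \<noteq> j then block_seq i j [(j, i)] else \<zero>\<^bsub>BA\<^esub>"]
      wfam_entry_closed BA.zero_closed corner_entry corner_zero
    by (simp del: One_nat_def)
  also have "\<dots> = wfam_X True"
    unfolding wfam_X_def flip_simps
    using block_seq_closed[OF one_two(1) one_two(2) single_word_in(1)[OF one_two(2) one_two(1)]]
      block_seq_closed[OF one_two(2) one_two(1) single_word_in(1)[OF one_two(1) one_two(2)]]
    by (simp only: BA.r_zero BA.l_zero)
  finally show ?thesis .
qed

lemma flip_in: "i \<in> {1, 2} \<Longrightarrow> flip b i \<in> {1, 2}"
  by (auto simp: flip_def)

lemma path_end_in: "i \<in> {1, 2} \<Longrightarrow> path_end i w \<in> {1, 2}"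
  by (induction i w rule: path_end.induct) (simp_all only: path_end.simps flip_in)

lemma block_path_in: "i \<in> {1, 2} \<Longrightarrow> block_path i w \<in> block_words"
  by (induction i w rule: block_path.induct)
     (simp_all only: block_path.simps Cons_in_lists_iff lists.Nil flip_in mem_Sigma_iff simp_thms)

text \<open>Each row of a factor has one nonzero block, so a product follows one path per starting
  row and concatenates the blocks met on the way.\<close>

lemma wfam_word_product:
  "BA.word_product wfam_X w =
    block_seq 1 (path_end 1 w) (block_path 1 w) \<oplus>\<^bsub>BA\<^esub> block_seq 2 (path_end 2 w) (block_path 2 w)"
proof (induction w)
  case Nil
  show ?case unfolding BA.word_product_simps path_end.simps block_path.simps by (rule one_block_seq)
next
  case (Cons b w)
  let ?P = "\<lambda>i. block_seq i (path_end i w) (block_path i w)"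
  let ?X = "\<lambda>i. block_seq i (flip b i) [(flip b i, i)]"
  have P: "?P i \<in> carrier BA" and X: "?X i \<in> carrier BA" if "i \<in> {1, 2}" for i
    by (intro block_seq_closed that path_end_in block_path_in flip_in single_word_in)+
  have XP: "?X i \<otimes>\<^bsub>BA\<^esub> ?P j = (if flip b i = j then block_seq i (path_end j w) ((flip b i, i) # block_path j w) else \<zero>\<^bsub>BA\<^esub>)"
    if "i \<in> {1, 2}" "j \<in> {1, 2}" for i j
    unfolding block_seq_mult[OF that(1) flip_in[OF that(1)] that(2) path_end_in[OF that(2)]] by simp
  have Q: "block_seq i (path_end (flip b i) w) ((flip b i, i) # block_path (flip b i) w) \<in> carrier BA"
    if "i \<in> {1, 2}" for i
    using block_seq_closed[OF that path_end_in[OF that, of "b # w"] block_path_in[OF that, of "b # w"]] by simp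
  have row: "?X i \<otimes>\<^bsub>BA\<^esub> (?P 1 \<oplus>\<^bsub>BA\<^esub> ?P 2) =
      block_seq i (path_end (flip b i) w) ((flip b i, i) # block_path (flip b i) w)" if "i \<in> {1, 2}" for i
  proof -
    have "flip b i = 1 \<or> flip b i = 2" using flip_in[OF that] by blast
    then show ?thesis
    proof
      assume f: "flip b i = 1"
      then show ?thesis
        using BA.r_distr[OF P[OF one_two(1)] P[OF one_two(2)] X[OF that]] XP[OF that one_two(1)] XP[OF that one_two(2)]
          BA.r_zero[OF Q[OF that]] by (simp del: One_nat_def)
    next
      assume f: "flip b i = 2"
      then show ?thesis
        using BA.r_distr[OF P[OF one_two(1)] P[OF one_two(2)] X[OF that]] XP[OF that one_two(1)] XP[OF that one_two(2)]
          BA.l_zero[OF Q[OF that]] by (simp del: One_nat_def)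
    qed
  qed
  have "BA.word_product wfam_X (b # w) = (?X 1 \<oplus>\<^bsub>BA\<^esub> ?X 2) \<otimes>\<^bsub>BA\<^esub> (?P 1 \<oplus>\<^bsub>BA\<^esub> ?P 2)"
    unfolding BA.word_product_simps Cons.IH wfam_X_def ..
  also have "\<dots> = ?X 1 \<otimes>\<^bsub>BA\<^esub> (?P 1 \<oplus>\<^bsub>BA\<^esub> ?P 2) \<oplus>\<^bsub>BA\<^esub> ?X 2 \<otimes>\<^bsub>BA\<^esub> (?P 1 \<oplus>\<^bsub>BA\<^esub> ?P 2)"
    by (rule BA.l_distr[OF X[OF one_two(1)] X[OF one_two(2)] BA.a_closed[OF P[OF one_two(1)] P[OF one_two(2)]]])
  finally show ?case unfolding row[OF one_two(1)] row[OF one_two(2)] path_end.simps block_path.simps .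
qed

text \<open>The path returns to its starting row exactly for an even number of flips; then each of
  the two rows contributes half of the moment. For an odd number there is no diagonal block, and the
  free moment is 0 as well.\<close>

lemma wfam_word_state: "block_state (BA.word_product wfam_X w) = free_moment (block_cumulant c) w"
proof -
  have s: "block_state (block_seq i (path_end i w) (block_path i w)) =
      (if even (count_list w True) then free_moment (block_cumulant c) w / 2 else 0)" if "i \<in> {1, 2}" for i
  proof -
    have "block_state (block_seq i (path_end i w) (block_path i w)) =
        (if i = path_end i w then limit_trace c (block_path i w) / 2 else 0)"
      unfolding block_seq_def by (rule block_state_block[OF that path_end_in[OF that] block_path_in[OF that]])
    then show ?thesis
      unfolding limit_trace_block_path[OF that] path_end_parity[OF that] using that by auto
  qed
  have "block_state (BA.word_product wfam_X w) =
      block_state (block_seq 1 (path_end 1 w) (block_path 1 w)) + block_state (block_seq 2 (path_end 2 w) (block_path 2 w))"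
    unfolding wfam_word_product
    by (rule BA.state_add) (intro block_seq_closed path_end_in block_path_in one_two)+
  then show ?thesis
    unfolding s[OF one_two(1)] s[OF one_two(2)] using block_moment_odd[of w c] by auto
qed

lemma mat_star_algebra_simps:
  "x \<otimes>\<^bsub>mat_star_algebra n\<^esub> y = x * y" "\<one>\<^bsub>mat_star_algebra n\<^esub> = 1\<^sub>m n"
  "adj (mat_star_algebra n) x = mat_adjoint x"
  by (simp_all add: mat_star_algebra_def module.defs module_mat_def)

lemma star_word_wfam:
  "star_word BA wfam ls n \<omega> =
    star_word (mat_star_algebra (2 * d n)) (wishart_family (d n) (p n) (g n) \<omega>) ls"
  by (induction ls) (auto simp: star_word_def mat_star_algebra_simps wfam_def block_algebra_simps)

lemma star_word_limit:
  assumes "ls \<in> lists (letters \<times> UNIV)"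
  shows "(\<lambda>n. \<integral>\<omega>. normalized_trace (2 * d n)
      (star_word (mat_star_algebra (2 * d n)) (wishart_family (d n) (p n) (g n) \<omega>) ls) \<partial>M n)
    \<longlonglongrightarrow> block_state (star_word BA wfam ls)"
proof -
  have "star_word BA wfam ls \<in> block_span d p g"
    using BA.star_word_closed[OF wfam_closed assms] unfolding block_algebra_simps .
  from span_limit[OF this] show ?thesis unfolding star_word_wfam .
qed

lemma wfam_W_adj: "adj BA (wfam W) = wfam W"
proof -
  have cl: "block_seq 1 1 [(1, 1)] \<in> carrier BA" "block_seq 1 2 [(1, 2)] \<in> carrier BA"
    "block_seq 2 1 [(2, 1)] \<in> carrier BA" "block_seq 2 2 [(2, 2)] \<in> carrier BA"
    by (intro block_seq_closed single_word_in one_two)+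
  have "adj BA (wfam W) = (1 / 2) \<odot>\<^bsub>BA\<^esub> ((block_seq 1 1 [(1, 1)] \<oplus>\<^bsub>BA\<^esub> block_seq 2 1 [(2, 1)]) \<oplus>\<^bsub>BA\<^esub>
      (block_seq 1 2 [(1, 2)] \<oplus>\<^bsub>BA\<^esub> block_seq 2 2 [(2, 2)]))"
    unfolding wfam_W using cl
    by (simp add: BA.adj_smult BA.adj_add BA.a_closed block_seq_adj del: One_nat_def)
  also have "(block_seq 1 1 [(1, 1)] \<oplus>\<^bsub>BA\<^esub> block_seq 2 1 [(2, 1)]) \<oplus>\<^bsub>BA\<^esub> (block_seq 1 2 [(1, 2)] \<oplus>\<^bsub>BA\<^esub> block_seq 2 2 [(2, 2)]) =
      (block_seq 1 1 [(1, 1)] \<oplus>\<^bsub>BA\<^esub> block_seq 1 2 [(1, 2)]) \<oplus>\<^bsub>BA\<^esub> (block_seq 2 1 [(2, 1)] \<oplus>\<^bsub>BA\<^esub> block_seq 2 2 [(2, 2)])"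
    using cl by (simp add: BA.a_ac del: One_nat_def)
  finally show ?thesis unfolding wfam_W[symmetric] .
qed

theorem wfam_wishart_limit: "wishart_limit M d p g BA block_state wfam"
  unfolding wishart_limit_def limit_joint_distribution_def
  using BA.star_prob_space_axioms wfam_closed star_word_limit wfam_units wfam_W_adj by blast

text \<open>In any limit, \<open>X b\<close> is built from the letters by the same polynomial as
  \<open>wfam_X b\<close>, so its moments can be computed in the concrete limit. Self-adjointness is
  not a matter of moments and comes from the relations required in
  \<open>wishart_limit\<close>.\<close>

theorem wishart_limit_word_state:
  fixes A :: "'b star_algebra"
  assumes lim: "wishart_limit M d p g A \<phi> a"
  defines "e \<equiv> \<lambda>i j. a (E i j)"
  defines "w \<equiv> \<lambda>i j. 2 \<odot>\<^bsub>A\<^esub> block_entry A e (a W) i j"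
  defines "X \<equiv> \<lambda>b. if b then block_element A e (\<lambda>i j. if i \<noteq> j then w j i else \<zero>\<^bsub>A\<^esub>)
    else block_element A e (\<lambda>i j. if i = j then w i j else \<zero>\<^bsub>A\<^esub>)"
  shows "star_prob_space A \<phi>" "X b \<in> carrier A" "adj A (X b) = X b"
    and "\<phi> (star_algebra.word_product A X u) = free_moment (block_cumulant c) u"
proof -
  have jd: "limit_joint_distribution M (\<lambda>n. 2 * d n) letters (\<lambda>n. wishart_family (d n) (p n) (g n)) A \<phi> a"
    and mu: "matrix_units2 A e" and sa: "adj A (a W) = a W"
    using lim unfolding wishart_limit_def e_def by blast+
  show sp: "star_prob_space A \<phi>" using jd unfolding limit_joint_distribution_def by blast
  interpret P: star_prob_space A \<phi> by (rule sp)
  have aI: "a l \<in> carrier A" if "l \<in> letters" for l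
    using jd that unfolding limit_joint_distribution_def by blast
  interpret pair: star_algebra_pair A BA a wfam letters
    by unfold_locales (use aI wfam_closed in auto)
  have let_W: "W \<in> letters" and let_E: "i \<in> {1, 2} \<Longrightarrow> j \<in> {1, 2} \<Longrightarrow> E i j \<in> letters" for i j
    unfolding letters_def by blast+
  have ec: "e i j \<in> carrier A" and ea: "adj A (e i j) = e j i" if "i \<in> {1, 2}" "j \<in> {1, 2}" for i j
    using mu that unfolding matrix_units2_def by blast+
  have wc: "w i j \<in> carrier A" if "i \<in> {1, 2}" "j \<in> {1, 2}" for i j
    unfolding w_def by (intro P.sm_closed P.block_entry_closed ec aI let_W that)
  have wa: "adj A (w i j) = w j i" if "i \<in> {1, 2}" "j \<in> {1, 2}" for i j
    unfolding w_def
    using P.block_entry_adj[OF ec ea aI[OF let_W] sa that] P.block_entry_closed[OF ec aI[OF let_W] that]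
    by (simp add: P.adj_smult)
  have same_e: "pair.same (e i j) (wfam_unit i j)" if "i \<in> {1, 2}" "j \<in> {1, 2}" for i j
    unfolding e_def by (rule pair.same_letter[OF let_E[OF that]])
  have same_w: "pair.same (w i j) (wfam_entry i j)" if "i \<in> {1, 2}" "j \<in> {1, 2}" for i j
    unfolding w_def block_entry_def
    by (intro same_poly.smult pair.same_mult same_e pair.same_letter let_W that one_two)
  show "X b \<in> carrier A"
    unfolding X_def using ec wc by (cases b) (auto intro!: P.block_element_closed)
  show "adj A (X b) = X b"
  proof (cases b)
    case True
    have "adj A (block_element A e (\<lambda>i j. if i \<noteq> j then w j i else \<zero>\<^bsub>A\<^esub>)) =
        block_element A e (\<lambda>i j. if i \<noteq> j then w j i else \<zero>\<^bsub>A\<^esub>)"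
      by (rule P.block_element_adj[OF ec ea]) (use wc wa P.adj_zero in simp_all)
    then show ?thesis using True by (simp add: X_def)
  next
    case False
    have "adj A (block_element A e (\<lambda>i j. if i = j then w i j else \<zero>\<^bsub>A\<^esub>)) =
        block_element A e (\<lambda>i j. if i = j then w i j else \<zero>\<^bsub>A\<^esub>)"
      by (rule P.block_element_adj[OF ec ea]) (use wc wa P.adj_zero in simp_all)
    then show ?thesis using False by (simp add: X_def)
  qed
  have same_X: "pair.same (X b) (wfam_X b)" for b
  proof (cases b)
    case True
    have "pair.same (block_element A e (\<lambda>i j. if i \<noteq> j then w j i else \<zero>\<^bsub>A\<^esub>))
        (block_element BA wfam_unit (\<lambda>i j. if i \<noteq> j then wfam_entry j i else \<zero>\<^bsub>BA\<^esub>))"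
    proof (rule pair.same_block_element[OF same_e])
      show "pair.same (if i \<noteq> j then w j i else \<zero>\<^bsub>A\<^esub>) (if i \<noteq> j then wfam_entry j i else \<zero>\<^bsub>BA\<^esub>)"
        if "i \<in> {1, 2}" "j \<in> {1, 2}" for i j
        using same_w[OF that(2,1)] pair.same_zero by (cases "i = j") (simp_all only: simp_thms if_True if_False)
    qed
    then show ?thesis unfolding wfam_X2 X_def using True by simp
  next
    case False
    have "pair.same (block_element A e (\<lambda>i j. if i = j then w i j else \<zero>\<^bsub>A\<^esub>))
        (block_element BA wfam_unit (\<lambda>i j. if i = j then wfam_entry i j else \<zero>\<^bsub>BA\<^esub>))"
    proof (rule pair.same_block_element[OF same_e])
      show "pair.same (if i = j then w i j else \<zero>\<^bsub>A\<^esub>) (if i = j then wfam_entry i j else \<zero>\<^bsub>BA\<^esub>)"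
        if "i \<in> {1, 2}" "j \<in> {1, 2}" for i j
        using same_w[OF that] pair.same_zero by (cases "i = j") (simp_all only: simp_thms if_True if_False)
    qed
    then show ?thesis unfolding wfam_X1 X_def using False by simp
  qed
  \<comment> \<open>Both values are limits of the same sequence of expected traces.\<close>
  have mom: "\<phi> (star_word A a ls) = block_state (star_word BA wfam ls)" if "ls \<in> lists (letters \<times> UNIV)" for ls
  proof (rule LIMSEQ_unique[OF _ star_word_limit[OF that]])
    show "(\<lambda>n. \<integral>\<omega>. normalized_trace (2 * d n)
      (star_word (mat_star_algebra (2 * d n)) (wishart_family (d n) (p n) (g n) \<omega>) ls) \<partial>M n)
      \<longlonglongrightarrow> \<phi> (star_word A a ls)"
      using jd that unfolding limit_joint_distribution_def by blast
  qed
  have "\<phi> (P.word_product X u) = block_state (BA.word_product wfam_X u)"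
  proof (rule pair.same_state[OF sp BA.star_prob_space_axioms])
    show "pair.same (P.word_product X u) (BA.word_product wfam_X u)"
      by (rule pair.same_word_product) (rule same_X)
  qed (rule mom)
  then show "\<phi> (star_algebra.word_product A X u) = free_moment (block_cumulant c) u"
    unfolding wfam_word_state .
qed

end

text \<open>If all cumulants of \<open>a\<close> coincide, the size an open block has reached is
  forgotten. An open block in front of \<open>w\<close> then equals the moment of
  \<open>a # w\<close>, which closes the recursion on moments alone.\<close>

lemma open_block_constant:
  assumes "\<And>n. \<kappa> a n = k"
  shows "open_block \<kappa> a n w = open_block \<kappa> a n' w"
proof (induction "length w" arbitrary: w n n' rule: less_induct)
  case less
  have "open_block \<kappa> a (Suc n) (take s w) = open_block \<kappa> a (Suc n') (take s w)" if "s < length w" for s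
    using less[of "take s w" "Suc n" "Suc n'"] that by simp
  then show ?case
    unfolding open_block.simps[of \<kappa> a n] open_block.simps[of \<kappa> a n'] assms
    by (intro arg_cong2[where f = "(+)"] sum.cong refl) auto
qed

lemma free_moment_mp:
  assumes "0 < c"
  shows "free_moment (block_cumulant (complex_of_real c)) (replicate n False) = complex_of_real (mp_moment c n)"
proof (induction n rule: less_induct)
  case (less n)
  let ?\<kappa> = "block_cumulant (complex_of_real c)"
  show ?case
  proof (cases n)
    case 0
    then show ?thesis by (simp add: mp_moment_def[OF assms])
  next
    case (Suc l)
    \<comment> \<open>Size 2 may be lowered to 1, and an open block of size 1 is a moment with one
      further letter.\<close>
    have "open_block ?\<kappa> False 2 (replicate k False) = free_moment ?\<kappa> (replicate (Suc k) False)" for k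
      using open_block_constant[of ?\<kappa> False "complex_of_real c" 2 "replicate k False" 1]
      by (simp add: block_cumulant_def)
    then have "free_moment ?\<kappa> (replicate n False) = complex_of_real c * free_moment ?\<kappa> (replicate l False) +
        (\<Sum>k<l. free_moment ?\<kappa> (replicate (Suc k) False) * free_moment ?\<kappa> (replicate (l - Suc k) False))"
      using open_block_replicate[of ?\<kappa> False 1 l] by (simp add: Suc block_cumulant_def numeral_2_eq_2)
    also have "\<dots> = complex_of_real (c * mp_moment c l + (\<Sum>k<l. mp_moment c (Suc k) * mp_moment c (l - Suc k)))"
      using less by (simp add: Suc del: replicate_Suc)
    also have "\<dots> = complex_of_real (mp_moment c n)"
      unfolding Suc mp_moment_recursion[OF assms, of l] ..
    finally show ?thesis .
  qed
qed

theorem theorem3: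
  fixes M :: "nat \<Rightarrow> 'a measure" and d p :: "nat \<Rightarrow> nat" and c :: real
    and g :: "nat \<Rightarrow> nat \<Rightarrow> nat \<Rightarrow> nat \<Rightarrow> 'a \<Rightarrow> complex"
  assumes "0 < c"
    and "filterlim d at_top sequentially"
    and "filterlim p at_top sequentially"
    and "(\<lambda>n. real (p n) / (2 * real (d n))) \<longlonglongrightarrow> c"
    and "\<And>n. prob_space (M n)"
    and "\<And>n. prob_space.indep_vars (M n) (\<lambda>_. borel) (\<lambda>(i, r, k). g n i r k)
               ({1, 2} \<times> {..<d n} \<times> {..<p n})"
    and "\<And>n i r k. i \<in> {1, 2} \<Longrightarrow> r < d n \<Longrightarrow> k < p n \<Longrightarrow>
           complex_gaussian (M n) (g n i r k) \<and>
           (\<integral>\<omega>. g n i r k \<omega> \<partial>M n) = 0 \<and>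
           (\<integral>\<omega>. (cmod (g n i r k \<omega>))\<^sup>2 \<partial>M n) = 1"
  shows
    "(\<exists>(A :: (nat \<Rightarrow> 'a \<Rightarrow> complex mat) star_algebra) \<phi> a.
        wishart_limit M d p g A \<phi> a \<and>
        (let e = (\<lambda>i j. a (E i j)); w = (\<lambda>i j. 2 \<odot>\<^bsub>A\<^esub> block_entry A e (a W) i j)
         in a W = (1 / 2) \<odot>\<^bsub>A\<^esub> block_element A e (\<lambda>i j. w i j) \<and>
            a WL = (1 / 2) \<odot>\<^bsub>A\<^esub> block_element A e (\<lambda>i j. w j i)))
     \<and>
     (\<forall>(A :: 'b star_algebra) \<phi> a.
        wishart_limit M d p g A \<phi> a \<longrightarrow>
        (let e = (\<lambda>i j. a (E i j)); w = (\<lambda>i j. 2 \<odot>\<^bsub>A\<^esub> block_entry A e (a W) i j);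
             X1 = block_element A e (\<lambda>i j. if i = j then w i j else \<zero>\<^bsub>A\<^esub>);
             X2 = block_element A e (\<lambda>i j. if i \<noteq> j then w j i else \<zero>\<^bsub>A\<^esub>)
         in free_elements A \<phi> {1, 2 :: nat} (\<lambda>i. if i = 1 then X1 else X2) \<and>
            has_distribution A \<phi> X1 (marchenko_pastur (2 * c)) \<and>
            (\<forall>n\<ge>1. element_free_cumulant A \<phi> X1 n = complex_of_real (2 * c)) \<and>
            even_element A \<phi> X2 \<and>
            (\<forall>n\<ge>1. element_free_cumulant A \<phi> X2 (2 * n) = complex_of_real (2 * c))))"
proof -
  let ?c = "complex_of_real (2 * c)" and ?\<kappa> = "block_cumulant (complex_of_real (2 * c))"
  have c: "0 < 2 * c" using assms(1) by simp
  have blocks: "wishart_blocks (M n) (d n) (p n) (g n)" for n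
  proof (intro wishart_blocks.intro complex_gaussian_family.intro assms(5)
      complex_gaussian_family_axioms.intro assms(6))
    fix x :: "nat \<times> nat \<times> nat" assume "x \<in> {1, 2} \<times> {..<d n} \<times> {..<p n}"
    then obtain i r k where x: "x = (i, r, k)" and irk: "i \<in> {1, 2}" "r < d n" "k < p n"
      by (metis SigmaE lessThan_iff)
    show "complex_gaussian (M n) (case x of (i, r, k) \<Rightarrow> g n i r k)"
      "(\<integral>\<omega>. (case x of (i, r, k) \<Rightarrow> g n i r k) \<omega> \<partial>M n) = 0"
      "(\<integral>\<omega>. (cmod ((case x of (i, r, k) \<Rightarrow> g n i r k) \<omega>))\<^sup>2 \<partial>M n) = 1"
      using assms(7)[OF irk] by (simp_all add: x)
  qed simp
  \<comment> \<open>The limit of traces is governed by p / d, which is twice the ratio p / (2 d) of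
    the hypothesis; this is where the parameter \<open>2 * c\<close> comes from.\<close>
  have "(\<lambda>n. 2 * (real (p n) / (2 * real (d n)))) \<longlonglongrightarrow> 2 * c"
    by (intro tendsto_mult_left assms(4))
  then have "(\<lambda>n. complex_of_real (2 * (real (p n) / (2 * real (d n))))) \<longlonglongrightarrow> ?c"
    by (rule tendsto_of_real)
  then have ratio: "(\<lambda>n. of_nat (p n) / of_nat (d n) :: complex) \<longlonglongrightarrow> ?c"
    by simp
  interpret wishart_sequence M d p g ?c
    by (intro wishart_sequence.intro blocks assms(2) ratio)
  show ?thesis
  proof (intro conjI allI impI)
    show "\<exists>(A :: (nat \<Rightarrow> 'a \<Rightarrow> complex mat) star_algebra) \<phi> a.
        wishart_limit M d p g A \<phi> a \<and>
        (let e = (\<lambda>i j. a (E i j)); w = (\<lambda>i j. 2 \<odot>\<^bsub>A\<^esub> block_entry A e (a W) i j)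
         in a W = (1 / 2) \<odot>\<^bsub>A\<^esub> block_element A e (\<lambda>i j. w i j) \<and>
            a WL = (1 / 2) \<odot>\<^bsub>A\<^esub> block_element A e (\<lambda>i j. w j i))"
      unfolding Let_def
      by (intro exI[of _ BA] exI[of _ block_state] exI[of _ wfam] conjI
          wfam_wishart_limit wfam_W_blocks wfam_WL_blocks)
  next
    fix A :: "'b star_algebra" and \<phi> a
    assume lim: "wishart_limit M d p g A \<phi> a"
    define e where "e = (\<lambda>i j. a (E i j))"
    define w where "w = (\<lambda>i j. 2 \<odot>\<^bsub>A\<^esub> block_entry A e (a W) i j)"
    define X where "X = (\<lambda>b. if b then block_element A e (\<lambda>i j. if i \<noteq> j then w j i else \<zero>\<^bsub>A\<^esub>)
      else block_element A e (\<lambda>i j. if i = j then w i j else \<zero>\<^bsub>A\<^esub>))"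
    note limit = wishart_limit_word_state[OF lim]
    interpret P: star_prob_space A \<phi> by (rule limit(1))
    have X: "X b \<in> carrier A" "adj A (X b) = X b" for b
      unfolding X_def w_def e_def by (rule limit(2), rule limit(3))
    have mom: "\<phi> (P.word_product X u) = free_moment ?\<kappa> u" for u
      unfolding X_def w_def e_def by (rule limit(4))
    have pow: "\<phi> (X b [^]\<^bsub>A\<^esub> n) = free_moment ?\<kappa> (replicate n b)" for b and n :: nat
      using mom[of "replicate n b"] by (simp only: P.word_product_replicate[OF X(1)])
    have cum: "element_free_cumulant A \<phi> (X b) n = ?\<kappa> b n" if "1 \<le> n" for b n
      unfolding element_free_cumulant_def pow by (rule free_cumulant_free_moment[OF that])
    have free: "free_elements A \<phi> {1, 2 :: nat} (\<lambda>i. if i = 1 then X False else X True)"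
      by (rule P.free_elements_of_free_moments[OF X(1) mom])
    have dist: "has_distribution A \<phi> (X False) (marchenko_pastur (2 * c))"
      unfolding has_distribution_def
    proof (intro conjI allI X)
      fix n :: nat
      note mp = marchenko_pastur_moments[OF c, of n]
      show "integrable (marchenko_pastur (2 * c)) (\<lambda>t. t ^ n)" using mp by (simp only: has_bochner_integral_iff)
      show "\<phi> (X False [^]\<^bsub>A\<^esub> n) = complex_of_real (\<integral>t. t ^ n \<partial>marchenko_pastur (2 * c))"
        unfolding pow free_moment_mp[OF c] has_bochner_integral_integral_eq[OF mp] ..
    qed
    have even: "even_element A \<phi> (X True)"
      unfolding even_element_def
    proof (intro conjI allI impI X)
      fix n :: nat assume "odd n"
      moreover have "count_list (replicate n True) True = n" by (induction n) auto
      ultimately show "\<phi> (X True [^]\<^bsub>A\<^esub> n) = 0"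
        unfolding pow using block_moment_odd[of "replicate n True" ?c] by simp
    qed
    have cum1: "\<forall>n\<ge>1. element_free_cumulant A \<phi> (X False) n = ?c"
      using cum[of _ False] by (simp add: block_cumulant_def)
    have cum2: "\<forall>n\<ge>1. element_free_cumulant A \<phi> (X True) (2 * n) = ?c"
    proof (intro allI impI)
      fix n :: nat assume "1 \<le> n"
      then show "element_free_cumulant A \<phi> (X True) (2 * n) = ?c"
        using cum[of "2 * n" True] by (simp add: block_cumulant_def)
    qed
    have XX: "X False = block_element A e (\<lambda>i j. if i = j then w i j else \<zero>\<^bsub>A\<^esub>)"
      "X True = block_element A e (\<lambda>i j. if i \<noteq> j then w j i else \<zero>\<^bsub>A\<^esub>)"
      by (simp_all add: X_def)
    show "let e = (\<lambda>i j. a (E i j)); w = (\<lambda>i j. 2 \<odot>\<^bsub>A\<^esub> block_entry A e (a W) i j);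
             X1 = block_element A e (\<lambda>i j. if i = j then w i j else \<zero>\<^bsub>A\<^esub>);
             X2 = block_element A e (\<lambda>i j. if i \<noteq> j then w j i else \<zero>\<^bsub>A\<^esub>)
         in free_elements A \<phi> {1, 2 :: nat} (\<lambda>i. if i = 1 then X1 else X2) \<and>
            has_distribution A \<phi> X1 (marchenko_pastur (2 * c)) \<and>
            (\<forall>n\<ge>1. element_free_cumulant A \<phi> X1 n = complex_of_real (2 * c)) \<and>
            even_element A \<phi> X2 \<and>
            (\<forall>n\<ge>1. element_free_cumulant A \<phi> X2 (2 * n) = complex_of_real (2 * c))"
      unfolding Let_def e_def[symmetric]
      by (intro conjI free[unfolded XX w_def] dist[unfolded XX w_def] cum1[unfolded XX w_def]
          even[unfolded XX w_def] cum2[unfolded XX w_def])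
  qed
qed

end
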